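(* Let $\epsilon\in[0,1)$, $t_0^s\in\mathbb{R}$ and $k\ge2$. (a) Fix an integer $n\ge k$. For every $\delta>0$ there exists $q_0>0$ such that for every prime power $q\ge q_0$, a random $(n,k)$-coding scheme $\mathcal{C}$ over $q\mathrm{EC}(\epsilon)$ almost surely satisfies $$\left|\Delta_{\epsilon,\mathcal{C}}-\Delta^{lb}_{\epsilon,(n,k)}\right|<\delta .$$ (b) For each prime power $q$ and $n\ge k$ let $\Delta_{\epsilon,(n,k)}$ denote the almost sure (constant) value of the average age $\Delta_{\epsilon,\mathcal{C}}$ of a random $(n,k)$-coding scheme over $q\mathrm{EC}(\epsilon)$, and let $\Delta^{lin}_\epsilon$ denote the optimal average age among linear block codes over $q\mathrm{EC}(\epsilon)$. Then $$\Delta^{lin}_\epsilon-\min_{n\ge k}\Delta_{\epsilon,(n,k)}\longrightarrow 0\quad\text{as } q\to\infty \text{ through prime powers}.$$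
   Context: Setting: $q\mathrm{EC}(\epsilon)$ is the memoryless erasure channel with input alphabet $\mathbb{F}_q$: each input is independently erased with probability $\epsilon$ and otherwise received unchanged and instantaneously. The $i$-th channel use ($i\ge1$) takes place at time $i$. The source message $U_m\in\mathbb{F}_q^k$ is generated at time $m+t_0^s$ (indices $m\in\mathbb{Z}$). $(n,k)$-scheme induced by linear encoders $F_l(u)=u^T\mathbf{G}_l$, $\mathbf{G}_l\in\mathbb{F}_q^{k\times n}$, $l\ge1$: the $l$-th transmitted message is $U_{m(l)}$ with $m(l)=\lfloor (l-1)n+1-t_0^s\rfloor$; the $n$ coordinates of $F_l(U_{m(l)})$ are sent in order at channel uses $(l-1)n+1,\dots,ln$. All other source messages are discarded. The $l$-th transmitted message is decoded at the first channel use of its block (if any) at which it is uniquely determined by the non-erased symbols of the block received so far (i.e. the corresponding columns of $\mathbf{G}_l$ span $\mathbb{F}_q^k$); otherwise it is lost. Random $(n,k)$-scheme: all columns of all $\mathbf{G}_l$ are independent and uniform on $\mathbb{F}_q^k\setminus\{0\}$, independent of the erasures, and known to encoder and decoder; "almost surely" is over this choice and the erasures. Age: at time $t$ the instantaneous age is $\Delta_{\epsilon,\mathcal{C}}(t)=t-(m(l)+t_0^s)$, where $l$ is the most recent transmitted message decoded at or before time $t$; before the first decoding it equals $a_0+t$ for a fixed constant $a_0$. The average age is the almost sure limit $\Delta_{\epsilon,\mathcal{C}}=\lim_{\tau\to\infty}\frac1\tau\int_0^\tau\Delta_{\epsilon,\mathcal{C}}(t)\,dt$. $\Delta^{lin}_\epsilon$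 (which depends on $q$) is the infimum of $\Delta_{\epsilon,\mathcal{C}}$ over all $n\ge k$ and all $(n,k)$-schemes induced by (deterministic) sequences of $(n,k)$-linear encoders for which the limit exists and is almost surely constant. Lower bound: let $\tilde B$ and $\tilde{\tilde B}$ be sums of $k$, respectively $k+1$, i.i.d. geometric random variables on $\{1,2,\dots\}$ with success probability $1-\epsilon$. With $[x]=x-\lfloor x\rfloor$, $$\Delta^{lb}_{\epsilon,(n,k)}=\frac{2n(1-\epsilon)-(1-\epsilon)(n+2)\mathbb{P}(\tilde B\le n)+2k\,\mathbb{P}(\tilde{\tilde B}\le n+1)}{2(1-\epsilon)\mathbb{P}(\tilde B\le n)}+[-t_0^s].$$ *)

theory Defs
  imports
    "HOL-Probability.Probability"
    "HOL-Algebra.Ring"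
    "HOL-Number_Theory.Prime_Powers"
begin

text \<open>
  The field size has to vary inside the statement, so the finite field is a carrier-based
  structure \<open>F :: 'a ring\<close>; for infinite \<open>'a\<close>, such as \<open>nat\<close>, these cover all finite fields up to
  isomorphism.  Vectors in \<open>F\<^sup>k\<close> are extensional functions on \<open>{..<k}\<close>.  An encoder
  sequence is a function \<open>G\<close> where \<open>G l j\<close> is the \<open>j\<close>-th column (\<open>1 \<le> j \<le> n\<close>) of the generator
  matrix of block \<open>l \<ge> 1\<close>.  An erasure pattern is a function \<open>e\<close> where \<open>e i\<close> says that the symbol
  sent at channel use \<open>i \<ge> 1\<close> is erased.
\<close>

definition galois_field :: "nat \<Rightarrow> 'a ring \<Rightarrow> bool" where
  "galois_field q F \<longleftrightarrow> field F \<and> finite (carrier F) \<and> card (carrier F) = q"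

definition vectors :: "'a ring \<Rightarrow> nat \<Rightarrow> (nat \<Rightarrow> 'a) set" where
  "vectors F k = {..<k} \<rightarrow>\<^sub>E carrier F"

definition zero_vector :: "'a ring \<Rightarrow> nat \<Rightarrow> nat \<Rightarrow> 'a" where
  "zero_vector F k = (\<lambda>i\<in>{..<k}. \<zero>\<^bsub>F\<^esub>)"


section \<open>Coding schemes and decoding\<close>

definition linear_encoders ::
    "'a ring \<Rightarrow> nat \<Rightarrow> nat \<Rightarrow> (nat \<Rightarrow> nat \<Rightarrow> nat \<Rightarrow> 'a) \<Rightarrow> bool" where
  "linear_encoders F k n G \<longleftrightarrow> (\<forall>l\<ge>1. \<forall>j\<in>{1..n}. G l j \<in> vectors F k)"

text \<open>The \<open>j\<close>-th coordinate of \<open>u\<^sup>T M\<close>, for a matrix \<open>M\<close> with columns \<open>M j\<close>.\<close>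

definition encode :: "'a ring \<Rightarrow> nat \<Rightarrow> (nat \<Rightarrow> nat \<Rightarrow> 'a) \<Rightarrow> (nat \<Rightarrow> 'a) \<Rightarrow> nat \<Rightarrow> 'a" where
  "encode F k M u j = (\<Oplus>\<^bsub>F\<^esub>i\<in>{..<k}. u i \<otimes>\<^bsub>F\<^esub> M j i)"

text \<open>
  The message is uniquely determined by the codeword symbols at the positions \<open>J\<close>.  Since encoding
  is linear, this does not depend on which message was sent, and it means that the columns
  \<open>M j\<close> with \<open>j \<in> J\<close> span \<open>F\<^sup>k\<close>.
\<close>

definition decodable :: "'a ring \<Rightarrow> nat \<Rightarrow> (nat \<Rightarrow> nat \<Rightarrow> 'a) \<Rightarrow> nat set \<Rightarrow> bool" where
  "decodable F k M J \<longleftrightarrow>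
     (\<forall>u\<in>vectors F k. \<forall>v\<in>vectors F k. (\<forall>j\<in>J. encode F k M u j = encode F k M v j) \<longrightarrow> u = v)"

definition channel_use :: "nat \<Rightarrow> nat \<Rightarrow> nat \<Rightarrow> nat" where
  "channel_use n l j = (l - 1) * n + j"

definition received :: "nat \<Rightarrow> (nat \<Rightarrow> bool) \<Rightarrow> nat \<Rightarrow> nat \<Rightarrow> nat set" where
  "received n e l j = {j'\<in>{1..j}. \<not> e (channel_use n l j')}"

text \<open>Block \<open>l\<close> is decoded exactly at its \<open>j\<close>-th channel use.\<close>

definition decoded_at ::
    "'a ring \<Rightarrow> nat \<Rightarrow> nat \<Rightarrow> (nat \<Rightarrow> nat \<Rightarrow> nat \<Rightarrow> 'a) \<Rightarrow> (nat \<Rightarrow> bool) \<Rightarrow> nat \<Rightarrow> nat \<Rightarrow> bool" where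
  "decoded_at F k n G e l j \<longleftrightarrow>
     j \<in> {1..n} \<and> decodable F k (G l) (received n e l j) \<and>
     (\<forall>j'\<in>{1..<j}. \<not> decodable F k (G l) (received n e l j'))"

definition decoded_blocks ::
    "'a ring \<Rightarrow> nat \<Rightarrow> nat \<Rightarrow> (nat \<Rightarrow> nat \<Rightarrow> nat \<Rightarrow> 'a) \<Rightarrow> (nat \<Rightarrow> bool) \<Rightarrow> real \<Rightarrow> nat set" where
  "decoded_blocks F k n G e t =
     {l. l \<ge> 1 \<and> (\<exists>j. decoded_at F k n G e l j \<and> real (channel_use n l j) \<le> t)}"


section \<open>Age\<close>

definition message_index :: "nat \<Rightarrow> real \<Rightarrow> nat \<Rightarrow> int" where
  "message_index n t0 l = \<lfloor>(real l - 1) * real n + 1 - t0\<rfloor>"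

text \<open>
  Blocks are decoded in the order in which they are sent, so the most recently decoded one is the
  one with the largest index.  The parameter \<open>a0\<close> is the age at time 0.
\<close>

definition age ::
    "'a ring \<Rightarrow> nat \<Rightarrow> nat \<Rightarrow> real \<Rightarrow> real \<Rightarrow> (nat \<Rightarrow> nat \<Rightarrow> nat \<Rightarrow> 'a) \<Rightarrow> (nat \<Rightarrow> bool) \<Rightarrow> real \<Rightarrow> real"
  where
  "age F k n t0 a0 G e t =
     (if decoded_blocks F k n G e t = {} then a0 + t
      else t - (of_int (message_index n t0 (Max (decoded_blocks F k n G e t))) + t0))"

definition has_average :: "(real \<Rightarrow> real) \<Rightarrow> real \<Rightarrow> bool" where
  "has_average f c \<longleftrightarrow> ((\<lambda>\<tau>. 1 / \<tau> * integral {0..\<tau>} f) \<longlongrightarrow> c) at_top"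


section \<open>Erasures and random schemes\<close>

definition erasures :: "real \<Rightarrow> (nat \<Rightarrow> bool) measure" where
  "erasures \<epsilon> = (\<Pi>\<^sub>M i\<in>{1..}. measure_pmf (bernoulli_pmf \<epsilon>))"

definition random_encoders :: "'a ring \<Rightarrow> nat \<Rightarrow> nat \<Rightarrow> (nat \<Rightarrow> nat \<Rightarrow> nat \<Rightarrow> 'a) measure" where
  "random_encoders F k n =
     (\<Pi>\<^sub>M l\<in>{1..}. \<Pi>\<^sub>M j\<in>{1..n}. measure_pmf (pmf_of_set (vectors F k - {zero_vector F k})))"

definition random_scheme ::
    "'a ring \<Rightarrow> real \<Rightarrow> nat \<Rightarrow> nat \<Rightarrow> ((nat \<Rightarrow> nat \<Rightarrow> nat \<Rightarrow> 'a) \<times> (nat \<Rightarrow> bool)) measure" where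
  "random_scheme F \<epsilon> k n = random_encoders F k n \<Otimes>\<^sub>M erasures \<epsilon>"

definition random_average_age ::
    "'a ring \<Rightarrow> real \<Rightarrow> nat \<Rightarrow> real \<Rightarrow> real \<Rightarrow> nat \<Rightarrow> real" where
  "random_average_age F \<epsilon> k t0 a0 n =
     (THE c. AE (G, e) in random_scheme F \<epsilon> k n. has_average (age F k n t0 a0 G e) c)"

definition linear_average_ages :: "'a ring \<Rightarrow> real \<Rightarrow> nat \<Rightarrow> real \<Rightarrow> real \<Rightarrow> real set" where
  "linear_average_ages F \<epsilon> k t0 a0 =
     {c. \<exists>n\<ge>k. \<exists>G. linear_encoders F k n G \<and>
           (AE e in erasures \<epsilon>. has_average (age F k n t0 a0 G e) c)}"

definition optimal_linear_age :: "'a ring \<Rightarrow> real \<Rightarrow> nat \<Rightarrow> real \<Rightarrow> real \<Rightarrow> real" where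
  "optimal_linear_age F \<epsilon> k t0 a0 = Inf (linear_average_ages F \<epsilon> k t0 a0)"


section \<open>The lower bound\<close>

text \<open>\<open>geometric_pmf\<close> counts failures only, hence the shift by one.\<close>

definition geometric_sum_pmf :: "nat \<Rightarrow> real \<Rightarrow> nat pmf" where
  "geometric_sum_pmf r p = map_pmf sum_list (replicate_pmf r (map_pmf Suc (geometric_pmf p)))"

definition age_lower_bound :: "real \<Rightarrow> nat \<Rightarrow> real \<Rightarrow> nat \<Rightarrow> real" where
  "age_lower_bound \<epsilon> k t0 n =
     (let P1 = measure_pmf.prob (geometric_sum_pmf k (1 - \<epsilon>)) {..n};
          P2 = measure_pmf.prob (geometric_sum_pmf (k + 1) (1 - \<epsilon>)) {..n + 1}
      in (2 * real n * (1 - \<epsilon>) - (1 - \<epsilon>) * (real n + 2) * P1 + 2 * real k * P2)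
           / (2 * (1 - \<epsilon>) * P1) + frac (- t0))"

end

theory Submission
  imports Defs "HOL-Real_Asymp.Real_Asymp"
begin

text \<open>
  Let \<open>D\<^sub>i\<close> be the position at which block \<open>i\<close> is decoded (a value above \<open>n\<close> if it is lost), and \<open>X\<^sub>i\<close> the
  distance from block \<open>i\<close> to the last decoded block before it. During block \<open>i\<close> the age drops by
  \<open>n X\<^sub>i\<close> at position \<open>D\<^sub>i\<close>, so its average is an explicit constant plus the average of
  \<open>X\<^sub>i min(D\<^sub>i, n)\<close>. For independent \<open>D\<^sub>i\<close> with \<open>P(D\<^sub>i \<le> n) = p\<close> and \<open>E min(D\<^sub>i, n) = \<mu>\<close> the latter converges
  almost surely to \<open>\<mu> / p\<close>. The lower bound is the value of this for the idealized decoder that needs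
  any \<open>k\<close> symbols: by counting messages it is pathwise at least as fast as every linear code, and a
  random block deviates from it with probability \<open>O(1/q)\<close>, since all \<open>k\<close>-subsets of its columns are
  bases except with that probability. Since the lower bound grows linearly in \<open>n\<close>, its minimum over
  \<open>n\<close> is attained, and the random scheme for the minimizing \<open>n\<close> is nearly optimal.
\<close>

section \<open>A law of large numbers for renewal rewards\<close>

text \<open>The products \<open>X_i min(D_i, n)\<close> are dependent through the gaps, so a law of
  large numbers for independent terms does not apply to them. The remedy is a correction term that
  turns the centred sum, up to a boundary term, into a martingale. Its orthogonal increments give a
  second moment of order N, which suffices for almost sure convergence because the summands are
  nonnegative. The limit \<mu> / p is the natural one: \<open>X_i\<close> depends only on the past,
  hence is independent of \<open>D_i\<close>, and its mean tends to 1 / p. The sum of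
  \<open>k + 1\<close> geometric variables in the lower bound is a size-biasing effect: weighting
  the law of the k-th success time by its value gives a multiple of the law of the next success
  time, shifted by one. Two points concern q. The O(1/q) estimate is void for small fields, so the
  positive decoding probability, and with it the existence of the average age, is shown separately
  for every field. And the minimizing n of the lower bound does not depend on q, so closeness for
  this one n settles the limit.\<close>

lemma tendsto_average_from_squares:
  fixes s :: "nat \<Rightarrow> real"
  assumes mono: "mono s" and nonneg: "\<And>N. 0 \<le> s N"
    and lim: "(\<lambda>m. s (m\<^sup>2) / (real m)\<^sup>2) \<longlonglongrightarrow> c"
  shows "(\<lambda>N. s N / real N) \<longlonglongrightarrow> c"
proof -
  \<comment> \<open>\<open>r N\<close> is the integer square root of \<open>N\<close>. Consecutive
    squares have ratio tending to 1, so monotonicity traps \<open>s N / N\<close> between its values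
    along the squares.\<close>
  define r where "r N = nat \<lfloor>sqrt (real N)\<rfloor>" for N
  have r_lower: "(r N)\<^sup>2 \<le> N" for N
  proof -
    have "real (r N) \<le> sqrt (real N)" by (simp add: r_def)
    then have "(real (r N))\<^sup>2 \<le> (sqrt (real N))\<^sup>2" by (intro power_mono) auto
    then show ?thesis by (simp flip: of_nat_power)
  qed
  have r_upper: "N \<le> (Suc (r N))\<^sup>2" for N
  proof -
    have "sqrt (real N) \<le> real (Suc (r N))" by (simp add: r_def) linarith
    then have "(sqrt (real N))\<^sup>2 \<le> (real (Suc (r N)))\<^sup>2" by (intro power_mono) auto
    then show ?thesis by (simp flip: of_nat_power del: of_nat_Suc)
  qed
  have r_lim: "filterlim r at_top at_top"
    unfolding r_def by real_asymp
  let ?lo = "\<lambda>m. s (m\<^sup>2) / (real m)\<^sup>2 * ((real m)\<^sup>2 / (real (Suc m))\<^sup>2)"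
  let ?hi = "\<lambda>m. s ((Suc m)\<^sup>2) / (real (Suc m))\<^sup>2 * ((real (Suc m))\<^sup>2 / (real m)\<^sup>2)"
  have "?lo \<longlonglongrightarrow> c * 1"
    by (intro tendsto_mult lim) real_asymp
  then have lo: "(\<lambda>N. ?lo (r N)) \<longlonglongrightarrow> c"
    using filterlim_compose[OF _ r_lim] by simp
  have "?hi \<longlonglongrightarrow> c * 1"
    by (intro tendsto_mult LIMSEQ_Suc[OF lim]) real_asymp
  then have hi: "(\<lambda>N. ?hi (r N)) \<longlonglongrightarrow> c"
    using filterlim_compose[OF _ r_lim] by simp
  have ev: "eventually (\<lambda>N. 1 \<le> r N) at_top"
    using r_lim by (simp add: filterlim_at_top)
  show ?thesis
  proof (rule tendsto_sandwich[OF _ _ lo hi])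
    show "eventually (\<lambda>N. ?lo (r N) \<le> s N / real N) sequentially"
      using ev
    proof eventually_elim
      case (elim N)
      have N: "0 < N" using r_lower[of N] elim by (metis gr0I le_zero_eq not_one_le_zero power_eq_0_iff)
      have "?lo (r N) = s ((r N)\<^sup>2) / (real (Suc (r N)))\<^sup>2" using elim by simp
      also have "\<dots> \<le> s N / real N"
        using N nonneg r_upper[of N] monoD[OF mono r_lower[of N]]
        by (intro frac_le) (auto simp flip: of_nat_power of_nat_Suc)
      finally show ?case .
    qed
    show "eventually (\<lambda>N. s N / real N \<le> ?hi (r N)) sequentially"
      using ev
    proof eventually_elim
      case (elim N)
      have "s N / real N \<le> s ((Suc (r N))\<^sup>2) / (real (r N))\<^sup>2"
        using elim nonneg r_lower[of N] monoD[OF mono r_upper[of N]]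
        by (intro frac_le) (auto simp flip: of_nat_power)
      also have "\<dots> = ?hi (r N)" using elim by (simp del: of_nat_Suc)
      finally show ?case .
    qed
  qed
qed

text \<open>Along squares N = m^2 the normalized second moments are of order 1 / m^2, hence
  summable. So the series of squared deviations has finite expectation, is finite almost surely, and
  its terms vanish. Nonnegativity makes the partial sums monotone, which fills in the times between
  squares.\<close>

lemma (in prob_space) AE_tendsto_average_of_second_moment:
  fixes Z :: "nat \<Rightarrow> 'a \<Rightarrow> real"
  assumes [measurable]: "\<And>i. random_variable borel (Z i)"
    and nonneg: "\<And>i \<omega>. 0 \<le> Z i \<omega>"
    and int: "\<And>N. integrable M (\<lambda>\<omega>. ((\<Sum>i<N. Z i \<omega>) - c * real N)\<^sup>2)"
    and bound: "\<And>N. expectation (\<lambda>\<omega>. ((\<Sum>i<N. Z i \<omega>) - c * real N)\<^sup>2) \<le> C * real N + C"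
  shows "AE \<omega> in M. (\<lambda>N. (\<Sum>i<N. Z i \<omega>) / real N) \<longlonglongrightarrow> c"
proof -
  define s where "s \<omega> N = (\<Sum>i<N. Z i \<omega>)" for \<omega> N
  have [measurable]: "(\<lambda>\<omega>. s \<omega> N) \<in> borel_measurable M" for N unfolding s_def by measurable
  define f where "f m \<omega> = ((s \<omega> ((Suc m)\<^sup>2) - c * real ((Suc m)\<^sup>2)) / (real (Suc m))\<^sup>2)\<^sup>2" for m \<omega>
  have [measurable]: "f m \<in> borel_measurable M" for m unfolding f_def by measurable
  have f_alt: "f m \<omega> = (s \<omega> ((Suc m)\<^sup>2) - c * real ((Suc m)\<^sup>2))\<^sup>2 / (real (Suc m)) ^ 4" for m \<omega>
    unfolding f_def power_divide by (simp flip: power_mult)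
  have f_int: "integrable M (f m)" for m
    unfolding f_alt[abs_def] using int[of "(Suc m)\<^sup>2"] by (simp add: s_def)
  have C0: "0 \<le> C" using bound[of 0] by simp
  have f_exp: "expectation (f m) \<le> 2 * C * (1 / (real (Suc m))\<^sup>2)" for m
  proof -
    let ?x = "real (Suc m)"
    have "expectation (f m) = expectation (\<lambda>\<omega>. (s \<omega> ((Suc m)\<^sup>2) - c * real ((Suc m)\<^sup>2))\<^sup>2) / ?x ^ 4"
      unfolding f_alt[abs_def] by simp
    also have "\<dots> \<le> (C * ?x\<^sup>2 + C) / ?x ^ 4"
      using bound[of "(Suc m)\<^sup>2"] by (intro divide_right_mono) (auto simp: s_def)
    also have "\<dots> \<le> (2 * C * ?x\<^sup>2) / ?x ^ 4"
    proof (intro divide_right_mono)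
      have "C * 1 \<le> C * ?x\<^sup>2" using C0 by (intro mult_left_mono one_le_power) auto
      then show "C * ?x\<^sup>2 + C \<le> 2 * C * ?x\<^sup>2" by simp
    qed auto
    also have "\<dots> = 2 * C * (1 / ?x\<^sup>2)"
      by (simp add: field_simps power2_eq_square power4_eq_xxxx del: of_nat_Suc)
    finally show ?thesis .
  qed
  have summ: "summable (\<lambda>m. 2 * C * (1 / (real (Suc m))\<^sup>2))"
    using inverse_power_summable[of 2, where 'a=real]
    by (intro summable_mult summable_Suc_iff[THEN iffD2]) (simp add: inverse_eq_divide)
  have "(\<integral>\<^sup>+\<omega>. (\<Sum>m. ennreal (f m \<omega>)) \<partial>M) = (\<Sum>m. \<integral>\<^sup>+\<omega>. ennreal (f m \<omega>) \<partial>M)"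
    by (intro nn_integral_suminf) measurable
  also have "\<dots> = (\<Sum>m. ennreal (expectation (f m)))"
    by (intro suminf_cong nn_integral_eq_integral f_int) (auto simp: f_def)
  also have "\<dots> \<le> (\<Sum>m. ennreal (2 * C * (1 / (real (Suc m))\<^sup>2)))"
    by (intro suminf_le ennreal_leI f_exp) auto
  also have "\<dots> < \<infinity>"
    using summ C0 by (simp add: suminf_ennreal2 less_top del: of_nat_Suc)
  finally have "(\<integral>\<^sup>+\<omega>. (\<Sum>m. ennreal (f m \<omega>)) \<partial>M) \<noteq> \<infinity>" by simp
  then have "AE \<omega> in M. (\<Sum>m. ennreal (f m \<omega>)) \<noteq> \<infinity>"
    by (intro nn_integral_PInf_AE) measurable
  then show ?thesis
  proof (rule AE_mp, intro AE_I2 impI)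
    fix \<omega> assume "(\<Sum>m. ennreal (f m \<omega>)) \<noteq> \<infinity>"
    then have "summable (\<lambda>m. f m \<omega>)"
      by (intro summable_suminf_not_top) (auto simp: f_def)
    then have "(\<lambda>m. sqrt (f m \<omega>)) \<longlonglongrightarrow> sqrt 0"
      by (intro tendsto_real_sqrt summable_LIMSEQ_zero)
    then have "(\<lambda>m. \<bar>(s \<omega> ((Suc m)\<^sup>2) - c * real ((Suc m)\<^sup>2)) / (real (Suc m))\<^sup>2\<bar>) \<longlonglongrightarrow> 0"
      by (simp add: f_def del: of_nat_Suc)
    then have "(\<lambda>m. (s \<omega> ((Suc m)\<^sup>2) - c * real ((Suc m)\<^sup>2)) / (real (Suc m))\<^sup>2) \<longlonglongrightarrow> 0"
      by (simp only: tendsto_rabs_zero_iff)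
    then have "(\<lambda>m. (s \<omega> ((Suc m)\<^sup>2) / (real (Suc m))\<^sup>2 - c)) \<longlonglongrightarrow> 0"
      by (simp add: diff_divide_distrib del: of_nat_Suc)
    then have "(\<lambda>m. s \<omega> ((Suc m)\<^sup>2) / (real (Suc m))\<^sup>2) \<longlonglongrightarrow> c"
      using LIM_zero_iff[of _ c sequentially] by blast
    then have "(\<lambda>m. s \<omega> (m\<^sup>2) / (real m)\<^sup>2) \<longlonglongrightarrow> c"
      by (rule LIMSEQ_imp_Suc)
    moreover have "mono (s \<omega>)"
      unfolding s_def by (intro monoI sum_mono2) (auto simp: nonneg)
    moreover have "0 \<le> s \<omega> N" for N unfolding s_def by (intro sum_nonneg nonneg)
    ultimately show "(\<lambda>N. (\<Sum>i<N. Z i \<omega>) / real N) \<longlonglongrightarrow> c"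
      using tendsto_average_from_squares[of "s \<omega>" c] by (simp add: s_def)
  qed
qed

text \<open>
  The distance from block \<open>i\<close> to the last block before it that is decoded (that is, \<open>d j \<le> n\<close>),
  where a fictitious block \<open>-1\<close> counts as decoded.
\<close>

primrec gap :: "nat \<Rightarrow> (nat \<Rightarrow> nat) \<Rightarrow> nat \<Rightarrow> nat" where
  "gap n d 0 = 1"
| "gap n d (Suc i) = Suc (if d i \<le> n then 0 else gap n d i)"

lemma gap_ge_1: "1 \<le> gap n d i"
  by (cases i) auto

lemma gap_le: "gap n d i \<le> Suc i"
  by (induction i) auto

lemma gap_cong: "(\<And>j. j < i \<Longrightarrow> d j = d' j) \<Longrightarrow> gap n d i = gap n d' i"
  by (induction i) auto

lemma gap_mono: "(\<And>j. d' j \<le> d j) \<Longrightarrow> gap n d' i \<le> gap n d i"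
proof (induction i)
  case (Suc i)
  then show ?case using le_trans[of "d' i" "d i" n] by auto
qed simp

text \<open>Since \<open>f\<close> sees only the coordinates below \<open>i\<close>, it factors
  through finitely many discrete variables, on which every function is measurable. Boundedness then
  supplies the integrability for the product rule.\<close>

lemma (in prob_space) indep_past_present_expectation:
  fixes D :: "nat \<Rightarrow> 'a \<Rightarrow> nat" and f :: "(nat \<Rightarrow> nat) \<Rightarrow> real" and h :: "nat \<Rightarrow> real"
  assumes indep: "indep_vars (\<lambda>_. count_space UNIV) D UNIV"
    and f_cong: "\<forall>d d'. (\<forall>j<i. d j = d' j) \<longrightarrow> f d = f d'"
    and f_bounded: "\<forall>d. \<bar>f d\<bar> \<le> B" and h_bounded: "\<forall>x. \<bar>h x\<bar> \<le> H"
  shows "integrable M (\<lambda>\<omega>. f (\<lambda>j. D j \<omega>))"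
    and "integrable M (\<lambda>\<omega>. f (\<lambda>j. D j \<omega>) * h (D i \<omega>))"
    and "expectation (\<lambda>\<omega>. f (\<lambda>j. D j \<omega>) * h (D i \<omega>))
           = expectation (\<lambda>\<omega>. f (\<lambda>j. D j \<omega>)) * expectation (\<lambda>\<omega>. h (D i \<omega>))"
proof -
  let ?N = "\<lambda>_::nat. count_space (UNIV :: nat set)"
  have discrete: "PiM A ?N = count_space (A \<rightarrow>\<^sub>E UNIV)" if "finite A" for A
    using that by (intro count_space_PiM_finite) auto
  have "indep_var (PiM {..<i} ?N) (\<lambda>\<omega>. restrict (\<lambda>j. D j \<omega>) {..<i}) (PiM {i} ?N) (\<lambda>\<omega>. restrict (\<lambda>j. D j \<omega>) {i})"
    by (intro indep_var_restrict[OF indep]) auto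
  then have "indep_var borel (f \<circ> (\<lambda>\<omega>. restrict (\<lambda>j. D j \<omega>) {..<i})) borel ((\<lambda>d. h (d i)) \<circ> (\<lambda>\<omega>. restrict (\<lambda>j. D j \<omega>) {i}))"
    by (rule indep_var_compose) (auto simp: discrete)
  moreover have "f \<circ> (\<lambda>\<omega>. restrict (\<lambda>j. D j \<omega>) {..<i}) = (\<lambda>\<omega>. f (\<lambda>j. D j \<omega>))"
    using f_cong by (auto simp: fun_eq_iff)
  ultimately have iv: "indep_var borel (\<lambda>\<omega>. f (\<lambda>j. D j \<omega>)) borel (\<lambda>\<omega>. h (D i \<omega>))"
    by (simp add: comp_def)
  have f: "integrable M (\<lambda>\<omega>. f (\<lambda>j. D j \<omega>))"
    using indep_var_rv1[OF iv] f_bounded by (intro integrable_const_bound[where B=B]) auto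
  have h: "integrable M (\<lambda>\<omega>. h (D i \<omega>))"
    using indep_var_rv2[OF iv] h_bounded by (intro integrable_const_bound[where B=H]) auto
  show "integrable M (\<lambda>\<omega>. f (\<lambda>j. D j \<omega>))" by (rule f)
  show "integrable M (\<lambda>\<omega>. f (\<lambda>j. D j \<omega>) * h (D i \<omega>))"
    by (rule indep_var_integrable[OF iv f h])
  show "expectation (\<lambda>\<omega>. f (\<lambda>j. D j \<omega>) * h (D i \<omega>))
           = expectation (\<lambda>\<omega>. f (\<lambda>j. D j \<omega>)) * expectation (\<lambda>\<omega>. h (D i \<omega>))"
    by (rule indep_var_lebesgue_integral[OF iv f h])
qed

text \<open>
  The sum minus its target \<open>\<mu> / p * N\<close> is, up to a boundary term, a sum of the orthogonal products
  \<open>h (D i) * gap i\<close> with \<open>h (D i)\<close> centred and independent of the past.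
\<close>

theorem (in prob_space) AE_renewal_average:
  fixes D :: "nat \<Rightarrow> 'a \<Rightarrow> nat"
  assumes indep: "indep_vars (\<lambda>_. count_space UNIV) D UNIV"
    and p: "\<And>i. prob {\<omega> \<in> space M. D i \<omega> \<le> n} = p" "0 < p"
    and \<mu>: "\<And>i. expectation (\<lambda>\<omega>. real (min (D i \<omega>) n)) = \<mu>"
  shows "AE \<omega> in M. (\<lambda>N. (\<Sum>i<N. real (gap n (\<lambda>j. D j \<omega>) i * min (D i \<omega>) n)) / real N) \<longlonglongrightarrow> \<mu> / p"
proof -
  define c where "c = \<mu> / p"
  define lost :: "nat \<Rightarrow> real" where "lost x = (if x \<le> n then 0 else 1)" for x
  \<comment> \<open>The \<open>lost\<close> part is the correction: since
    \<open>c * p = \<mu>\<close>, a summand minus \<open>c\<close> becomes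
    \<open>h (d i) * X i d\<close> plus the telescoping difference
    \<open>c * (X i d - X (Suc i) d)\<close>.\<close>
  define h where "h x = (real (min x n) - \<mu>) + c * (lost x - (1 - p))" for x
  define X where "X i d = real (gap n d i)" for i d
  define S where "S i d = (\<Sum>j<i. h (d j) * X j d)" for i d
  define H where "H = real n + \<bar>\<mu>\<bar> + \<bar>c\<bar> * (1 + \<bar>1 - p\<bar>)"
  \<comment> \<open>\<open>K\<close> is the fixed point of y = 1 + 2 / p + (1 - p) y, the recursion
    that bounds the second moments of \<open>X\<close>; likewise 1 / p is the fixed point for the
    first moments.\<close>
  define K where "K = (1 + 2 / p) / p"

  have rv[measurable]: "D i \<in> measurable M (count_space UNIV)" for i
    using indep by (auto simp: indep_vars_def)
  have h_bounded: "\<bar>h x\<bar> \<le> H" for x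
  proof -
    have "\<bar>c * (lost x - (1 - p))\<bar> \<le> \<bar>c\<bar> * (1 + \<bar>1 - p\<bar>)"
      unfolding abs_mult by (intro mult_left_mono) (auto simp: lost_def)
    then show ?thesis unfolding h_def H_def by (auto simp: min_def)
  qed
  then have H: "0 \<le> H" by (meson abs_ge_zero order_trans)
  have lost_bounded': "\<forall>x. \<bar>lost x\<bar> \<le> 1" by (simp add: lost_def)
  note lost_bounded = lost_bounded'[rule_format]
  have h_bounded': "\<forall>x. \<bar>h x\<bar> \<le> H" using h_bounded by blast
  have p_le_1: "p \<le> 1" using p(1)[of 0] prob_le_1 by metis
  have K: "0 \<le> K" using p(2) by (simp add: K_def)

  have X_Suc: "X (Suc i) d = 1 + lost (d i) * X i d" for i d by (simp add: X_def lost_def)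
  have X_ge: "1 \<le> X i d" for i d using gap_ge_1[of n d i] by (simp add: X_def)
  have X_bounded: "\<bar>X i d\<bar> \<le> real (Suc i)" for i d
    unfolding X_def using gap_le[of n d i] by (metis abs_of_nat of_nat_le_iff)
  have X_cong: "(\<And>j. j < i \<Longrightarrow> d j = d' j) \<Longrightarrow> X i d = X i d'" for i d d'
    unfolding X_def by (metis gap_cong)
  have S_cong: "S i d = S i d'" if "\<And>j. j < i \<Longrightarrow> d j = d' j" for i d d'
    unfolding S_def using that by (intro sum.cong refl arg_cong2[where f="(*)"] X_cong) auto
  have S_bounded: "\<bar>S i d\<bar> \<le> (\<Sum>j<i. H * real (Suc j))" for i d
    unfolding S_def
    by (intro order_trans[OF sum_abs] sum_mono) (auto simp: abs_mult simp del: of_nat_Suc intro!: mult_mono h_bounded X_bounded H)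

  note past = indep_past_present_expectation[OF indep]
  have X_cong': "\<forall>d d'. (\<forall>j<i. d j = d' j) \<longrightarrow> X i d = X i d'" for i
    using X_cong by blast
  have X_bounded': "\<forall>d. \<bar>X i d\<bar> \<le> real (Suc i)" for i
    using X_bounded by blast
  note X_facts = past[of i "X i" "real (Suc i)" for i, OF X_cong' X_bounded']
  have X2_cong: "(\<And>j. j < i \<Longrightarrow> d j = d' j) \<Longrightarrow> (X i d)\<^sup>2 = (X i d')\<^sup>2" for i d d' using X_cong by metis
  have X2_bounded: "\<bar>(X i d)\<^sup>2\<bar> \<le> (real (Suc i))\<^sup>2" for i d
    using power_mono[OF X_bounded, of i d 2] by (simp add: power2_abs)
  have X2_cong': "\<forall>d d'. (\<forall>j<i. d j = d' j) \<longrightarrow> (X i d)\<^sup>2 = (X i d')\<^sup>2" for i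
    using X2_cong by blast
  have X2_bounded': "\<forall>d. \<bar>(X i d)\<^sup>2\<bar> \<le> (real (Suc i))\<^sup>2" for i
    using X2_bounded by blast
  note X2_facts = past[of i "\<lambda>d. (X i d)\<^sup>2" "(real (Suc i))\<^sup>2" for i, OF X2_cong' X2_bounded']
  have S2_cong: "(\<And>j. j < i \<Longrightarrow> d j = d' j) \<Longrightarrow> (S i d)\<^sup>2 = (S i d')\<^sup>2" for i d d' using S_cong by metis
  have S2_bounded: "\<bar>(S i d)\<^sup>2\<bar> \<le> (\<Sum>j<i. H * real (Suc j))\<^sup>2" for i d
    using power_mono[OF S_bounded, of i d 2] by (simp add: power2_abs)
  have S2_cong': "\<forall>d d'. (\<forall>j<i. d j = d' j) \<longrightarrow> (S i d)\<^sup>2 = (S i d')\<^sup>2" for i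
    using S2_cong by blast
  have S2_bounded': "\<forall>d. \<bar>(S i d)\<^sup>2\<bar> \<le> (\<Sum>j<i. H * real (Suc j))\<^sup>2" for i
    using S2_bounded by blast
  note S2_facts = past[of i "\<lambda>d. (S i d)\<^sup>2" "(\<Sum>j<i. H * real (Suc j))\<^sup>2" for i, OF S2_cong' S2_bounded']
  have SX_cong: "(\<And>j. j < i \<Longrightarrow> d j = d' j) \<Longrightarrow> S i d * X i d = S i d' * X i d'" for i d d'
    using S_cong X_cong by metis
  have SX_bounded: "\<bar>S i d * X i d\<bar> \<le> (\<Sum>j<i. H * real (Suc j)) * real (Suc i)" for i d
    unfolding abs_mult by (intro mult_mono S_bounded X_bounded sum_nonneg mult_nonneg_nonneg H) auto
  have SX_cong': "\<forall>d d'. (\<forall>j<i. d j = d' j) \<longrightarrow> S i d * X i d = S i d' * X i d'" for i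
    using SX_cong by blast
  have SX_bounded': "\<forall>d. \<bar>S i d * X i d\<bar> \<le> (\<Sum>j<i. H * real (Suc j)) * real (Suc i)" for i
    using SX_bounded by blast
  note SX_facts = past[of i "\<lambda>d. S i d * X i d" "(\<Sum>j<i. H * real (Suc j)) * real (Suc i)" for i, OF SX_cong' SX_bounded']

  have E_lost: "expectation (\<lambda>\<omega>. lost (D i \<omega>)) = 1 - p" for i
  proof -
    have "(\<lambda>\<omega>. lost (D i \<omega>)) = (\<lambda>\<omega>. 1 - indicat_real {\<omega>. D i \<omega> \<le> n} \<omega>)"
      by (auto simp: lost_def fun_eq_iff)
    moreover have "expectation (indicat_real {\<omega>. D i \<omega> \<le> n}) = p"
      using p(1)[of i] by (simp add: Int_def conj_commute)
    moreover have "integrable M (indicat_real {\<omega>. D i \<omega> \<le> n})"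
      using p(1)[of i] p(2) by (intro integrable_const_bound[where B=1]) auto
    ultimately show ?thesis by (simp add: prob_space)
  qed
  have int_lost: "integrable M (\<lambda>\<omega>. lost (D i \<omega>))" for i
    by (intro integrable_const_bound[where B=1]) (auto simp: lost_bounded)
  have int_min: "integrable M (\<lambda>\<omega>. real (min (D i \<omega>) n))" for i
    by (intro integrable_const_bound[where B="real n"]) auto
  have E_h: "expectation (\<lambda>\<omega>. h (D i \<omega>)) = 0" for i
    unfolding h_def using int_lost[of i] int_min[of i] E_lost[of i] \<mu>[of i] by (simp add: prob_space)

  have EX: "expectation (\<lambda>\<omega>. X i (\<lambda>j. D j \<omega>)) \<le> 1 / p" for i
  proof (induction i)
    case 0
    then show ?case using p(2) p_le_1 by (simp add: X_def prob_space)
  next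
    case (Suc i)
    have "expectation (\<lambda>\<omega>. X (Suc i) (\<lambda>j. D j \<omega>)) = 1 + expectation (\<lambda>\<omega>. X i (\<lambda>j. D j \<omega>)) * (1 - p)"
      unfolding X_Suc using X_facts[OF lost_bounded', of i] E_lost[of i]
      by (simp add: prob_space mult.commute)
    also have "\<dots> \<le> 1 + 1 / p * (1 - p)"
      using Suc p_le_1 by (intro add_left_mono mult_right_mono) auto
    also have "\<dots> = 1 / p" using p(2) by (simp add: field_simps)
    finally show ?case .
  qed
  have X2_Suc: "(X (Suc i) d)\<^sup>2 = 1 + 2 * (X i d * lost (d i)) + (X i d)\<^sup>2 * lost (d i)" for i d
    unfolding X_Suc by (auto simp: power2_eq_square algebra_simps lost_def)
  have EX2: "expectation (\<lambda>\<omega>. (X i (\<lambda>j. D j \<omega>))\<^sup>2) \<le> K" for i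
  proof (induction i)
    case 0
    have "1 * 1 \<le> (1 + 2 / p) * (1 / p)" using p(2) p_le_1 by (intro mult_mono) auto
    then show ?case by (simp add: X_def prob_space K_def)
  next
    case (Suc i)
    have "expectation (\<lambda>\<omega>. (X (Suc i) (\<lambda>j. D j \<omega>))\<^sup>2)
        = 1 + 2 * (expectation (\<lambda>\<omega>. X i (\<lambda>j. D j \<omega>)) * (1 - p))
            + expectation (\<lambda>\<omega>. (X i (\<lambda>j. D j \<omega>))\<^sup>2) * (1 - p)"
      unfolding X2_Suc using X_facts[OF lost_bounded', of i] X2_facts[OF lost_bounded', of i] E_lost[of i]
      by (simp add: prob_space)
    also have "\<dots> \<le> 1 + 2 * (1 / p * 1) + K * (1 - p)"
      using Suc p(2) p_le_1 EX[of i] by (intro add_mono mult_left_mono mult_right_mono mult_mono order_refl) auto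
    also have "\<dots> = K" using p(2) by (simp add: K_def field_simps)
    finally show ?case .
  qed
  have S2_Suc: "(S (Suc i) d)\<^sup>2 = (S i d)\<^sup>2 + 2 * (S i d * X i d * h (d i)) + (X i d)\<^sup>2 * (h (d i))\<^sup>2" for i d
    by (simp add: S_def power2_eq_square algebra_simps)
  have h2_bounded: "\<bar>(h x)\<^sup>2\<bar> \<le> H\<^sup>2" for x
    using power_mono[OF h_bounded, of x 2] by (simp add: power2_abs)
  have h2_bounded': "\<forall>x. \<bar>(h x)\<^sup>2\<bar> \<le> H\<^sup>2" using h2_bounded by blast
  have E_h2: "expectation (\<lambda>\<omega>. (h (D i \<omega>))\<^sup>2) \<le> H\<^sup>2" "0 \<le> expectation (\<lambda>\<omega>. (h (D i \<omega>))\<^sup>2)" for i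
  proof -
    have "expectation (\<lambda>\<omega>. (h (D i \<omega>))\<^sup>2) \<le> expectation (\<lambda>\<omega>. H\<^sup>2)"
      using h2_bounded by (intro integral_mono integrable_const_bound[where B="H\<^sup>2"]) auto
    then show "expectation (\<lambda>\<omega>. (h (D i \<omega>))\<^sup>2) \<le> H\<^sup>2" by (simp add: prob_space)
  qed simp
  have ES2: "expectation (\<lambda>\<omega>. (S i (\<lambda>j. D j \<omega>))\<^sup>2) \<le> K * H\<^sup>2 * real i" for i
  proof (induction i)
    case 0
    then show ?case by (simp add: S_def)
  next
    case (Suc i)
    have "expectation (\<lambda>\<omega>. (S (Suc i) (\<lambda>j. D j \<omega>))\<^sup>2)
        = expectation (\<lambda>\<omega>. (S i (\<lambda>j. D j \<omega>))\<^sup>2)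
            + expectation (\<lambda>\<omega>. (X i (\<lambda>j. D j \<omega>))\<^sup>2) * expectation (\<lambda>\<omega>. (h (D i \<omega>))\<^sup>2)"
      unfolding S2_Suc
      using S2_facts[OF lost_bounded', of i] SX_facts[OF h_bounded', of i] X2_facts[OF h2_bounded', of i] E_h[of i]
      by (simp add: prob_space)
    also have "\<dots> \<le> K * H\<^sup>2 * real i + K * H\<^sup>2"
      using Suc EX2 E_h2 K by (intro add_mono mult_mono) auto
    finally show ?case by (simp add: algebra_simps)
  qed

  have decompose: "(\<Sum>i<N. real (gap n d i * min (d i) n)) - c * real N = S N d + c * (1 - X N d)" for N d
  proof (induction N)
    case 0
    then show ?case by (simp add: S_def X_def)
  next
    case (Suc N)
    have "c * p = \<mu>" using p(2) by (simp add: c_def)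
    then have "X N d * real (min (d N) n) - c = h (d N) * X N d + c * (X N d - X (Suc N) d)"
      unfolding h_def X_Suc by (simp add: algebra_simps)
    moreover have "S (Suc N) d = S N d + h (d N) * X N d" by (simp add: S_def)
    ultimately show ?case using Suc by (simp add: algebra_simps X_def)
  qed
  have le: "((\<Sum>i<N. real (gap n d i * min (d i) n)) - c * real N)\<^sup>2 \<le> 2 * (S N d)\<^sup>2 + 2 * c\<^sup>2 * (X N d)\<^sup>2" for N d
  proof -
    have "(S N d + c * (1 - X N d))\<^sup>2 \<le> 2 * (S N d)\<^sup>2 + 2 * (c * (1 - X N d))\<^sup>2"
      using zero_le_power2[of "S N d - c * (1 - X N d)"] by (simp add: power2_eq_square algebra_simps)
    \<comment> \<open>As \<open>X\<close> is at least 1, the boundary term is controlled by the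
      second moment of \<open>X\<close>.\<close>
    moreover have "(1 - X N d)\<^sup>2 \<le> (X N d)\<^sup>2"
      using X_ge[of N d] by (intro abs_le_square_iff[THEN iffD1]) auto
    then have "c\<^sup>2 * (1 - X N d)\<^sup>2 \<le> c\<^sup>2 * (X N d)\<^sup>2" by (intro mult_left_mono) auto
    ultimately show ?thesis unfolding decompose by (simp add: power_mult_distrib)
  qed
  have int_bound: "integrable M (\<lambda>\<omega>. 2 * (S N (\<lambda>j. D j \<omega>))\<^sup>2 + 2 * c\<^sup>2 * (X N (\<lambda>j. D j \<omega>))\<^sup>2)" for N
    using S2_facts(1)[OF lost_bounded', of N] X2_facts(1)[OF lost_bounded', of N] by simp
  have gap_meas[measurable]: "(\<lambda>\<omega>. gap n (\<lambda>j. D j \<omega>) i) \<in> measurable M (count_space UNIV)" for i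
    by (induction i) (auto simp del: gap.simps(1) simp: gap.simps)
  have int: "integrable M (\<lambda>\<omega>. ((\<Sum>i<N. real (gap n (\<lambda>j. D j \<omega>) i * min (D i \<omega>) n)) - c * real N)\<^sup>2)" for N
  proof (rule Bochner_Integration.integrable_bound[OF int_bound[of N]])
    show "AE \<omega> in M. norm (((\<Sum>i<N. real (gap n (\<lambda>j. D j \<omega>) i * min (D i \<omega>) n)) - c * real N)\<^sup>2)
        \<le> norm (2 * (S N (\<lambda>j. D j \<omega>))\<^sup>2 + 2 * c\<^sup>2 * (X N (\<lambda>j. D j \<omega>))\<^sup>2)"
      using order_trans[OF le abs_ge_self] by simp
  qed measurable
  have bound: "expectation (\<lambda>\<omega>. ((\<Sum>i<N. real (gap n (\<lambda>j. D j \<omega>) i * min (D i \<omega>) n)) - c * real N)\<^sup>2)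
      \<le> (2 * K * H\<^sup>2 + 2 * c\<^sup>2 * K) * real N + (2 * K * H\<^sup>2 + 2 * c\<^sup>2 * K)" for N
  proof -
    have "expectation (\<lambda>\<omega>. ((\<Sum>i<N. real (gap n (\<lambda>j. D j \<omega>) i * min (D i \<omega>) n)) - c * real N)\<^sup>2)
        \<le> expectation (\<lambda>\<omega>. 2 * (S N (\<lambda>j. D j \<omega>))\<^sup>2 + 2 * c\<^sup>2 * (X N (\<lambda>j. D j \<omega>))\<^sup>2)"
      by (intro integral_mono int int_bound le)
    also have "\<dots> = 2 * expectation (\<lambda>\<omega>. (S N (\<lambda>j. D j \<omega>))\<^sup>2) + 2 * c\<^sup>2 * expectation (\<lambda>\<omega>. (X N (\<lambda>j. D j \<omega>))\<^sup>2)"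
      using S2_facts(1)[OF lost_bounded', of N] X2_facts(1)[OF lost_bounded', of N] by simp
    also have "\<dots> \<le> 2 * (K * H\<^sup>2 * real N) + 2 * c\<^sup>2 * K"
      by (intro add_mono mult_left_mono ES2 EX2) auto
    also have "\<dots> \<le> (2 * K * H\<^sup>2 + 2 * c\<^sup>2 * K) * real N + (2 * K * H\<^sup>2 + 2 * c\<^sup>2 * K)"
      using K by (simp add: algebra_simps)
    finally show ?thesis .
  qed
  show ?thesis
    using AE_tendsto_average_of_second_moment[OF _ _ int bound] by (simp add: c_def)
qed

section \<open>Time averages of the age\<close>

lemma average_imp_term_over_index:
  fixes a :: "nat \<Rightarrow> real"
  assumes "(\<lambda>N. (\<Sum>i<N. a i) / real N) \<longlonglongrightarrow> b"
  shows "(\<lambda>N. a N / real N) \<longlonglongrightarrow> 0"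
proof -
  let ?s = "\<lambda>N. (\<Sum>i<N. a i) / real N"
  \<comment> \<open>\<open>a N\<close> is the difference of two consecutive partial sums, whose
    normalized limits agree.\<close>
  have "(\<lambda>N. ?s (Suc N) * (real (Suc N) / real N) - ?s N) \<longlonglongrightarrow> b * 1 - b"
    by (intro tendsto_diff tendsto_mult assms LIMSEQ_Suc[OF assms]) real_asymp
  moreover have "eventually (\<lambda>N. ?s (Suc N) * (real (Suc N) / real N) - ?s N = a N / real N) sequentially"
    using eventually_gt_at_top[of 0]
  proof eventually_elim
    case (elim N)
    have "?s (Suc N) * (real (Suc N) / real N) = (\<Sum>i<Suc N. a i) / real N" by (simp del: of_nat_Suc sum.lessThan_Suc)
    then show ?case by (simp add: add_divide_distrib)
  qed
  ultimately show ?thesis by (auto dest: Lim_transform_eventually)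
qed

lemma average_cong_eventually:
  fixes a b :: "nat \<Rightarrow> real"
  assumes eq: "\<And>i. m \<le> i \<Longrightarrow> a i = b i"
    and lim: "(\<lambda>N. (\<Sum>i<N. a i) / real N) \<longlonglongrightarrow> c"
  shows "(\<lambda>N. (\<Sum>i<N. b i) / real N) \<longlonglongrightarrow> c"
proof -
  define C where "C = (\<Sum>i<m. b i - a i)"
  have "(\<lambda>N. (\<Sum>i<N. a i) / real N + C / real N) \<longlonglongrightarrow> c + 0"
    by (intro tendsto_add lim) real_asymp
  moreover have "eventually (\<lambda>N. (\<Sum>i<N. a i) / real N + C / real N = (\<Sum>i<N. b i) / real N) sequentially"
    using eventually_ge_at_top[of m]
  proof eventually_elim
    case (elim N)
    have "(\<Sum>i<N. b i - a i) = (\<Sum>i<m. b i - a i)"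
      using elim eq by (intro sum.mono_neutral_right) auto
    then have "(\<Sum>i<N. b i) = (\<Sum>i<N. a i) + C" by (simp add: C_def sum_subtractf)
    then show ?case by (simp add: add_divide_distrib)
  qed
  ultimately show ?thesis by (auto dest: Lim_transform_eventually)
qed

text \<open>At a general \<open>N\<close> the last block is incomplete. Its fewer than
  \<open>n\<close> terms are bounded by \<open>B (N div n)\<close>, which is o(N). The bound varies
  with the block because ages within a block grow with the gap.\<close>

lemma average_of_block_sums:
  fixes a :: "nat \<Rightarrow> real"
  assumes n: "0 < n"
    and lim: "(\<lambda>M. (\<Sum>i<M. \<Sum>j<n. a (i * n + j)) / real M) \<longlonglongrightarrow> real n * b"
    and bound: "\<And>i j. j < n \<Longrightarrow> \<bar>a (i * n + j)\<bar> \<le> B i"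
    and B: "(\<lambda>i. B i / real i) \<longlonglongrightarrow> 0"
  shows "(\<lambda>N. (\<Sum>i<N. a i) / real N) \<longlonglongrightarrow> b"
proof -
  let ?W = "\<lambda>M. \<Sum>i<M. \<Sum>j<n. a (i * n + j)"
  have div_lim: "filterlim (\<lambda>N. N div n) at_top sequentially"
    unfolding filterlim_at_top
  proof (intro allI eventually_sequentiallyI)
    fix Z N :: nat assume "Z * n \<le> N"
    then show "Z \<le> N div n" using n by (simp add: less_eq_div_iff_mult_less_eq)
  qed
  have ratio: "(\<lambda>N. real (N div n) / real N) \<longlonglongrightarrow> 1 / real n"
  proof (rule tendsto_sandwich)
    show "eventually (\<lambda>N. 1 / real n - 1 / real N \<le> real (N div n) / real N) sequentially"
      using eventually_gt_at_top[of 0]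
    proof eventually_elim
      case (elim N)
      have "N \<le> n * (N div n) + n" using n by (metis add.commute add_le_cancel_left div_mult_mod_eq less_imp_le mod_less_divisor mult.commute)
      then have "real N \<le> real n * real (N div n) + real n" by (metis of_nat_add of_nat_le_iff of_nat_mult)
      then have "(real N - real n) / (real n * real N) \<le> (real n * real (N div n)) / (real n * real N)"
        by (intro divide_right_mono) auto
      then show ?case using elim n by (simp add: diff_divide_distrib)
    qed
    show "eventually (\<lambda>N. real (N div n) / real N \<le> 1 / real n) sequentially"
      using eventually_gt_at_top[of 0]
    proof eventually_elim
      case (elim N)
      have "real (N div n) * real n \<le> real N" by (metis div_times_less_eq_dividend of_nat_le_iff of_nat_mult)
      then show ?case using elim n by (simp add: field_simps)
    qed
    show "(\<lambda>N. 1 / real n - 1 / real N) \<longlonglongrightarrow> 1 / real n" by real_asymp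
  qed simp
  have main: "(\<lambda>N. (?W (N div n) / real (N div n)) * (real (N div n) / real N)) \<longlonglongrightarrow> (real n * b) * (1 / real n)"
    by (intro tendsto_mult ratio filterlim_compose[OF lim div_lim])
  have err: "(\<lambda>N. (real n * (B (N div n) / real (N div n))) * (real (N div n) / real N)) \<longlonglongrightarrow> (real n * 0) * (1 / real n)"
    by (intro tendsto_mult ratio filterlim_compose[OF B div_lim] tendsto_const)
  have ev: "eventually (\<lambda>N. 0 < N div n) sequentially"
    using div_lim eventually_gt_at_top[of "0::nat"] by (simp add: filterlim_iff)
  have "(\<lambda>N. (\<Sum>i<N. a i) / real N - (?W (N div n) / real (N div n)) * (real (N div n) / real N)) \<longlonglongrightarrow> 0"
  proof (rule Lim_null_comparison)
    show "eventually (\<lambda>N. norm ((\<Sum>i<N. a i) / real N - (?W (N div n) / real (N div n)) * (real (N div n) / real N))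
        \<le> (real n * (B (N div n) / real (N div n))) * (real (N div n) / real N)) sequentially"
      using ev
    proof eventually_elim
      case (elim N)
      define q r where "q = N div n" and "r = N mod n"
      have N: "N = q * n + r" "r < n" using n by (auto simp: q_def r_def)
      have "(\<Sum>i<N. a i) = (\<Sum>i<q * n. a i) + (\<Sum>i\<in>{q * n..<q * n + r}. a i)"
        using N(1) by (subst sum.union_disjoint[symmetric]) (auto intro!: sum.cong)
      also have "(\<Sum>i<q * n. a i) = (\<Sum>m<q. sum a {m * n..<m * n + n})"
        by (rule sum.nat_group[symmetric])
      also have "\<dots> = ?W q"
        by (rule sum.cong[OF refl]) (subst sum.atLeastLessThan_shift_0, simp add: lessThan_atLeast0 comp_def)
      also have "(\<Sum>i\<in>{q * n..<q * n + r}. a i) = (\<Sum>j<r. a (q * n + j))"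
        by (subst sum.atLeastLessThan_shift_0) (simp add: lessThan_atLeast0 comp_def)
      finally have eq: "(\<Sum>i<N. a i) - ?W q = (\<Sum>j<r. a (q * n + j))" by simp
      have B0: "0 \<le> B q" using bound[OF n, of q] abs_ge_zero order_trans by blast
      have "\<bar>\<Sum>j<r. a (q * n + j)\<bar> \<le> (\<Sum>j<r. B q)"
        using N(2) by (intro order_trans[OF sum_abs] sum_mono bound) auto
      also have "\<dots> \<le> real n * B q" using N(2) B0 by (simp add: mult_right_mono)
      finally have le: "\<bar>(\<Sum>i<N. a i) - ?W q\<bar> \<le> real n * B q" using eq by simp
      have "N > 0" using elim by (metis div_0 gr0I)
      have "(?W q / real q) * (real q / real N) = ?W q / real N"
           "(real n * (B q / real q)) * (real q / real N) = real n * B q / real N"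
        using elim by (auto simp: q_def)
      then show ?case
        using le \<open>N > 0\<close> by (simp add: q_def[symmetric] abs_divide divide_right_mono flip: diff_divide_distrib)
    qed
    show "(\<lambda>N. (real n * (B (N div n) / real (N div n))) * (real (N div n) / real N)) \<longlonglongrightarrow> 0"
      using err by simp
  qed
  from tendsto_add[OF this main] show ?thesis using n by simp
qed

text \<open>The formula is demanded on a half-open interval because the age may jump at the right
  endpoint; a single point does not affect the integral.\<close>

lemma has_integral_unit_slope_segment:
  fixes f :: "real \<Rightarrow> real"
  assumes "u \<le> v" and f: "\<And>t. u \<le> t \<Longrightarrow> t < v \<Longrightarrow> f t = A + (t - u)"
  shows "(f has_integral (A * (v - u) + (v - u)\<^sup>2 / 2)) {u..v}"
proof -
  have "((\<lambda>t. A + (t - u)) has_integral ((A * v + (v - u)\<^sup>2 / 2) - (A * u + (u - u)\<^sup>2 / 2))) {u..v}"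
    using \<open>u \<le> v\<close>
    by (intro fundamental_theorem_of_calculus)
      (auto intro!: derivative_eq_intros simp: has_real_derivative_iff_has_vector_derivative[symmetric])
  moreover have "(A * v + (v - u)\<^sup>2 / 2) - (A * u + (u - u)\<^sup>2 / 2) = A * (v - u) + (v - u)\<^sup>2 / 2"
    by (simp add: algebra_simps)
  ultimately have "((\<lambda>t. A + (t - u)) has_integral (A * (v - u) + (v - u)\<^sup>2 / 2)) {u..v}" by (simp only:)
  then show ?thesis
    by (rule has_integral_spike_finite[of "{v}", rotated 2]) (use f in auto)
qed

text \<open>Each unit interval contributes its initial value plus 1/2, the integral of
  \<open>frac\<close>, hence the shift of the limit. At a noninteger time the unfinished interval
  adds a fraction of \<open>a N\<close> and a bounded term, which is o(N) once the averages
  converge.\<close>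

lemma has_average_unit_slope_iff:
  fixes f :: "real \<Rightarrow> real" and a :: "nat \<Rightarrow> real"
  assumes f: "\<And>t. 0 \<le> t \<Longrightarrow> f t = a (nat \<lfloor>t\<rfloor>) + frac t"
  shows "has_average f c \<longleftrightarrow> (\<lambda>N. (\<Sum>i<N. a i) / real N) \<longlonglongrightarrow> c - 1 / 2"
proof -
  let ?s = "\<lambda>N. \<Sum>i<N. a i"
  have segment: "(f has_integral (a N * (v - real N) + (v - real N)\<^sup>2 / 2)) {real N..v}"
    if "real N \<le> v" "v \<le> real (Suc N)" for N v
  proof (rule has_integral_unit_slope_segment[OF that(1)])
    fix t assume t: "real N \<le> t" "t < v"
    then have "\<lfloor>t\<rfloor> = int N" using that(2) by (intro floor_unique) auto
    then show "f t = a N + (t - real N)" using t f[of t] by (simp add: frac_def)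
  qed
  have at_nat: "(f has_integral (?s N + real N / 2)) {0..real N}" for N
  proof (induction N)
    case 0
    then show ?case using has_integral_refl(1)[of f 0] by simp
  next
    case (Suc N)
    have "(f has_integral (a N + 1 / 2)) {real N..real (Suc N)}"
      using segment[of N "real (Suc N)"] by simp
    with Suc have "(f has_integral ((?s N + real N / 2) + (a N + 1 / 2))) {0..real (Suc N)}"
      by (intro has_integral_combine[of 0 "real N" "real (Suc N)" f]) auto
    then show ?case by (simp add: algebra_simps add_divide_distrib)
  qed
  have integral: "integral {0..\<tau>} f = ?s (nat \<lfloor>\<tau>\<rfloor>) + real (nat \<lfloor>\<tau>\<rfloor>) / 2 + (a (nat \<lfloor>\<tau>\<rfloor>) * frac \<tau> + (frac \<tau>)\<^sup>2 / 2)"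
    if "0 \<le> \<tau>" for \<tau>
  proof (rule integral_unique, rule has_integral_combine)
    show "(f has_integral (a (nat \<lfloor>\<tau>\<rfloor>) * frac \<tau> + (frac \<tau>)\<^sup>2 / 2)) {real (nat \<lfloor>\<tau>\<rfloor>)..\<tau>}"
      using segment[of "nat \<lfloor>\<tau>\<rfloor>" \<tau>] that by (simp add: frac_def) linarith
    show "(f has_integral (?s (nat \<lfloor>\<tau>\<rfloor>) + real (nat \<lfloor>\<tau>\<rfloor>) / 2)) {0..real (nat \<lfloor>\<tau>\<rfloor>)}"
      by (rule at_nat)
  qed (use that in auto)
  show ?thesis
  proof
    assume "has_average f c"
    then have "(\<lambda>N. 1 / real N * integral {0..real N} f) \<longlonglongrightarrow> c"
      unfolding has_average_def by (rule filterlim_compose) (rule filterlim_real_sequentially)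
    then have "(\<lambda>N. 1 / real N * (?s N + real N / 2)) \<longlonglongrightarrow> c"
      using integral_unique[OF at_nat] by simp
    then have "(\<lambda>N. 1 / real N * (?s N + real N / 2) - 1 / 2) \<longlonglongrightarrow> c - 1 / 2"
      by (intro tendsto_intros)
    moreover have "eventually (\<lambda>N. 1 / real N * (?s N + real N / 2) - 1 / 2 = ?s N / real N) sequentially"
      using eventually_gt_at_top[of 0] by eventually_elim (simp add: field_simps)
    ultimately show "(\<lambda>N. ?s N / real N) \<longlonglongrightarrow> c - 1 / 2" by (rule Lim_transform_eventually)
  next
    assume lim: "(\<lambda>N. ?s N / real N) \<longlonglongrightarrow> c - 1 / 2"
    note small = average_imp_term_over_index[OF lim]
    let ?N = "\<lambda>\<tau>::real. nat \<lfloor>\<tau>\<rfloor>"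
    have N_lim: "filterlim ?N sequentially at_top" by real_asymp
    have ratio: "((\<lambda>\<tau>. real (?N \<tau>) / \<tau>) \<longlongrightarrow> 1) at_top" by real_asymp
    have "((\<lambda>\<tau>. (?s (?N \<tau>) / real (?N \<tau>) + 1 / 2) * (real (?N \<tau>) / \<tau>)
        + (a (?N \<tau>) / real (?N \<tau>)) * (real (?N \<tau>) / \<tau>) * frac \<tau> + (frac \<tau>)\<^sup>2 / 2 / \<tau>)
      \<longlongrightarrow> (c - 1 / 2 + 1 / 2) * 1 + 0 + 0) at_top"
    proof (intro tendsto_add tendsto_mult filterlim_compose[OF lim N_lim] tendsto_const ratio)
      have "((\<lambda>\<tau>. \<bar>(a (?N \<tau>) / real (?N \<tau>)) * (real (?N \<tau>) / \<tau>)\<bar>) \<longlongrightarrow> \<bar>0 * 1\<bar>) at_top"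
        by (intro tendsto_rabs tendsto_mult filterlim_compose[OF small N_lim] ratio)
      then have z: "((\<lambda>\<tau>. \<bar>(a (?N \<tau>) / real (?N \<tau>)) * (real (?N \<tau>) / \<tau>)\<bar>) \<longlongrightarrow> 0) at_top" by simp
      show "((\<lambda>\<tau>. (a (?N \<tau>) / real (?N \<tau>)) * (real (?N \<tau>) / \<tau>) * frac \<tau>) \<longlongrightarrow> 0) at_top"
      proof (rule Lim_null_comparison[OF always_eventually z], intro allI)
        fix \<tau> :: real
        have "\<bar>frac \<tau>\<bar> \<le> 1" using frac_lt_1[of \<tau>] by simp
        from mult_left_mono[OF this, of "\<bar>(a (?N \<tau>) / real (?N \<tau>)) * (real (?N \<tau>) / \<tau>)\<bar>"]
        show "norm ((a (?N \<tau>) / real (?N \<tau>)) * (real (?N \<tau>) / \<tau>) * frac \<tau>) \<le> \<bar>(a (?N \<tau>) / real (?N \<tau>)) * (real (?N \<tau>) / \<tau>)\<bar>"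
          unfolding real_norm_def abs_mult by simp
      qed
      have z: "((\<lambda>\<tau>::real. 1 / \<tau>) \<longlongrightarrow> 0) at_top" by real_asymp
      show "((\<lambda>\<tau>::real. (frac \<tau>)\<^sup>2 / 2 / \<tau>) \<longlongrightarrow> 0) at_top"
      proof (rule Lim_null_comparison[OF _ z])
        show "eventually (\<lambda>\<tau>::real. norm ((frac \<tau>)\<^sup>2 / 2 / \<tau>) \<le> 1 / \<tau>) at_top"
          using eventually_gt_at_top[of 0]
        proof eventually_elim
          case (elim \<tau>)
          have "(frac \<tau>)\<^sup>2 \<le> 1" using frac_lt_1[of \<tau>] by (intro power_le_one) auto
          then have "(frac \<tau>)\<^sup>2 / 2 \<le> 1" by simp
          then show ?case using divide_right_mono[of "(frac \<tau>)\<^sup>2 / 2" 1 \<tau>] elim by simp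
        qed
      qed
    qed
    moreover have "eventually (\<lambda>\<tau>. (?s (?N \<tau>) / real (?N \<tau>) + 1 / 2) * (real (?N \<tau>) / \<tau>)
        + (a (?N \<tau>) / real (?N \<tau>)) * (real (?N \<tau>) / \<tau>) * frac \<tau> + (frac \<tau>)\<^sup>2 / 2 / \<tau>
        = 1 / \<tau> * integral {0..\<tau>} f) at_top"
      using eventually_ge_at_top[of 1]
    proof eventually_elim
      case (elim \<tau>)
      then have "1 \<le> \<lfloor>\<tau>\<rfloor>" by linarith
      then have pos: "real (?N \<tau>) \<noteq> 0" "\<tau> \<noteq> 0" using elim by linarith+
      define N s w x where "N = real (?N \<tau>)" and "s = ?s (?N \<tau>)" and "w = a (?N \<tau>)" and "x = frac \<tau>"
      have "integral {0..\<tau>} f = s + N / 2 + (w * x + x\<^sup>2 / 2)"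
        using integral[of \<tau>] elim by (simp add: N_def s_def w_def x_def)
      moreover have "(s / N + 1 / 2) * (N / \<tau>) + (w / N) * (N / \<tau>) * x + x\<^sup>2 / 2 / \<tau>
          = 1 / \<tau> * (s + N / 2 + (w * x + x\<^sup>2 / 2))"
        using pos unfolding N_def[symmetric] by (simp add: field_simps)
      ultimately show ?case by (simp only: N_def s_def w_def x_def)
    qed
    ultimately show "has_average f c"
      unfolding has_average_def by (auto dest: Lim_transform_eventually)
  qed
qed

text \<open>
  In what follows, \<open>d i\<close> is the position at which block \<open>i\<close> is decoded; blocks are
  numbered from \<open>0\<close>, and a value above \<open>n\<close> means that the block is lost.
\<close>

definition block_age :: "nat \<Rightarrow> real \<Rightarrow> real \<Rightarrow> (nat \<Rightarrow> nat) \<Rightarrow> real \<Rightarrow> real" where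
  "block_age n \<phi> a0 d t =
     (let B = {i. d i \<le> n \<and> real (i * n + d i) \<le> t}
      in if B = {} then a0 + t else t - real (Max B * n) - 1 + \<phi>)"

text \<open>Agrees with \<open>block_age\<close> except that a block number \<open>-1\<close> is considered to be decoded at time 0.\<close>

definition virtual_age :: "nat \<Rightarrow> real \<Rightarrow> (nat \<Rightarrow> nat) \<Rightarrow> nat \<Rightarrow> real" where
  "virtual_age n \<phi> d N =
     real (N mod n) - 1 + \<phi> + (if d (N div n) \<le> N mod n then 0 else real (gap n d (N div n) * n))"

section \<open>The age as a function of the decoding positions\<close>

lemma gap_all_lost: "(\<And>j. j < i \<Longrightarrow> n < d j) \<Longrightarrow> gap n d i = Suc i"
  by (induction i) force+

lemma gap_last_decoded:
  assumes "m < i" "d m \<le> n" "\<And>j. m < j \<Longrightarrow> j < i \<Longrightarrow> n < d j"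
  shows "gap n d i = i - m"
  using assms
proof (induction i)
  case (Suc i)
  show ?case
  proof (cases "i = m")
    case False
    then have "gap n d i = i - m" "n < d i" using Suc by auto
    then show ?thesis using False Suc.prems(1) by (simp add: Suc_diff_le)
  qed (use Suc.prems in simp)
qed simp

text \<open>Blocks occupy disjoint time windows: an earlier block that is not lost is decoded by
  time \<open>i * n\<close>, and a later one only after \<open>Suc i * n\<close>, since positions
  start at 1.\<close>

lemma decoded_set_at:
  fixes n :: nat
  assumes d: "\<And>i. 1 \<le> d i" and j: "j < n"
  shows "{i'. d i' \<le> n \<and> i' * n + d i' \<le> i * n + j} = {i'. i' < i \<and> d i' \<le> n} \<union> (if d i \<le> j then {i} else {})"
    (is "?L = ?R")
proof (rule Set.set_eqI)
  fix i'
  consider "i' < i" | "i' = i" | "i < i'" by linarith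
  then show "i' \<in> ?L \<longleftrightarrow> i' \<in> ?R"
  proof cases
    case 1
    then have "Suc i' * n \<le> i * n" by (intro mult_le_mono1) simp
    then show ?thesis using 1 by auto
  next
    case 2
    then show ?thesis using j by auto
  next
    case 3
    then have "Suc i * n \<le> i' * n" by (intro mult_le_mono1) simp
    then show ?thesis using 3 j d[of i'] by auto
  qed
qed

lemma block_age_unit_slope:
  assumes "0 \<le> t"
  shows "block_age n \<phi> a0 d t = block_age n \<phi> a0 d (real (nat \<lfloor>t\<rfloor>)) + frac t"
proof -
  define B where "B t = {i. d i \<le> n \<and> real (i * n + d i) \<le> t}" for t
  have "real m \<le> t \<longleftrightarrow> real m \<le> real (nat \<lfloor>t\<rfloor>)" for m
    using assms le_floor_iff[of "int m" t] by (simp add: le_nat_iff) linarith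
  then have B: "B (real (nat \<lfloor>t\<rfloor>)) = B t"
    unfolding B_def by blast
  have t: "real (nat \<lfloor>t\<rfloor>) + frac t = t" using assms by (simp add: frac_def)
  have age: "block_age n \<phi> a0 d s = (if B s = {} then a0 + s else s - real (Max (B s) * n) - 1 + \<phi>)" for s
    unfolding block_age_def B_def Let_def ..
  show ?thesis unfolding age B using t by auto
qed

lemma block_age_all_lost:
  assumes "\<And>i. n < d i"
  shows "block_age n \<phi> a0 d t = a0 + t"
  using assms by (simp add: block_age_def not_le[symmetric])

text \<open>Once block \<open>m\<close> is over, a genuinely decoded block lies in the past, so the
  fictitious block -1 and the constant \<open>a0\<close> are forgotten. While the current block
  \<open>i\<close> is undecoded, the freshest decoded one is \<open>Max B = i - gap n d i\<close>,
  which accounts for the term with the gap.\<close>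

lemma block_age_eq_virtual_age:
  assumes n: "0 < n" and d: "\<And>i. 1 \<le> d i" and m: "d m \<le> n" "Suc m * n \<le> N"
  shows "block_age n \<phi> a0 d (real N) = virtual_age n \<phi> d N"
proof -
  define i j where "i = N div n" and "j = N mod n"
  have N: "N = i * n + j" and j: "j < n" using n by (auto simp: i_def j_def)
  define B where "B = {i'. d i' \<le> n \<and> i' * n + d i' \<le> N}"
  have B: "B = {i'. i' < i \<and> d i' \<le> n} \<union> (if d i \<le> j then {i} else {})"
    unfolding B_def N by (rule decoded_set_at[OF d j])
  have fin: "finite B" unfolding B by auto
  have "m \<in> B" unfolding B_def using m by auto
  then have ne: "B \<noteq> {}" by auto
  have age: "block_age n \<phi> a0 d (real N) = real N - real (Max B * n) - 1 + \<phi>"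
    unfolding block_age_def Let_def of_nat_le_iff B_def[symmetric] using ne by simp
  show ?thesis
  proof (cases "d i \<le> j")
    case True
    then have "Max B = i" using fin B by (intro Max_eqI) auto
    then show ?thesis using True unfolding age virtual_age_def i_def[symmetric] j_def[symmetric] by (simp add: N)
  next
    case False
    have *: "Max B < i" "d (Max B) \<le> n" using Max_in[OF fin ne] B False by auto
    have "gap n d i = i - Max B"
    proof (rule gap_last_decoded[where d=d, OF *])
      fix j' assume "Max B < j'" "j' < i"
      show "n < d j'"
      proof (rule ccontr)
        assume "\<not> n < d j'"
        then have "j' \<in> B" using \<open>j' < i\<close> unfolding B by simp
        then show False using Max_ge[OF fin, of j'] \<open>Max B < j'\<close> by simp
      qed
    qed
    then have "real (gap n d i) = real i - real (Max B)" using *(1) by simp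
    then have gap_n: "real (gap n d i) * real n = real i * real n - real (Max B) * real n"
      by (simp only: left_diff_distrib)
    then show ?thesis
      using False unfolding age virtual_age_def i_def[symmetric] j_def[symmetric] by (simp add: N gap_n)
  qed
qed

text \<open>This is the reason for introducing \<open>virtual_age\<close>: it is monotone at every
  time, whereas \<open>block_age\<close> may fail to be so before the first decoding, because
  \<open>a0\<close> is arbitrary.\<close>

lemma virtual_age_mono:
  assumes "\<And>i. d' i \<le> d i"
  shows "virtual_age n \<phi> d' N \<le> virtual_age n \<phi> d N"
  unfolding virtual_age_def using le_trans[OF assms] gap_mono[OF assms, where n=n and i="N div n"]
  by (auto intro: mult_right_mono simp: of_nat_mult)

text \<open>The excess \<open>gap n d i * n\<close> is present exactly at the times
  \<open>j < d i\<close> of the block, that is at \<open>min (d i) n\<close> of its \<open>n\<close>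
  integer times. This produces the renewal reward.\<close>

lemma virtual_age_block_sum:
  "(\<Sum>j<n. virtual_age n \<phi> d (i * n + j))
     = real n * ((real n - 1) / 2 + \<phi> - 1) + real n * real (gap n d i * min (d i) n)"
proof -
  have "(\<Sum>j<n. virtual_age n \<phi> d (i * n + j))
      = (\<Sum>j<n. real j) + (\<Sum>j<n. \<phi> - 1) + (\<Sum>j<n. if d i \<le> j then 0 else real (gap n d i * n))"
    unfolding sum.distrib[symmetric] by (intro sum.cong refl) (simp add: virtual_age_def)
  also have "(\<Sum>j<n. if d i \<le> j then 0 else real (gap n d i * n)) = (\<Sum>j<min (d i) n. real (gap n d i * n))"
    by (rule sum.mono_neutral_cong_right) auto
  also have "(\<Sum>j<n. real j) = real n * (real n - 1) / 2"
    by (induction n) (auto simp: field_simps)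
  finally show ?thesis by (simp add: algebra_simps)
qed

lemma virtual_age_average:
  assumes n: "0 < n" and d: "\<And>i. 1 \<le> d i"
    and lim: "(\<lambda>M. (\<Sum>i<M. real (gap n d i * min (d i) n)) / real M) \<longlonglongrightarrow> m"
  shows "(\<lambda>N. (\<Sum>i<N. virtual_age n \<phi> d i) / real N) \<longlonglongrightarrow> (real n - 1) / 2 + \<phi> - 1 + m"
proof (rule average_of_block_sums[OF n])
  let ?b = "(real n - 1) / 2 + \<phi> - 1"
  have "(\<lambda>M. real n * ?b + real n * ((\<Sum>i<M. real (gap n d i * min (d i) n)) / real M)) \<longlonglongrightarrow> real n * ?b + real n * m"
    by (intro tendsto_intros lim)
  moreover have "eventually (\<lambda>M. real n * ?b + real n * ((\<Sum>i<M. real (gap n d i * min (d i) n)) / real M)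
      = (\<Sum>i<M. \<Sum>j<n. virtual_age n \<phi> d (i * n + j)) / real M) sequentially"
    using eventually_gt_at_top[of 0]
    by eventually_elim (simp add: virtual_age_block_sum sum.distrib add_divide_distrib flip: sum_distrib_left)
  ultimately show "(\<lambda>M. (\<Sum>i<M. \<Sum>j<n. virtual_age n \<phi> d (i * n + j)) / real M) \<longlonglongrightarrow> real n * (?b + m)"
    by (simp add: distrib_left Lim_transform_eventually)
  show "\<bar>virtual_age n \<phi> d (i * n + j)\<bar> \<le> real n * real (gap n d i * min (d i) n) + (real n + 1 + \<bar>\<phi>\<bar>)" if "j < n" for i j
  proof -
    \<comment> \<open>Because this minimum is at least 1, the gap is dominated by the terms of the
      convergent average, which are o(i).\<close>
    have "1 \<le> min (d i) n" using n d[of i] by simp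
    then have "gap n d i * 1 * n \<le> gap n d i * min (d i) n * n" by (intro mult_le_mono) auto
    then have "real (gap n d i * n) \<le> real n * real (gap n d i * min (d i) n)"
      by (metis mult.commute mult_1_right of_nat_le_iff of_nat_mult)
    then show ?thesis using that by (auto simp: virtual_age_def simp del: of_nat_mult)
  qed
  have "(\<lambda>i. real n * (real (gap n d i * min (d i) n) / real i) + (real n + 1 + \<bar>\<phi>\<bar>) / real i) \<longlonglongrightarrow> real n * 0 + 0"
    by (intro tendsto_add tendsto_mult tendsto_const average_imp_term_over_index[OF lim]) real_asymp
  then show "(\<lambda>i. (real n * real (gap n d i * min (d i) n) + (real n + 1 + \<bar>\<phi>\<bar>)) / real i) \<longlonglongrightarrow> 0"
    by (simp add: add_divide_distrib)
qed

text \<open>If every block were lost, the summands would be \<open>Suc i * n\<close>, whose averages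
  diverge.\<close>

lemma exists_decoded_if_gap_average:
  assumes n: "0 < n"
    and lim: "(\<lambda>M. (\<Sum>i<M. real (gap n d i * min (d i) n)) / real M) \<longlonglongrightarrow> m"
  shows "\<exists>i. d i \<le> n"
proof (rule ccontr)
  assume "\<nexists>i. d i \<le> n"
  then have lost: "n < d i" for i by (simp add: not_le)
  then have "gap n d i = Suc i" for i by (simp add: gap_all_lost)
  then have "(\<lambda>i. real (Suc i * n) / real i) \<longlonglongrightarrow> 0"
    using average_imp_term_over_index[OF lim] lost by (simp add: min_absorb2 less_imp_le)
  moreover have "(\<lambda>i. real (Suc i * n) / real i) \<longlonglongrightarrow> real n" by real_asymp
  ultimately show False using n LIMSEQ_unique by fastforce
qed

lemma has_average_block_age_iff:
  assumes n: "0 < n" and d: "\<And>i. 1 \<le> d i" and dec: "\<exists>i. d i \<le> n"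
  shows "has_average (block_age n \<phi> a0 d) c \<longleftrightarrow> (\<lambda>N. (\<Sum>i<N. virtual_age n \<phi> d i) / real N) \<longlonglongrightarrow> c - 1 / 2"
proof -
  obtain m where m: "d m \<le> n" using dec by blast
  have eq: "block_age n \<phi> a0 d (real i) = virtual_age n \<phi> d i" if "Suc m * n \<le> i" for i
    using n d m that by (rule block_age_eq_virtual_age)
  have "has_average (block_age n \<phi> a0 d) c \<longleftrightarrow> (\<lambda>N. (\<Sum>i<N. block_age n \<phi> a0 d (real i)) / real N) \<longlonglongrightarrow> c - 1 / 2"
    by (rule has_average_unit_slope_iff[OF block_age_unit_slope])
  also have "\<dots> \<longleftrightarrow> (\<lambda>N. (\<Sum>i<N. virtual_age n \<phi> d i) / real N) \<longlonglongrightarrow> c - 1 / 2"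
    using average_cong_eventually[of "Suc m * n" "\<lambda>i. block_age n \<phi> a0 d (real i)" "virtual_age n \<phi> d" "c - 1 / 2", OF eq]
      average_cong_eventually[of "Suc m * n" "virtual_age n \<phi> d" "\<lambda>i. block_age n \<phi> a0 d (real i)" "c - 1 / 2", OF eq[symmetric]]
    by blast
  finally show ?thesis .
qed

lemma has_average_block_age:
  assumes n: "0 < n" and d: "\<And>i. 1 \<le> d i"
    and lim: "(\<lambda>M. (\<Sum>i<M. real (gap n d i * min (d i) n)) / real M) \<longlonglongrightarrow> m"
  shows "has_average (block_age n \<phi> a0 d) (real n / 2 - 1 + \<phi> + m)"
proof -
  have *: "real n / 2 - 1 + \<phi> + m - 1 / 2 = (real n - 1) / 2 + \<phi> - 1 + m" by (simp add: field_simps)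
  show ?thesis
    unfolding has_average_block_age_iff[OF n d exists_decoded_if_gap_average[OF n lim]] *
    by (rule virtual_age_average[OF n d lim])
qed

text \<open>Virtual ages are compared pointwise and the inequality passes to the limit. The slower
  sequence must decode some block, for otherwise its age \<open>a0 + t\<close> would have no
  average.\<close>

lemma block_age_average_lower_bound:
  assumes n: "0 < n" and d': "\<And>i. 1 \<le> d' i" and le: "\<And>i. d' i \<le> d i"
    and lim: "(\<lambda>M. (\<Sum>i<M. real (gap n d' i * min (d' i) n)) / real M) \<longlonglongrightarrow> m"
    and avg: "has_average (block_age n \<phi> a0 d) c"
  shows "real n / 2 - 1 + \<phi> + m \<le> c"
proof -
  have d: "1 \<le> d i" for i using d' le order_trans by blast
  have dec: "\<exists>i. d i \<le> n"
  proof (rule ccontr)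
    assume "\<nexists>i. d i \<le> n"
    then have "block_age n \<phi> a0 d t = a0 + t" for t by (intro block_age_all_lost) (simp add: not_le)
    then have "(\<lambda>N. (\<Sum>i<N. a0 + real i) / real N) \<longlonglongrightarrow> c - 1 / 2"
      using avg has_average_unit_slope_iff[of "block_age n \<phi> a0 d" "\<lambda>N. block_age n \<phi> a0 d (real N)" c, OF block_age_unit_slope] by simp
    then have "(\<lambda>i. (a0 + real i) / real i) \<longlonglongrightarrow> 0" by (rule average_imp_term_over_index)
    moreover have "(\<lambda>i. (a0 + real i) / real i) \<longlonglongrightarrow> 1" by real_asymp
    ultimately show False using LIMSEQ_unique by fastforce
  qed
  have "(real n - 1) / 2 + \<phi> - 1 + m \<le> c - 1 / 2"
  proof (rule LIMSEQ_le)
    show "(\<lambda>N. (\<Sum>i<N. virtual_age n \<phi> d' i) / real N) \<longlonglongrightarrow> (real n - 1) / 2 + \<phi> - 1 + m"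
      by (rule virtual_age_average[OF n d' lim])
    show "(\<lambda>N. (\<Sum>i<N. virtual_age n \<phi> d i) / real N) \<longlonglongrightarrow> c - 1 / 2"
      using avg has_average_block_age_iff[OF n d dec] by blast
    show "\<exists>N0. \<forall>N\<ge>N0. (\<Sum>i<N. virtual_age n \<phi> d' i) / real N \<le> (\<Sum>i<N. virtual_age n \<phi> d i) / real N"
      by (intro exI allI impI divide_right_mono sum_mono virtual_age_mono le) auto
  qed
  then show ?thesis by (simp add: field_simps)
qed

section \<open>Independence of the blocks\<close>

text \<open>The joint law of the coordinates is \<open>PiM I M\<close> itself and the marginals are
  its factors, so the product-law criterion for independence applies.\<close>

lemma indep_vars_PiM_component:
  assumes M: "\<And>i. i \<in> I \<Longrightarrow> prob_space (M i)" and I: "I \<noteq> {}"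
  shows "prob_space.indep_vars (PiM I M) M (\<lambda>i x. x i) I"
proof -
  interpret prob_space "PiM I M" using M by (rule prob_space_PiM)
  have "distr (PiM I M) (PiM I M) (\<lambda>x. \<lambda>i\<in>I. x i) = distr (PiM I M) (PiM I M) (\<lambda>x. x)"
    by (rule distr_cong) (auto simp: space_PiM PiE_def extensional_restrict)
  also have "\<dots> = PiM I M" by (rule distr_id)
  also have "\<dots> = (\<Pi>\<^sub>M i\<in>I. distr (PiM I M) (M i) (\<lambda>x. x i))"
    by (intro PiM_cong refl distr_PiM_component[symmetric] M)
  finally show ?thesis
    by (subst indep_vars_iff_distr_eq_PiM') (auto simp: I)
qed

text \<open>Independence is checked for finite index sets and on rectangles, an intersection-stable
  generator on which probabilities in the product factor. It will combine independent columns with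
  independent erasures into independent blocks.\<close>

lemma indep_vars_pair_measure:
  assumes M: "prob_space M" and N: "prob_space N"
    and X: "prob_space.indep_vars M M' X I" and Y: "prob_space.indep_vars N N' Y I"
  shows "prob_space.indep_vars (M \<Otimes>\<^sub>M N) (\<lambda>i. M' i \<Otimes>\<^sub>M N' i) (\<lambda>i x. (X i (fst x), Y i (snd x))) I"
proof -
  interpret M: prob_space M by fact
  interpret N: prob_space N by fact
  interpret pair_prob_space M N ..
  have rv_X: "X i \<in> measurable M (M' i)" if "i \<in> I" for i
    using X that by (auto simp: M.indep_vars_def)
  have rv_Y: "Y i \<in> measurable N (N' i)" if "i \<in> I" for i
    using Y that by (auto simp: N.indep_vars_def)
  let ?Z = "\<lambda>i x. (X i (fst x), Y i (snd x))"
  have rv: "random_variable (M' i \<Otimes>\<^sub>M N' i) (?Z i)" if "i \<in> I" for i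
    using rv_X[OF that] rv_Y[OF that] by measurable
  have prob_Times: "prob (A \<times> B) = M.prob A * N.prob B" if "A \<in> sets M" "B \<in> sets N" for A B
    using N.emeasure_pair_measure_Times[OF that]
    by (simp add: emeasure_eq_measure M.emeasure_eq_measure N.emeasure_eq_measure flip: ennreal_mult)
  have fin: "indep_vars (\<lambda>i. M' i \<Otimes>\<^sub>M N' i) ?Z J" if J: "J \<subseteq> I" "J \<noteq> {}" "finite J" for J
  proof (subst indep_vars_finite[OF J(2,3), where E="\<lambda>i. {a \<times> b | a b. a \<in> sets (M' i) \<and> b \<in> sets (N' i)}"])
    fix i assume "i \<in> J"
    then show "random_variable (M' i \<Otimes>\<^sub>M N' i) (?Z i)" using rv J by blast
    show "sets (M' i \<Otimes>\<^sub>M N' i) = sigma_sets (space (M' i \<Otimes>\<^sub>M N' i)) {a \<times> b | a b. a \<in> sets (M' i) \<and> b \<in> sets (N' i)}"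
      by (simp add: sets_pair_measure space_pair_measure)
    show "Int_stable {a \<times> b | a b. a \<in> sets (M' i) \<and> b \<in> sets (N' i)}"
      by (rule Int_stable_pair_measure_generator)
    show "space (M' i \<Otimes>\<^sub>M N' i) \<in> {a \<times> b | a b. a \<in> sets (M' i) \<and> b \<in> sets (N' i)}"
      by (auto simp: space_pair_measure)
    show "{a \<times> b | a b. a \<in> sets (M' i) \<and> b \<in> sets (N' i)} \<subseteq> Pow (space (M' i \<Otimes>\<^sub>M N' i))"
      by (auto simp: space_pair_measure dest: sets.sets_into_space)
  next
    show "\<forall>A\<in>\<Pi> i\<in>J. {a \<times> b | a b. a \<in> sets (M' i) \<and> b \<in> sets (N' i)}.
        prob (\<Inter>j\<in>J. ?Z j -` A j \<inter> space (M \<Otimes>\<^sub>M N)) = (\<Prod>j\<in>J. prob (?Z j -` A j \<inter> space (M \<Otimes>\<^sub>M N)))"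
    proof
      fix A assume "A \<in> (\<Pi> i\<in>J. {a \<times> b | a b. a \<in> sets (M' i) \<and> b \<in> sets (N' i)})"
      then have "\<forall>i\<in>J. \<exists>a b. a \<in> sets (M' i) \<and> b \<in> sets (N' i) \<and> A i = a \<times> b"
        by (fastforce simp: Pi_iff)
      then obtain a b where ab: "\<And>i. i \<in> J \<Longrightarrow> a i \<in> sets (M' i) \<and> b i \<in> sets (N' i) \<and> A i = a i \<times> b i"
        by metis
      let ?a = "\<lambda>i. X i -` a i \<inter> space M" and ?b = "\<lambda>i. Y i -` b i \<inter> space N"
      have ms: "?a i \<in> sets M" "?b i \<in> sets N" if "i \<in> J" for i
        using ab[OF that] rv_X[of i] rv_Y[of i] J that by (auto intro: measurable_sets)
      have Z: "?Z i -` A i \<inter> space (M \<Otimes>\<^sub>M N) = ?a i \<times> ?b i" if "i \<in> J" for i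
        using ab[OF that] by (auto simp: space_pair_measure)
      have "(\<Inter>j\<in>J. ?Z j -` A j \<inter> space (M \<Otimes>\<^sub>M N)) = (\<Inter>j\<in>J. ?a j \<times> ?b j)"
        using Z by (intro INF_cong) auto
      also have "\<dots> = (\<Inter>j\<in>J. ?a j) \<times> (\<Inter>j\<in>J. ?b j)" using J(2) by auto
      also have "prob \<dots> = M.prob (\<Inter>j\<in>J. ?a j) * N.prob (\<Inter>j\<in>J. ?b j)"
        using J ms by (intro prob_Times sets.finite_INT) auto
      also have "M.prob (\<Inter>j\<in>J. ?a j) = (\<Prod>j\<in>J. M.prob (?a j))"
        using J ab by (intro M.indep_varsD[OF X]) auto
      also have "N.prob (\<Inter>j\<in>J. ?b j) = (\<Prod>j\<in>J. N.prob (?b j))"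
        using J ab by (intro N.indep_varsD[OF Y]) auto
      also have "(\<Prod>j\<in>J. M.prob (?a j)) * (\<Prod>j\<in>J. N.prob (?b j)) = (\<Prod>j\<in>J. prob (?Z j -` A j \<inter> space (M \<Otimes>\<^sub>M N)))"
        unfolding prod.distrib[symmetric] using Z ms by (intro prod.cong) (auto simp: prob_Times)
      finally show "prob (\<Inter>j\<in>J. ?Z j -` A j \<inter> space (M \<Otimes>\<^sub>M N)) = (\<Prod>j\<in>J. prob (?Z j -` A j \<inter> space (M \<Otimes>\<^sub>M N)))" .
    qed
  qed
  show ?thesis
    unfolding indep_vars_def2
  proof (intro conjI ballI rv)
    show "indep_sets (\<lambda>i. {?Z i -` A \<inter> space (M \<Otimes>\<^sub>M N) |A. A \<in> sets (M' i \<Otimes>\<^sub>M N' i)}) I"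
      using fin by (subst indep_sets_finite_index_sets) (auto simp: indep_vars_def2)
  qed
qed

lemma sets_PiM_discrete:
  assumes "finite I" "\<And>i. i \<in> I \<Longrightarrow> sets (M i) = UNIV" "countable (UNIV :: 'b set)"
  shows "sets (PiM I M :: ('i \<Rightarrow> 'b) measure) = Pow (I \<rightarrow>\<^sub>E UNIV)"
proof -
  have "sets (PiM I M) = sets (PiM I (\<lambda>_. count_space (UNIV :: 'b set)))"
    using assms(2) by (intro sets_PiM_cong) auto
  then show ?thesis
    using assms(1,3) by (simp add: count_space_PiM_finite)
qed

text \<open>Columns have type \<open>nat \<Rightarrow> 'a\<close>, which is in general uncountable,
  so \<open>sets_PiM_discrete\<close> does not cover them. Singletons are still finite boxes, and
  hence finite sets are measurable.\<close>

lemma finite_subset_sets_PiM: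
  assumes "finite I" "\<And>i. i \<in> I \<Longrightarrow> sets (M i) = UNIV" "finite S" "S \<subseteq> I \<rightarrow>\<^sub>E UNIV"
  shows "S \<in> sets (PiM I M)"
proof (rule sets.countable[OF _ countable_finite[OF assms(3)]])
  fix x assume "x \<in> S"
  then have x: "x \<in> extensional I" using assms(4) unfolding PiE_def by blast
  have "{x} = (\<Pi>\<^sub>E i\<in>I. {x i})"
    using x by (auto simp: PiE_iff extensional_def fun_eq_iff) metis
  also have "\<dots> \<in> sets (PiM I M)" using assms by (intro sets_PiM_I_finite) auto
  finally show "{x} \<in> sets (PiM I M)" .
qed

section \<open>The probability space of a single block\<close>

definition nonzero_column :: "'a ring \<Rightarrow> nat \<Rightarrow> (nat \<Rightarrow> 'a) pmf" where
  "nonzero_column F k = pmf_of_set (vectors F k - {zero_vector F k})"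

definition block_columns :: "'a ring \<Rightarrow> nat \<Rightarrow> nat \<Rightarrow> (nat \<Rightarrow> nat \<Rightarrow> 'a) measure" where
  "block_columns F k n = (\<Pi>\<^sub>M j\<in>{1..n}. measure_pmf (nonzero_column F k))"

definition block_erasures :: "real \<Rightarrow> nat \<Rightarrow> (nat \<Rightarrow> bool) measure" where
  "block_erasures \<epsilon> n = (\<Pi>\<^sub>M j\<in>{1..n}. measure_pmf (bernoulli_pmf \<epsilon>))"

definition block_space :: "'a ring \<Rightarrow> real \<Rightarrow> nat \<Rightarrow> nat \<Rightarrow> ((nat \<Rightarrow> nat \<Rightarrow> 'a) \<times> (nat \<Rightarrow> bool)) measure" where
  "block_space F \<epsilon> k n = block_columns F k n \<Otimes>\<^sub>M block_erasures \<epsilon> n"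

text \<open>Shifting the channel uses back to \<open>{1..n}\<close> puts all blocks on one space
  with the same law. Blocks are counted from 0 and encoders from 1, hence
  \<open>Suc i\<close>.\<close>

definition block :: "nat \<Rightarrow> nat \<Rightarrow> (nat \<Rightarrow> nat \<Rightarrow> nat \<Rightarrow> 'a) \<times> (nat \<Rightarrow> bool) \<Rightarrow> (nat \<Rightarrow> nat \<Rightarrow> 'a) \<times> (nat \<Rightarrow> bool)" where
  "block n i x = (fst x (Suc i), \<lambda>j\<in>{1..n}. snd x (i * n + j))"

lemma prob_space_block_columns: "prob_space (block_columns F k n)"
  unfolding block_columns_def by (intro prob_space_PiM measure_pmf.prob_space_axioms)

lemma prob_space_block_erasures: "prob_space (block_erasures \<epsilon> n)"
  unfolding block_erasures_def by (intro prob_space_PiM measure_pmf.prob_space_axioms)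

lemma random_encoders_eq: "random_encoders F k n = (\<Pi>\<^sub>M l\<in>{1..}. block_columns F k n)"
  unfolding random_encoders_def block_columns_def nonzero_column_def ..

lemma prob_space_random_encoders: "prob_space (random_encoders F k n)"
  unfolding random_encoders_eq by (intro prob_space_PiM prob_space_block_columns)

lemma prob_space_erasures: "prob_space (erasures \<epsilon>)"
  unfolding erasures_def by (intro prob_space_PiM measure_pmf.prob_space_axioms)

lemma prob_space_pair:
  assumes "prob_space M" "prob_space N"
  shows "prob_space (M \<Otimes>\<^sub>M N)"
proof -
  interpret M: prob_space M by fact
  interpret N: prob_space N by fact
  interpret pair_prob_space M N ..
  show ?thesis by (rule P.prob_space_axioms)
qed

lemma prob_space_random_scheme: "prob_space (random_scheme F \<epsilon> k n)"
  unfolding random_scheme_def by (intro prob_space_pair prob_space_random_encoders prob_space_erasures)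

lemma prob_space_block_space: "prob_space (block_space F \<epsilon> k n)"
  unfolding block_space_def by (intro prob_space_pair prob_space_block_columns prob_space_block_erasures)

lemma sets_block_erasures: "sets (block_erasures \<epsilon> n) = Pow ({1..n} \<rightarrow>\<^sub>E UNIV)"
  unfolding block_erasures_def by (rule sets_PiM_discrete) auto

lemma space_block_erasures: "space (block_erasures \<epsilon> n) = {1..n} \<rightarrow>\<^sub>E UNIV"
  unfolding block_erasures_def by (simp add: space_PiM)

lemma measurable_block_erasures: "f \<in> measurable (block_erasures \<epsilon> n) (count_space UNIV)"
  by (intro measurableI) (auto simp: sets_block_erasures space_block_erasures)

lemma erasure_block_measurable:
  "(\<lambda>e. \<lambda>j\<in>{1..n}. e (i * n + j)) \<in> measurable (erasures \<epsilon>) (block_erasures \<epsilon> n)"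
  unfolding erasures_def block_erasures_def
  by (intro measurable_restrict measurable_component_singleton) auto

lemma distr_random_encoders_block:
  "distr (random_encoders F k n) (block_columns F k n) (\<lambda>G. G (Suc i)) = block_columns F k n"
  unfolding random_encoders_eq by (intro distr_PiM_component prob_space_block_columns) auto

lemma distr_erasures_block:
  "distr (erasures \<epsilon>) (block_erasures \<epsilon> n) (\<lambda>e. \<lambda>j\<in>{1..n}. e (i * n + j)) = block_erasures \<epsilon> n"
  unfolding erasures_def block_erasures_def
  by (rule distr_PiM_reindex) (auto simp: measure_pmf.prob_space_axioms inj_on_def)

lemma block_measurable: "block n i \<in> measurable (random_scheme F \<epsilon> k n) (block_space F \<epsilon> k n)"
proof -
  have "(\<lambda>G. G (Suc i)) \<in> measurable (random_encoders F k n) (block_columns F k n)"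
    unfolding random_encoders_eq by (rule measurable_component_singleton) simp
  then show ?thesis
    unfolding block_def[abs_def] random_scheme_def block_space_def
    by (intro measurable_Pair measurable_compose[OF measurable_fst] measurable_compose[OF measurable_snd]
        erasure_block_measurable)
qed

lemma distr_block: "distr (random_scheme F \<epsilon> k n) (block_space F \<epsilon> k n) (block n i) = block_space F \<epsilon> k n"
proof -
  have "block_columns F k n \<Otimes>\<^sub>M block_erasures \<epsilon> n
      = distr (random_encoders F k n) (block_columns F k n) (\<lambda>G. G (Suc i))
          \<Otimes>\<^sub>M distr (erasures \<epsilon>) (block_erasures \<epsilon> n) (\<lambda>e. \<lambda>j\<in>{1..n}. e (i * n + j))"
    by (simp only: distr_random_encoders_block distr_erasures_block)
  also have "\<dots> = distr (random_encoders F k n \<Otimes>\<^sub>M erasures \<epsilon>) (block_columns F k n \<Otimes>\<^sub>M block_erasures \<epsilon> n)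
      (\<lambda>(G, e). (G (Suc i), \<lambda>j\<in>{1..n}. e (i * n + j)))"
  proof (rule pair_measure_distr)
    show "(\<lambda>G. G (Suc i)) \<in> measurable (random_encoders F k n) (block_columns F k n)"
      unfolding random_encoders_eq by (rule measurable_component_singleton) simp
    show "sigma_finite_measure (distr (erasures \<epsilon>) (block_erasures \<epsilon> n) (\<lambda>e. \<lambda>j\<in>{1..n}. e (i * n + j)))"
      unfolding distr_erasures_block
      by (intro finite_measure.axioms prob_space.axioms prob_space_block_erasures)
  qed (rule erasure_block_measurable)
  also have "(\<lambda>(G, e). (G (Suc i), \<lambda>j\<in>{1..n}. e (i * n + j))) = block n i"
    by (auto simp: block_def fun_eq_iff)
  finally show ?thesis by (simp add: block_space_def random_scheme_def)
qed

lemma indep_encoder_blocks: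
  "prob_space.indep_vars (random_encoders F k n) (\<lambda>_. block_columns F k n) (\<lambda>i G. G (Suc i)) UNIV"
proof -
  interpret prob_space "random_encoders F k n" by (rule prob_space_random_encoders)
  have coord: "indep_vars (\<lambda>_. block_columns F k n) (\<lambda>l G. G l) {1..}"
    unfolding random_encoders_eq by (intro indep_vars_PiM_component prob_space_block_columns) auto
  have "indep_vars (\<lambda>i. PiM {Suc i} (\<lambda>_. block_columns F k n)) (\<lambda>i G. restrict (\<lambda>l. G l) {Suc i}) UNIV"
    by (rule indep_vars_restrict[OF coord]) (auto simp: disjoint_family_on_def)
  then have "indep_vars (\<lambda>_. block_columns F k n) (\<lambda>i G. (\<lambda>x. x (Suc i)) (restrict (\<lambda>l. G l) {Suc i})) UNIV"
    by (rule indep_vars_compose2) (auto intro: measurable_component_singleton)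
  then show ?thesis by simp
qed

lemma indep_erasure_blocks:
  "prob_space.indep_vars (erasures \<epsilon>) (\<lambda>_. block_erasures \<epsilon> n) (\<lambda>i e. \<lambda>j\<in>{1..n}. e (i * n + j)) UNIV"
proof -
  interpret prob_space "erasures \<epsilon>" by (rule prob_space_erasures)
  let ?B = "\<lambda>_. measure_pmf (bernoulli_pmf \<epsilon>)"
  let ?K = "\<lambda>i. {i * n + 1..i * n + n}"
  have coord: "indep_vars ?B (\<lambda>l e. e l) {1..}"
    unfolding erasures_def by (intro indep_vars_PiM_component measure_pmf.prob_space_axioms) auto
  have disj: "?K i \<inter> ?K i' = {}" if "i \<noteq> i'" for i i'
  proof -
    have "Suc i * n \<le> i' * n \<or> Suc i' * n \<le> i * n"
      using that by (metis Suc_leI linorder_neqE_nat mult_le_mono1)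
    then show ?thesis by auto
  qed
  have "indep_vars (\<lambda>i. PiM (?K i) ?B) (\<lambda>i e. restrict (\<lambda>l. e l) (?K i)) UNIV"
  proof (rule indep_vars_restrict[OF coord])
    show "disjoint_family_on ?K UNIV"
      unfolding disjoint_family_on_def using disj by blast
  qed auto
  then have "indep_vars (\<lambda>_. block_erasures \<epsilon> n) (\<lambda>i e. (\<lambda>x. \<lambda>j\<in>{1..n}. x (i * n + j)) (restrict (\<lambda>l. e l) (?K i))) UNIV"
    unfolding block_erasures_def
    by (rule indep_vars_compose2) (intro measurable_restrict measurable_component_singleton, auto)
  moreover have "(\<lambda>j\<in>{1..n}. restrict (\<lambda>l. e l) (?K i) (i * n + j)) = (\<lambda>j\<in>{1..n}. e (i * n + j))"
    for e :: "nat \<Rightarrow> bool" and i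
    by (auto simp: restrict_def)
  ultimately show ?thesis by simp
qed

lemma indep_blocks:
  "prob_space.indep_vars (random_scheme F \<epsilon> k n) (\<lambda>_. block_space F \<epsilon> k n) (block n) UNIV"
  using indep_vars_pair_measure[OF prob_space_random_encoders prob_space_erasures indep_encoder_blocks indep_erasure_blocks]
  unfolding random_scheme_def block_space_def block_def[abs_def] .

text \<open>Stated for an arbitrary decoding position \<phi> computed from one block, since it is
  applied both to the actual and to the idealized decoder.\<close>

theorem AE_random_scheme_average:
  assumes \<phi>[measurable]: "\<phi> \<in> measurable (block_space F \<epsilon> k n) (count_space UNIV)"
    and pos: "0 < measure (block_space F \<epsilon> k n) {x \<in> space (block_space F \<epsilon> k n). \<phi> x \<le> n}"
  shows "AE x in random_scheme F \<epsilon> k n.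
    (\<lambda>N. (\<Sum>i<N. real (gap n (\<lambda>j. \<phi> (block n j x)) i * min (\<phi> (block n i x)) n)) / real N)
      \<longlonglongrightarrow> (\<integral>x. real (min (\<phi> x) n) \<partial>block_space F \<epsilon> k n)
          / measure (block_space F \<epsilon> k n) {x \<in> space (block_space F \<epsilon> k n). \<phi> x \<le> n}"
proof -
  interpret prob_space "random_scheme F \<epsilon> k n" by (rule prob_space_random_scheme)
  note block_measurable[of n _ F \<epsilon> k, measurable]
  show ?thesis
  proof (rule AE_renewal_average[OF _ _ pos])
    show "indep_vars (\<lambda>_. count_space UNIV) (\<lambda>i x. \<phi> (block n i x)) UNIV"
      by (rule indep_vars_compose2[OF indep_blocks]) (rule \<phi>)
    show "prob {x \<in> space (random_scheme F \<epsilon> k n). \<phi> (block n i x) \<le> n}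
        = measure (block_space F \<epsilon> k n) {x \<in> space (block_space F \<epsilon> k n). \<phi> x \<le> n}" for i
    proof -
      have "measure (distr (random_scheme F \<epsilon> k n) (block_space F \<epsilon> k n) (block n i)) {x \<in> space (block_space F \<epsilon> k n). \<phi> x \<le> n}
          = prob (block n i -` {x \<in> space (block_space F \<epsilon> k n). \<phi> x \<le> n} \<inter> space (random_scheme F \<epsilon> k n))"
        by (intro measure_distr) measurable
      also have "block n i -` {x \<in> space (block_space F \<epsilon> k n). \<phi> x \<le> n} \<inter> space (random_scheme F \<epsilon> k n)
          = {x \<in> space (random_scheme F \<epsilon> k n). \<phi> (block n i x) \<le> n}"
        using measurable_space[OF block_measurable[of n i F \<epsilon> k]] by auto
      finally show ?thesis by (simp add: distr_block)
    qed
    show "expectation (\<lambda>x. real (min (\<phi> (block n i x)) n)) = (\<integral>x. real (min (\<phi> x) n) \<partial>block_space F \<epsilon> k n)" for i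
    proof -
      have "(\<integral>x. real (min (\<phi> x) n) \<partial>distr (random_scheme F \<epsilon> k n) (block_space F \<epsilon> k n) (block n i))
          = expectation (\<lambda>x. real (min (\<phi> (block n i x)) n))"
        by (intro integral_distr) measurable
      then show ?thesis by (simp add: distr_block)
    qed
  qed
qed

section \<open>Decoding from any \<open>k\<close> symbols\<close>

text \<open>The negative binomial law counts the failures before the \<open>r\<close>-th success;
  adding the \<open>r\<close> successes counts trials. This makes its recursion and its mass
  function available.\<close>

lemma geometric_sum_pmf_eq: "geometric_sum_pmf r p = map_pmf (\<lambda>x. x + r) (neg_binomial_pmf r p)"
proof (induction r)
  case 0
  then show ?case by (simp add: geometric_sum_pmf_def)
next
  case (Suc r)
  have "geometric_sum_pmf (Suc r) p = geometric_pmf p \<bind> (\<lambda>x. map_pmf (\<lambda>s. Suc x + s) (geometric_sum_pmf r p))"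
    unfolding geometric_sum_pmf_def
    by (simp add: map_pmf_def bind_assoc_pmf bind_return_pmf)
  also have "\<dots> = map_pmf (\<lambda>x. x + Suc r) (neg_binomial_pmf (Suc r) p)"
    unfolding Suc neg_binomial_pmf_Suc
    by (simp add: map_pmf_def bind_assoc_pmf bind_return_pmf pair_pmf_def add_ac)
  finally show ?case .
qed

lemma prob_bind_bernoulli_pmf:
  assumes "0 \<le> p" "p \<le> 1"
  shows "measure_pmf.prob (bernoulli_pmf p \<bind> f) X
    = p * measure_pmf.prob (f True) X + (1 - p) * measure_pmf.prob (f False) X"
proof -
  have "ennreal (measure_pmf.prob (bernoulli_pmf p \<bind> f) X)
      = ennreal (p * measure_pmf.prob (f True) X + (1 - p) * measure_pmf.prob (f False) X)"
    using emeasure_bind_pmf[of "bernoulli_pmf p" f X] assms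
    by (simp add: measure_pmf.emeasure_eq_measure ennreal_mult ennreal_plus mult.commute)
  then show ?thesis
    using assms by (subst (asm) ennreal_inj) auto
qed

context
  fixes p :: real
  assumes p: "0 < p" "p \<le> 1"
begin

text \<open>Condition on the first trial: a success leaves \<open>r\<close> further successes to be
  found in \<open>j\<close> trials, a failure leaves \<open>Suc r\<close>.\<close>

lemma geometric_sum_cdf_Suc_Suc:
  "measure_pmf.prob (geometric_sum_pmf (Suc r) p) {..Suc j}
     = p * measure_pmf.prob (geometric_sum_pmf r p) {..j} + (1 - p) * measure_pmf.prob (geometric_sum_pmf (Suc r) p) {..j}"
proof -
  have vimage: "(\<lambda>x. x + Suc r) -` {..Suc j} = (\<lambda>x. x + r) -` {..j}" "Suc -` ((\<lambda>x. x + Suc r) -` {..Suc j}) = (\<lambda>x. x + Suc r) -` {..j}"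
    by auto
  have "measure_pmf.prob (geometric_sum_pmf (Suc r) p) {..Suc j}
      = measure_pmf.prob (neg_binomial_pmf (Suc r) p) ((\<lambda>x. x + Suc r) -` {..Suc j})"
    by (simp add: geometric_sum_pmf_eq)
  also have "\<dots> = p * measure_pmf.prob (neg_binomial_pmf r p) ((\<lambda>x. x + Suc r) -` {..Suc j})
      + (1 - p) * measure_pmf.prob (neg_binomial_pmf (Suc r) p) (Suc -` ((\<lambda>x. x + Suc r) -` {..Suc j}))"
    using p by (subst neg_binomial_pmf_unfold) (auto simp: prob_bind_bernoulli_pmf)
  also have "\<dots> = p * measure_pmf.prob (geometric_sum_pmf r p) {..j} + (1 - p) * measure_pmf.prob (geometric_sum_pmf (Suc r) p) {..j}"
    unfolding vimage(2) by (simp only: vimage(1) geometric_sum_pmf_eq measure_map_pmf)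
  finally show ?thesis .
qed

lemma geometric_sum_cdf_below: "j < r \<Longrightarrow> measure_pmf.prob (geometric_sum_pmf r p) {..j} = 0"
proof -
  assume "j < r"
  then have "(\<lambda>x. x + r) -` {..j} = {}" by auto
  then show ?thesis by (simp add: geometric_sum_pmf_eq)
qed

lemma geometric_sum_cdf_step:
  "measure_pmf.prob (geometric_sum_pmf r p) {..Suc j} = measure_pmf.prob (geometric_sum_pmf r p) {..j} + pmf (geometric_sum_pmf r p) (Suc j)"
  using measure_pmf.finite_measure_Union[of "{..j}" "geometric_sum_pmf r p" "{Suc j}"]
  by (simp add: atMost_Suc Un_insert_right insert_def[symmetric] measure_pmf_single Un_commute)

lemma pmf_geometric_sum:
  "pmf (geometric_sum_pmf r p) m = (if m < r then 0 else real ((m - 1) choose (m - r)) * p ^ r * (1 - p) ^ (m - r))"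
proof (cases "m < r")
  case True
  then have "m \<notin> set_pmf (geometric_sum_pmf r p)" by (auto simp: geometric_sum_pmf_eq)
  then show ?thesis using True by (simp add: set_pmf_iff)
next
  case False
  then obtain x where m: "m = x + r" by (metis add.commute le_Suc_ex not_le)
  have "pmf (geometric_sum_pmf r p) m = pmf (neg_binomial_pmf r p) x"
    unfolding geometric_sum_pmf_eq m by (rule pmf_map_inj') (simp add: inj_on_def)
  then show ?thesis using p by (simp add: pmf_neg_binomial m)
qed

text \<open>By the absorption identity for binomial coefficients, size-biasing the
  \<open>r\<close>-th success time gives, up to the factor \<open>r / p\<close> and a shift by one,
  the next success time. This is the origin of \<open>k + 1\<close> and \<open>n + 1\<close> in the
  lower bound.\<close>

lemma pmf_geometric_sum_Suc_Suc:
  assumes "0 < r"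
  shows "real (Suc m) * pmf (geometric_sum_pmf r p) (Suc m)
    = real r / p * pmf (geometric_sum_pmf (Suc r) p) (Suc (Suc m))"
proof (cases "Suc m < r")
  case True
  then show ?thesis by (simp add: pmf_geometric_sum)
next
  case False
  obtain s where r: "r = Suc s" using assms gr0_implies_Suc by blast
  then have s: "s \<le> m" using False by simp
  have "m choose (m - s) = m choose s" "Suc m choose (m - s) = Suc m choose Suc s"
    using s binomial_symmetric[of s m] binomial_symmetric[of "Suc s" "Suc m"] by auto
  moreover have "real (Suc m) * real (m choose s) = real (Suc s) * real (Suc m choose Suc s)"
    using Suc_times_binomial_eq[of m s] by (metis of_nat_mult mult.commute)
  ultimately have "real (Suc m) * real (m choose (m - s)) = real (Suc s) * real (Suc m choose (m - s))"
    by simp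
  moreover have "pmf (geometric_sum_pmf r p) (Suc m) = real (m choose (m - s)) * (p ^ Suc s * (1 - p) ^ (m - s))"
    using s by (simp add: pmf_geometric_sum r mult.assoc del: power_Suc)
  moreover have "pmf (geometric_sum_pmf (Suc r) p) (Suc (Suc m))
      = real (Suc m choose (m - s)) * (p * (p ^ Suc s * (1 - p) ^ (m - s)))"
    using s by (simp add: pmf_geometric_sum r mult.assoc del: binomial_Suc_Suc)
  ultimately show ?thesis using p by (simp add: r del: binomial_Suc_Suc of_nat_Suc power_Suc)
qed

text \<open>For a variable B with this law the left side is E max(n - B, 0), that is n P(B \<le> n)
  minus the mean of B truncated to B \<le> n, and size-biasing evaluates the truncated mean. In the
  induction the two increments at \<open>Suc n\<close> cancel.\<close>

lemma sum_geometric_sum_cdf: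
  assumes r: "0 < r"
  shows "(\<Sum>j<n. measure_pmf.prob (geometric_sum_pmf r p) {..j})
    = real n * measure_pmf.prob (geometric_sum_pmf r p) {..n}
      - real r / p * measure_pmf.prob (geometric_sum_pmf (Suc r) p) {..Suc n}"
proof (induction n)
  case 0
  then show ?case using r by (simp add: geometric_sum_cdf_below)
next
  case (Suc n)
  let ?Q = "\<lambda>r j. measure_pmf.prob (geometric_sum_pmf r p) {..j}"
  have "real (Suc n) * ?Q r (Suc n) - real r / p * ?Q (Suc r) (Suc (Suc n))
      = real (Suc n) * ?Q r n - real r / p * ?Q (Suc r) (Suc n)"
    unfolding geometric_sum_cdf_step[of r n] geometric_sum_cdf_step[of "Suc r" "Suc n"]
    using pmf_geometric_sum_Suc_Suc[OF r, of n] by (simp only: distrib_left)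
  then show ?case using Suc by (simp add: algebra_simps)
qed

end

text \<open>The value \<open>Suc n\<close> means that \<open>P\<close> is not reached within the block.\<close>

definition decode_pos :: "nat \<Rightarrow> (nat set \<Rightarrow> bool) \<Rightarrow> nat set \<Rightarrow> nat" where
  "decode_pos n P R = (LEAST j. 1 \<le> j \<and> (j \<le> n \<longrightarrow> P (R \<inter> {..j})))"

definition unerased :: "nat \<Rightarrow> (nat \<Rightarrow> bool) \<Rightarrow> nat set" where
  "unerased n e = {j \<in> {1..n}. \<not> e j}"

text \<open>\<open>P\<close> receives the columns of the block as well as the received positions, so
  that one definition covers the actual and the idealized decoder.\<close>

definition decode_time :: "nat \<Rightarrow> ('m \<Rightarrow> nat set \<Rightarrow> bool) \<Rightarrow> 'm \<times> (nat \<Rightarrow> bool) \<Rightarrow> nat" where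
  "decode_time n P x = decode_pos n (P (fst x)) (unerased n (snd x))"

lemma decode_pos_props:
  shows "1 \<le> decode_pos n P R" and "decode_pos n P R \<le> n \<Longrightarrow> P (R \<inter> {..decode_pos n P R})"
proof -
  have "1 \<le> Suc n \<and> (Suc n \<le> n \<longrightarrow> P (R \<inter> {..Suc n}))" by simp
  from LeastI[of "\<lambda>j. 1 \<le> j \<and> (j \<le> n \<longrightarrow> P (R \<inter> {..j}))", OF this]
  show "1 \<le> decode_pos n P R" and "decode_pos n P R \<le> n \<Longrightarrow> P (R \<inter> {..decode_pos n P R})"
    unfolding decode_pos_def by blast+
qed

lemma decode_pos_le: "1 \<le> j \<Longrightarrow> P (R \<inter> {..j}) \<Longrightarrow> decode_pos n P R \<le> j"
  unfolding decode_pos_def by (rule Least_le) simp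

lemma decode_pos_le_Suc: "decode_pos n P R \<le> Suc n"
  unfolding decode_pos_def by (rule Least_le) simp

text \<open>Pathwise comparison of decoders: an easier criterion fires no later. Lost blocks fit in
  because every position is at most \<open>Suc n\<close>.\<close>

lemma decode_pos_antimono:
  assumes "\<And>J. J \<subseteq> R \<Longrightarrow> P J \<Longrightarrow> Q J"
  shows "decode_pos n Q R \<le> decode_pos n P R"
proof (cases "decode_pos n P R \<le> n")
  case True
  then have "Q (R \<inter> {..decode_pos n P R})" using decode_pos_props(2) assms by blast
  then show ?thesis by (intro decode_pos_le decode_pos_props(1))
next
  case False
  then show ?thesis using decode_pos_le_Suc[of n Q R] by simp
qed

lemma decode_pos_cong:
  assumes "\<And>J. J \<subseteq> R \<Longrightarrow> P J \<longleftrightarrow> Q J"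
  shows "decode_pos n P R = decode_pos n Q R"
  using assms by (intro antisym decode_pos_antimono) auto

text \<open>Cardinality is monotone in the prefix, so the criterion stays true once it is met.
  \<open>0 \<notin> R\<close> settles \<open>j = 0\<close>, where the left side fails because
  positions start at 1.\<close>

lemma decode_pos_card_le_iff:
  assumes "1 \<le> k" "j \<le> n" "finite R" "0 \<notin> R"
  shows "decode_pos n (\<lambda>J. k \<le> card J) R \<le> j \<longleftrightarrow> k \<le> card (R \<inter> {..j})"
proof
  assume le: "decode_pos n (\<lambda>J. k \<le> card J) R \<le> j"
  then have "k \<le> card (R \<inter> {..decode_pos n (\<lambda>J. k \<le> card J) R})"
    using assms(2) decode_pos_props(2)[where P="\<lambda>J. k \<le> card J"] by simp
  also have "\<dots> \<le> card (R \<inter> {..j})"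
    using le assms(3) by (intro card_mono) auto
  finally show "k \<le> card (R \<inter> {..j})" .
next
  assume k: "k \<le> card (R \<inter> {..j})"
  have "j \<noteq> 0"
  proof
    assume "j = 0"
    then have "R \<inter> {..j} = {}" using assms(4) by auto
    then show False using k assms(1) by simp
  qed
  then show "decode_pos n (\<lambda>J. k \<le> card J) R \<le> j" using k by (intro decode_pos_le) auto
qed

lemma unerased_subset: "unerased n e \<subseteq> {1..n}"
  by (auto simp: unerased_def)

lemma finite_unerased: "finite (unerased n e)"
  using unerased_subset finite_subset by blast

section \<open>Distribution of decoding times within a block\<close>

lemma decode_time_measurable:
  assumes "\<And>J. J \<subseteq> {1..n} \<Longrightarrow> Measurable.pred (block_columns F k n) (\<lambda>M. P M J)"
  shows "decode_time n P \<in> measurable (block_space F \<epsilon> k n) (count_space UNIV)"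
  unfolding decode_time_def[abs_def] decode_pos_def block_space_def
proof (intro measurable_Least)
  fix j
  \<comment> \<open>Splitting by the finitely many values of the received set separates the columns
    from the erasures.\<close>
  have "(\<lambda>x. P (fst x) (unerased n (snd x) \<inter> {..j}))
      = (\<lambda>x. \<exists>J\<in>Pow {1..n}. unerased n (snd x) \<inter> {..j} = J \<and> P (fst x) J)"
    using unerased_subset by fastforce
  moreover have "Measurable.pred (block_columns F k n \<Otimes>\<^sub>M block_erasures \<epsilon> n)
      (\<lambda>x. \<exists>J\<in>Pow {1..n}. unerased n (snd x) \<inter> {..j} = J \<and> P (fst x) J)"
  proof (intro pred_intros_finite pred_intros_logic)
    fix J :: "nat set" assume "J \<in> Pow {1..n}"
    then have [measurable]: "Measurable.pred (block_columns F k n) (\<lambda>M. P M J)" using assms by blast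
    have [measurable]: "Measurable.pred (block_erasures \<epsilon> n) (\<lambda>e. unerased n e \<inter> {..j} = J)"
      by (rule measurable_block_erasures)
    show "Measurable.pred (block_columns F k n \<Otimes>\<^sub>M block_erasures \<epsilon> n) (\<lambda>x. unerased n (snd x) \<inter> {..j} = J)"
      by measurable
    show "Measurable.pred (block_columns F k n \<Otimes>\<^sub>M block_erasures \<epsilon> n) (\<lambda>x. P (fst x) J)"
      by measurable
  qed simp
  ultimately have "Measurable.pred (block_columns F k n \<Otimes>\<^sub>M block_erasures \<epsilon> n) (\<lambda>x. P (fst x) (unerased n (snd x) \<inter> {..j}))"
    by simp
  then show "Measurable.pred (block_columns F k n \<Otimes>\<^sub>M block_erasures \<epsilon> n)
      (\<lambda>x. 1 \<le> j \<and> (j \<le> n \<longrightarrow> P (fst x) (unerased n (snd x) \<inter> {..j})))"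
    by measurable
qed

text \<open>Condition on symbol \<open>Suc j\<close>, whose erasure is independent of the count
  among the first \<open>j\<close>. The resulting recursion is that of
  \<open>geometric_sum_cdf_Suc_Suc\<close>.\<close>

lemma block_erasures_count_Suc:
  assumes \<epsilon>: "0 \<le> \<epsilon>" "\<epsilon> \<le> 1" and j: "Suc j \<le> n"
  shows "measure (block_erasures \<epsilon> n) {e \<in> space (block_erasures \<epsilon> n). Suc k \<le> card (unerased n e \<inter> {..Suc j})}
    = (1 - \<epsilon>) * measure (block_erasures \<epsilon> n) {e \<in> space (block_erasures \<epsilon> n). k \<le> card (unerased n e \<inter> {..j})}
      + \<epsilon> * measure (block_erasures \<epsilon> n) {e \<in> space (block_erasures \<epsilon> n). Suc k \<le> card (unerased n e \<inter> {..j})}"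
proof -
  interpret prob_space "block_erasures \<epsilon> n" by (rule prob_space_block_erasures)
  let ?B = "\<lambda>_. measure_pmf (bernoulli_pmf \<epsilon>)"
  let ?S = "space (block_erasures \<epsilon> n)"
  let ?c = "\<lambda>e. card (unerased n e \<inter> {..j})"
  have coord: "indep_vars ?B (\<lambda>l e. e l) {1..n}"
    using j unfolding block_erasures_def by (intro indep_vars_PiM_component measure_pmf.prob_space_axioms) auto
  have "indep_var (PiM {1..j} ?B) (\<lambda>e. restrict (\<lambda>l. e l) {1..j}) (PiM {Suc j} ?B) (\<lambda>e. restrict (\<lambda>l. e l) {Suc j})"
    using j by (intro indep_var_restrict[OF coord]) auto
  then have "indep_var (count_space UNIV) ((\<lambda>e. card (unerased j e)) \<circ> (\<lambda>e. restrict (\<lambda>l. e l) {1..j}))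
      (count_space UNIV) ((\<lambda>e. of_bool (e (Suc j))) \<circ> (\<lambda>e. restrict (\<lambda>l. e l) {Suc j}))"
    by (rule indep_var_compose) (auto intro!: measurableI simp: sets_PiM_discrete space_PiM)
  moreover have "unerased j (restrict (\<lambda>l. e l) {1..j}) = unerased n e \<inter> {..j}" for e
    using j by (auto simp: unerased_def)
  ultimately have indep: "indep_var (count_space UNIV) ?c (count_space UNIV) (\<lambda>e. of_bool (e (Suc j)) :: nat)"
    by (simp add: comp_def)
  have rule: "prob {e \<in> ?S. m \<le> ?c e \<and> e (Suc j) = b} = prob {e \<in> ?S. m \<le> ?c e} * prob {e \<in> ?S. e (Suc j) = b}" for m b
    using indep_varD[OF indep, of "{m..}" "{of_bool b}"]
    by (simp add: vimage_def Int_def conj_ac of_bool_eq_iff)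
  have coin: "prob {e \<in> ?S. e (Suc j) = b} = pmf (bernoulli_pmf \<epsilon>) b" for b
  proof -
    have "measure (distr (block_erasures \<epsilon> n) (measure_pmf (bernoulli_pmf \<epsilon>)) (\<lambda>e. e (Suc j))) {b} = prob ((\<lambda>e. e (Suc j)) -` {b} \<inter> ?S)"
      using j by (intro measure_distr) (auto simp: block_erasures_def intro: measurable_component_singleton)
    moreover have "distr (block_erasures \<epsilon> n) (measure_pmf (bernoulli_pmf \<epsilon>)) (\<lambda>e. e (Suc j)) = measure_pmf (bernoulli_pmf \<epsilon>)"
      using j unfolding block_erasures_def by (intro distr_PiM_component measure_pmf.prob_space_axioms) auto
    ultimately show ?thesis by (simp add: measure_pmf_single vimage_def Int_def conj_commute)
  qed
  have card_Suc: "card (unerased n e \<inter> {..Suc j}) = (if e (Suc j) then ?c e else Suc (?c e))" for e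
  proof -
    have "unerased n e \<inter> {..Suc j} = (if e (Suc j) then unerased n e \<inter> {..j} else insert (Suc j) (unerased n e \<inter> {..j}))"
      using j by (auto simp: unerased_def le_Suc_eq)
    then show ?thesis using finite_unerased[of n e] by simp
  qed
  have "prob {e \<in> ?S. Suc k \<le> card (unerased n e \<inter> {..Suc j})}
      = prob ({e \<in> ?S. k \<le> ?c e \<and> e (Suc j) = False} \<union> {e \<in> ?S. Suc k \<le> ?c e \<and> e (Suc j) = True})"
    by (intro arg_cong[where f=prob]) (auto simp: card_Suc split: if_splits)
  also have "\<dots> = prob {e \<in> ?S. k \<le> ?c e \<and> e (Suc j) = False} + prob {e \<in> ?S. Suc k \<le> ?c e \<and> e (Suc j) = True}"
    by (intro finite_measure_Union) (auto simp: sets_block_erasures space_block_erasures)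
  finally show ?thesis
    unfolding rule coin using \<epsilon> by (simp add: mult.commute)
qed

text \<open>Both sides satisfy one recursion in \<open>j\<close> with equal boundary values,
  although one arises from the last symbol and the other from the first trial. This stands in for a
  coupling of the erasures with waiting times.\<close>

lemma block_erasures_count:
  assumes "0 \<le> \<epsilon>" "\<epsilon> < 1" and "j \<le> n"
  shows "measure (block_erasures \<epsilon> n) {e \<in> space (block_erasures \<epsilon> n). k \<le> card (unerased n e \<inter> {..j})}
    = measure_pmf.prob (geometric_sum_pmf k (1 - \<epsilon>)) {..j}"
  using assms(3)
proof (induction j arbitrary: k)
  case 0
  interpret prob_space "block_erasures \<epsilon> n" by (rule prob_space_block_erasures)
  have "unerased n e \<inter> {..0} = {}" for e by (auto simp: unerased_def)
  then show ?case
    using prob_space geometric_sum_cdf_below[of "1 - \<epsilon>" 0 k] assms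
    by (cases k) (simp_all add: geometric_sum_pmf_eq vimage_def)
next
  case (Suc j)
  interpret prob_space "block_erasures \<epsilon> n" by (rule prob_space_block_erasures)
  show ?case
  proof (cases k)
    case 0
    then show ?thesis using prob_space by (simp add: geometric_sum_pmf_eq vimage_def)
  next
    case (Suc k')
    then show ?thesis
      using Suc.IH[of k'] Suc.IH[of k] Suc.prems assms block_erasures_count_Suc[of \<epsilon> j n k']
        geometric_sum_cdf_Suc_Suc[of "1 - \<epsilon>" k' j]
      by simp
  qed
qed

text \<open>Pointwise, \<open>min m n\<close> is \<open>n\<close> minus the number of
  \<open>j < n\<close> with \<open>m \<le> j\<close>; so expectations reduce to distribution
  functions.\<close>

lemma (in prob_space) expectation_min:
  fixes \<phi> :: "'a \<Rightarrow> nat"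
  assumes \<phi>[measurable]: "\<phi> \<in> measurable M (count_space UNIV)"
  shows "expectation (\<lambda>x. real (min (\<phi> x) n)) = real n - (\<Sum>j<n. prob {x \<in> space M. \<phi> x \<le> j})"
proof -
  have single: "expectation (\<lambda>x. indicat_real {..j} (\<phi> x)) = prob {x \<in> space M. \<phi> x \<le> j}" for j
  proof -
    have "expectation (\<lambda>x. indicat_real {..j} (\<phi> x)) = expectation (indicat_real {x \<in> space M. \<phi> x \<le> j})"
      by (intro Bochner_Integration.integral_cong) (auto simp: indicator_def)
    then show ?thesis by simp
  qed
  have "real (min m n) = real n - (\<Sum>j<n. indicat_real {..j} m)" for m :: nat
  proof (induction n)
    case (Suc n)
    then show ?case by (auto simp: min_def indicator_def split: if_splits)
  qed simp
  then have "expectation (\<lambda>x. real (min (\<phi> x) n)) = expectation (\<lambda>x. real n - (\<Sum>j<n. indicat_real {..j} (\<phi> x)))"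
    by simp
  also have "\<dots> = real n - (\<Sum>j<n. expectation (\<lambda>x. indicat_real {..j} (\<phi> x)))"
  proof -
    have "integrable M (\<lambda>x. indicat_real {..j} (\<phi> x))" for j
      by (intro integrable_const_bound[where B=1]) (auto simp: indicator_def)
    then show ?thesis by (simp add: prob_space)
  qed
  finally show ?thesis by (simp add: single)
qed

text \<open>In a maximum distance separable code any \<open>k\<close> coordinates determine the
  message. This is the decoder of such a code, whether or not one exists over the field.\<close>

abbreviation mds_time :: "nat \<Rightarrow> nat \<Rightarrow> 'm \<times> (nat \<Rightarrow> bool) \<Rightarrow> nat" where
  "mds_time k n \<equiv> decode_time n (\<lambda>_ J. k \<le> card J)"

lemma mds_time_measurable: "mds_time k' n \<in> measurable (block_space F \<epsilon> k n) (count_space UNIV)"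
  by (rule decode_time_measurable) simp

lemma mds_time_cdf:
  assumes \<epsilon>: "0 \<le> \<epsilon>" "\<epsilon> < 1" and k: "1 \<le> k" and j: "j \<le> n"
  shows "measure (block_space F \<epsilon> k n) {x \<in> space (block_space F \<epsilon> k n). mds_time k n x \<le> j}
    = measure_pmf.prob (geometric_sum_pmf k (1 - \<epsilon>)) {..j}"
proof -
  interpret C: prob_space "block_columns F k n" by (rule prob_space_block_columns)
  interpret E: prob_space "block_erasures \<epsilon> n" by (rule prob_space_block_erasures)
  interpret P: prob_space "block_space F \<epsilon> k n" by (rule prob_space_block_space)
  let ?A = "{e \<in> space (block_erasures \<epsilon> n). k \<le> card (unerased n e \<inter> {..j})}"
  have "0 \<notin> unerased n e" for e by (auto simp: unerased_def)
  then have "{x \<in> space (block_space F \<epsilon> k n). mds_time k n x \<le> j} = space (block_columns F k n) \<times> ?A"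
    using decode_pos_card_le_iff[OF k j finite_unerased]
    by (auto simp: block_space_def space_pair_measure decode_time_def)
  moreover have "?A \<in> sets (block_erasures \<epsilon> n)"
    by (auto simp: sets_block_erasures space_block_erasures)
  ultimately have "emeasure (block_space F \<epsilon> k n) {x \<in> space (block_space F \<epsilon> k n). mds_time k n x \<le> j} = emeasure (block_erasures \<epsilon> n) ?A"
    by (simp add: block_space_def E.emeasure_pair_measure_Times C.emeasure_space_1)
  then show ?thesis
    using block_erasures_count[OF \<epsilon> j, of k] by (simp add: P.emeasure_eq_measure E.emeasure_eq_measure)
qed

lemma mds_time_expectation:
  assumes \<epsilon>: "0 \<le> \<epsilon>" "\<epsilon> < 1" and k: "1 \<le> k"
  shows "(\<integral>x. real (min (mds_time k n x) n) \<partial>block_space F \<epsilon> k n)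
    = real n - real n * measure_pmf.prob (geometric_sum_pmf k (1 - \<epsilon>)) {..n}
      + real k / (1 - \<epsilon>) * measure_pmf.prob (geometric_sum_pmf (Suc k) (1 - \<epsilon>)) {..Suc n}"
proof -
  interpret P: prob_space "block_space F \<epsilon> k n" by (rule prob_space_block_space)
  have "(\<Sum>j<n. P.prob {x \<in> space (block_space F \<epsilon> k n). mds_time k n x \<le> j})
      = (\<Sum>j<n. measure_pmf.prob (geometric_sum_pmf k (1 - \<epsilon>)) {..j})"
    by (intro sum.cong refl mds_time_cdf assms) auto
  then show ?thesis
    unfolding P.expectation_min[OF mds_time_measurable]
    using sum_geometric_sum_cdf[of "1 - \<epsilon>" k n] assms by simp
qed

lemma geometric_sum_cdf_pos:
  assumes "0 < p" "p \<le> 1" "r \<le> n"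
  shows "0 < measure_pmf.prob (geometric_sum_pmf r p) {..n}"
proof -
  have "0 < pmf (geometric_sum_pmf r p) r"
    using assms by (simp add: pmf_geometric_sum)
  also have "\<dots> \<le> measure_pmf.prob (geometric_sum_pmf r p) {..n}"
    unfolding measure_pmf_single[symmetric] using assms by (intro measure_pmf.finite_measure_mono) auto
  finally show ?thesis .
qed

text \<open>This is the renewal value with the idealized p and \<mu> inserted. It holds for every
  \<open>F\<close>, since the idealized decoder does not look at the columns.\<close>

lemma age_lower_bound_eq:
  assumes \<epsilon>: "0 \<le> \<epsilon>" "\<epsilon> < 1" and k: "1 \<le> k" "k \<le> n"
  shows "age_lower_bound \<epsilon> k t0 n = real n / 2 - 1 + frac (- t0)
    + (\<integral>x. real (min (mds_time k n x) n) \<partial>block_space F \<epsilon> k n)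
      / measure (block_space F \<epsilon> k n) {x \<in> space (block_space F \<epsilon> k n). mds_time k n x \<le> n}"
proof -
  have "0 < measure_pmf.prob (geometric_sum_pmf k (1 - \<epsilon>)) {..n}"
    using \<epsilon> k by (intro geometric_sum_cdf_pos) auto
  then show ?thesis
    unfolding mds_time_expectation[OF \<epsilon> k(1)] mds_time_cdf[OF \<epsilon> k(1) order_refl] age_lower_bound_def Let_def
    using \<epsilon> by (simp add: field_simps)
qed

lemma age_lower_bound_ge:
  assumes \<epsilon>: "0 \<le> \<epsilon>" "\<epsilon> < 1" and k: "1 \<le> k" "k \<le> n"
  shows "real n / 2 - 1 \<le> age_lower_bound \<epsilon> k t0 n"
  \<comment> \<open>Any structure serves as \<open>F\<close> here; the terms beyond
    \<open>n / 2 - 1\<close> are nonnegative.\<close>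
  unfolding age_lower_bound_eq[OF assms, where F="undefined :: nat ring"]
  by (simp add: add_increasing2 divide_nonneg_nonneg)

section \<open>Columns over a finite field\<close>

definition dot :: "'a ring \<Rightarrow> nat \<Rightarrow> (nat \<Rightarrow> 'a) \<Rightarrow> (nat \<Rightarrow> 'a) \<Rightarrow> 'a" where
  "dot F k u x = (\<Oplus>\<^bsub>F\<^esub>i\<in>{..<k}. u i \<otimes>\<^bsub>F\<^esub> x i)"

lemma encode_eq_dot: "encode F k M u j = dot F k u (M j)"
  by (simp add: encode_def dot_def)

lemma decodable_mono: "decodable F k M J \<Longrightarrow> J \<subseteq> J' \<Longrightarrow> decodable F k M J'"
  unfolding decodable_def by blast

locale finite_field_columns =
  fixes F :: "'a ring" (structure) and q k :: nat
  assumes galois: "galois_field q F" and k_pos: "1 \<le> k"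
begin

sublocale field F
  using galois by (simp add: galois_field_def)

lemma finite_carrier: "finite (carrier F)" and card_carrier: "card (carrier F) = q"
  using galois by (auto simp: galois_field_def)

lemma q_ge_2: "2 \<le> q"
proof -
  have "card {\<zero>, \<one>} \<le> card (carrier F)" by (intro card_mono finite_carrier) auto
  then show ?thesis using zero_not_one card_carrier by (simp add: zero_not_one[symmetric])
qed

lemma vectors_carrier: "x \<in> vectors F k \<Longrightarrow> i < k \<Longrightarrow> x i \<in> carrier F"
  by (auto simp: vectors_def)

lemma finite_vectors: "finite (vectors F k)"
  unfolding vectors_def by (intro finite_PiE finite_carrier) auto

lemma card_vectors: "card (vectors F k) = q ^ k"
  unfolding vectors_def by (simp add: card_PiE card_carrier)

lemma zero_vector_vectors: "zero_vector F k \<in> vectors F k"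
  by (auto simp: zero_vector_def vectors_def)

lemma dot_closed: "u \<in> vectors F k \<Longrightarrow> x \<in> vectors F k \<Longrightarrow> dot F k u x \<in> carrier F"
  unfolding dot_def by (intro finsum_closed) (auto simp: vectors_carrier)

lemma dot_split:
  assumes "i < k" "u \<in> vectors F k" "x \<in> vectors F k"
  shows "dot F k u x = u i \<otimes> x i \<oplus> (\<Oplus>l\<in>{..<k} - {i}. u l \<otimes> x l)"
proof -
  have "{..<k} = insert i ({..<k} - {i})" using assms(1) by auto
  then have "dot F k u x = (\<Oplus>l\<in>insert i ({..<k} - {i}). u l \<otimes> x l)"
    by (simp add: dot_def)
  also have "\<dots> = u i \<otimes> x i \<oplus> (\<Oplus>l\<in>{..<k} - {i}. u l \<otimes> x l)"
    using assms by (intro finsum_insert) (auto simp: vectors_carrier)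
  finally show ?thesis .
qed

text \<open>Encoding restricted to \<open>J\<close> injects the \<open>q ^ k\<close> messages into
  the \<open>q ^ card J\<close> received words, a count that stands in for a rank argument.\<close>

lemma decodable_imp_card_ge:
  assumes J: "finite J" and M: "\<And>j. j \<in> J \<Longrightarrow> M j \<in> vectors F k" and dec: "decodable F k M J"
  shows "k \<le> card J"
proof -
  have "inj_on (\<lambda>u. \<lambda>j\<in>J. encode F k M u j) (vectors F k)"
  proof (rule inj_onI)
    fix u v assume uv: "u \<in> vectors F k" "v \<in> vectors F k" "(\<lambda>j\<in>J. encode F k M u j) = (\<lambda>j\<in>J. encode F k M v j)"
    then have "\<forall>j\<in>J. encode F k M u j = encode F k M v j" by (metis restrict_apply')
    then show "u = v" using dec uv by (auto simp: decodable_def)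
  qed
  moreover have "(\<lambda>u. \<lambda>j\<in>J. encode F k M u j) ` vectors F k \<subseteq> J \<rightarrow>\<^sub>E carrier F"
    using M by (auto simp: encode_eq_dot dot_closed)
  moreover have "finite (J \<rightarrow>\<^sub>E carrier F)" using J finite_carrier by (intro finite_PiE)
  ultimately have "card (vectors F k) \<le> card (J \<rightarrow>\<^sub>E carrier F)"
    by (rule card_inj_on_le)
  then have "q ^ k \<le> q ^ card J"
    using J by (simp add: card_vectors card_PiE card_carrier)
  then show ?thesis using q_ge_2 by (simp add: power_le_imp_le_exp)
qed

text \<open>Provides a decodable matrix over every field, from which the decoding probability is
  seen to be positive also for small \<open>q\<close>.\<close>

lemma decodable_unit_columns:
  assumes J: "\<And>i. i < k \<Longrightarrow> \<exists>j\<in>J. M j = (\<lambda>l\<in>{..<k}. if l = i then \<one> else \<zero>)"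
  shows "decodable F k M J"
  unfolding decodable_def
proof (intro ballI impI)
  fix u v assume uv: "u \<in> vectors F k" "v \<in> vectors F k" "\<forall>j\<in>J. encode F k M u j = encode F k M v j"
  have unit: "dot F k w (\<lambda>l\<in>{..<k}. if l = i then \<one> else \<zero>) = w i" if w: "w \<in> vectors F k" and i: "i < k" for w i
  proof -
    define x where "x = (\<lambda>l\<in>{..<k}. if l = i then \<one> else \<zero>)"
    have "x \<in> vectors F k" by (auto simp: x_def vectors_def)
    then have "dot F k w x = w i \<otimes> x i \<oplus> (\<Oplus>l\<in>{..<k} - {i}. w l \<otimes> x l)"
      using dot_split[OF i w] by simp
    also have "(\<Oplus>l\<in>{..<k} - {i}. w l \<otimes> x l) = (\<Oplus>l\<in>{..<k} - {i}. \<zero>)"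
      using w by (intro finsum_cong') (auto simp: vectors_carrier x_def)
    also have "x i = \<one>" using i by (simp add: x_def)
    finally show ?thesis using w i unfolding x_def[symmetric] by (simp add: vectors_carrier)
  qed
  have "u i = v i" if i: "i < k" for i
  proof -
    obtain j where "j \<in> J" "M j = (\<lambda>l\<in>{..<k}. if l = i then \<one> else \<zero>)" using J i by blast
    then show ?thesis using uv unit i by (metis encode_eq_dot)
  qed
  then show "u = v" using uv(1,2) unfolding vectors_def by (intro PiE_ext) auto
qed

text \<open>\<open>w\<close> is the difference of two messages with equal received symbols, scaled
  so that some nonzero coordinate becomes \<open>\<one>\<close>. The scaling saves a factor of order
  \<open>q\<close> in the union bound, without which that bound would not tend to 0.\<close>

lemma not_decodable_orthogonal:
  assumes M: "\<And>j. j \<in> J \<Longrightarrow> M j \<in> vectors F k" and dec: "\<not> decodable F k M J"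
  shows "\<exists>i<k. \<exists>w\<in>vectors F k. w i = \<one> \<and> (\<forall>j\<in>J. dot F k w (M j) = \<zero>)"
proof -
  obtain u v where uv: "u \<in> vectors F k" "v \<in> vectors F k" "u \<noteq> v"
    and eq: "\<And>j. j \<in> J \<Longrightarrow> dot F k u (M j) = dot F k v (M j)"
    using dec by (auto simp: decodable_def encode_eq_dot)
  obtain i where i: "i < k" "u i \<noteq> v i"
    using PiE_ext[OF uv(1,2)[unfolded vectors_def]] uv(3) by auto
  have ui: "u l \<in> carrier F" "v l \<in> carrier F" if "l < k" for l using uv that by (auto simp: vectors_carrier)
  define c where "c = inv (u i \<ominus> v i)"
  have "u i \<ominus> v i \<noteq> \<zero>"
  proof
    assume "u i \<ominus> v i = \<zero>"
    then have "\<ominus> (\<ominus> v i) = u i" using ui[OF i(1)] by (intro minus_equality) (auto simp: minus_eq)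
    then show False using i(2) ui[OF i(1)] by simp
  qed
  then have unit: "u i \<ominus> v i \<in> Units F" using ui[OF i(1)] by (simp add: field_Units)
  then have c: "c \<in> carrier F" "c \<otimes> (u i \<ominus> v i) = \<one>" by (auto simp: c_def)
  define w where "w = (\<lambda>l\<in>{..<k}. c \<otimes> (u l \<ominus> v l))"
  have w: "w \<in> vectors F k" using c ui by (auto simp: w_def vectors_def)
  have "dot F k w (M j) = \<zero>" if j: "j \<in> J" for j
  proof -
    have m: "M j l \<in> carrier F" if "l < k" for l using M[OF j] that by (rule vectors_carrier)
    \<comment> \<open>Subtraction is written as multiplication by \<open>\<ominus> \<one>\<close> so
      that \<open>finsum_rdistr\<close> can pull it out of the sum.\<close>
    have "dot F k w (M j) = (\<Oplus>l\<in>{..<k}. c \<otimes> (u l \<otimes> M j l) \<oplus> c \<otimes> (\<ominus> \<one> \<otimes> (v l \<otimes> M j l)))"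
      unfolding dot_def
    proof (rule finsum_cong')
      fix l assume "l \<in> {..<k}"
      then have l: "l < k" "u l \<in> carrier F" "v l \<in> carrier F" "M j l \<in> carrier F" using ui m by auto
      then show "w l \<otimes> M j l = c \<otimes> (u l \<otimes> M j l) \<oplus> c \<otimes> (\<ominus> \<one> \<otimes> (v l \<otimes> M j l))"
        using c(1) by (simp add: w_def minus_eq l_distr r_distr m_assoc l_minus r_minus)
    qed (use c ui m in auto)
    also have "\<dots> = (\<Oplus>l\<in>{..<k}. c \<otimes> (u l \<otimes> M j l)) \<oplus> (\<Oplus>l\<in>{..<k}. c \<otimes> (\<ominus> \<one> \<otimes> (v l \<otimes> M j l)))"
      using c ui m by (intro finsum_addf) auto
    also have "(\<Oplus>l\<in>{..<k}. c \<otimes> (u l \<otimes> M j l)) = c \<otimes> dot F k u (M j)"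
      unfolding dot_def using c ui m by (intro finsum_rdistr[symmetric]) auto
    also have "(\<Oplus>l\<in>{..<k}. c \<otimes> (\<ominus> \<one> \<otimes> (v l \<otimes> M j l))) = c \<otimes> (\<Oplus>l\<in>{..<k}. \<ominus> \<one> \<otimes> (v l \<otimes> M j l))"
      using c ui m by (intro finsum_rdistr[symmetric]) auto
    also have "(\<Oplus>l\<in>{..<k}. \<ominus> \<one> \<otimes> (v l \<otimes> M j l)) = \<ominus> \<one> \<otimes> dot F k v (M j)"
      unfolding dot_def using c ui m by (intro finsum_rdistr[symmetric]) auto
    also have "c \<otimes> dot F k u (M j) \<oplus> c \<otimes> (\<ominus> \<one> \<otimes> dot F k v (M j)) = \<zero>"
      unfolding eq[OF j] using c(1) dot_closed[OF uv(2) M[OF j]] by (simp add: l_minus r_minus r_neg)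
    finally show ?thesis .
  qed
  moreover have "w i = \<one>" using c(2) i(1) by (simp add: w_def)
  ultimately show ?thesis using w i(1) by (intro exI[of _ i] conjI bexI[of _ w] ballI)
qed

lemma card_off_coordinate: "i < k \<Longrightarrow> card (({..<k} - {i}) \<rightarrow>\<^sub>E carrier F) = q ^ (k - 1)"
  by (simp add: card_PiE card_carrier)

lemma finite_off_coordinate: "finite (({..<k} - {i}) \<rightarrow>\<^sub>E carrier F)"
  by (intro finite_PiE finite_carrier) auto

lemma vectors_eqI:
  assumes "x \<in> vectors F k" "y \<in> vectors F k" "x i = y i"
    "restrict x ({..<k} - {i}) = restrict y ({..<k} - {i})"
  shows "x = y"
  using assms(1,2) unfolding vectors_def
proof (rule PiE_ext)
  fix l assume "l \<in> {..<k}"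
  then show "x l = y l" using assms(3) fun_cong[OF assms(4), of l] by (cases "l = i") auto
qed

text \<open>On \<open>A\<close> coordinate \<open>i\<close> is determined by the others, so
  forgetting it is injective.\<close>

lemma card_le_off_coordinate:
  assumes i: "i < k" and A: "A \<subseteq> vectors F k"
    and det: "\<And>x y. x \<in> A \<Longrightarrow> y \<in> A \<Longrightarrow> restrict x ({..<k} - {i}) = restrict y ({..<k} - {i}) \<Longrightarrow> x i = y i"
  shows "card A \<le> q ^ (k - 1)"
proof -
  have "card A \<le> card (({..<k} - {i}) \<rightarrow>\<^sub>E carrier F)"
  proof (rule card_inj_on_le[OF _ _ finite_off_coordinate])
    show "inj_on (\<lambda>x. restrict x ({..<k} - {i})) A"
    proof (rule inj_onI)
      fix x y assume xy: "x \<in> A" "y \<in> A" and eq: "restrict x ({..<k} - {i}) = restrict y ({..<k} - {i})"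
      show "x = y"
        using xy A by (intro vectors_eqI[OF _ _ det[OF xy eq] eq]) blast+
    qed
    show "(\<lambda>x. restrict x ({..<k} - {i})) ` A \<subseteq> ({..<k} - {i}) \<rightarrow>\<^sub>E carrier F"
    proof (intro image_subsetI)
      fix x assume "x \<in> A"
      then have "x l \<in> carrier F" if "l < k" for l using A that by (intro vectors_carrier) blast+
      then show "restrict x ({..<k} - {i}) \<in> ({..<k} - {i}) \<rightarrow>\<^sub>E carrier F"
        unfolding restrict_PiE_iff by blast
    qed
  qed
  then show ?thesis by (simp only: card_off_coordinate[OF i])
qed

lemma card_normalized_vectors:
  assumes "i < k"
  shows "card {w \<in> vectors F k. w i = \<one>} \<le> q ^ (k - 1)"
  by (rule card_le_off_coordinate[OF assms]) auto

text \<open>As \<open>w i = \<one>\<close>, the orthogonality equation can be solved for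
  \<open>x i\<close>.\<close>

lemma card_orthogonal_vectors:
  assumes i: "i < k" and w: "w \<in> vectors F k" "w i = \<one>"
  shows "card {x \<in> vectors F k. dot F k w x = \<zero>} \<le> q ^ (k - 1)"
proof (rule card_le_off_coordinate[OF i])
  show "{x \<in> vectors F k. dot F k w x = \<zero>} \<subseteq> vectors F k" by blast
next
  fix x y assume "x \<in> {x \<in> vectors F k. dot F k w x = \<zero>}" "y \<in> {x \<in> vectors F k. dot F k w x = \<zero>}"
    and eq: "restrict x ({..<k} - {i}) = restrict y ({..<k} - {i})"
  then have x: "x \<in> vectors F k" "dot F k w x = \<zero>" and y: "y \<in> vectors F k" "dot F k w y = \<zero>"
    by blast+
  let ?r = "\<lambda>x. \<Oplus>l\<in>{..<k} - {i}. w l \<otimes> x l"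
  have r: "?r y \<in> carrier F"
    using y(1) w(1) by (intro finsum_closed) (auto simp: vectors_carrier)
  have "x l = y l" if "l \<in> {..<k} - {i}" for l
    using fun_cong[OF eq, of l] that by simp
  then have rest: "?r x = ?r y"
    using y(1) w(1) by (intro finsum_cong') (auto simp: vectors_carrier)
  have split: "dot F k w v = v i \<oplus> ?r v" if "v \<in> vectors F k" for v
    unfolding dot_split[OF i w(1) that] w(2) using vectors_carrier[OF that i] by simp
  have "x i \<oplus> ?r y = \<zero>"
    using trans[OF split[OF x(1), symmetric] x(2)] unfolding rest .
  moreover have "y i \<oplus> ?r y = \<zero>"
    by (rule trans[OF split[OF y(1), symmetric] y(2)])
  ultimately have "x i \<oplus> ?r y = y i \<oplus> ?r y" by (rule trans[OF _ sym])
  then show "x i = y i"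
    using r vectors_carrier[OF x(1) i] vectors_carrier[OF y(1) i] by (simp only: add.right_cancel)
qed

end

section \<open>Random columns compared with idealized decoding\<close>

text \<open>
  The restriction to vector-valued columns holds almost surely and makes the event measurable even
  if the ambient type is uncountable.
\<close>

definition linear_decodable :: "'a ring \<Rightarrow> nat \<Rightarrow> nat \<Rightarrow> (nat \<Rightarrow> nat \<Rightarrow> 'a) \<Rightarrow> nat set \<Rightarrow> bool" where
  "linear_decodable F k n M J \<longleftrightarrow> M \<in> {1..n} \<rightarrow>\<^sub>E vectors F k \<and> decodable F k M J"

abbreviation linear_time :: "'a ring \<Rightarrow> nat \<Rightarrow> nat \<Rightarrow> (nat \<Rightarrow> nat \<Rightarrow> 'a) \<times> (nat \<Rightarrow> bool) \<Rightarrow> nat" where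
  "linear_time F k n \<equiv> decode_time n (linear_decodable F k n)"

text \<open>Coupling inequality: the two events can differ only where the variables do.\<close>

lemma (in prob_space) cdf_diff_le:
  fixes \<phi> \<psi> :: "'a \<Rightarrow> nat"
  assumes [measurable]: "\<phi> \<in> measurable M (count_space UNIV)" "\<psi> \<in> measurable M (count_space UNIV)"
  shows "\<bar>prob {x \<in> space M. \<phi> x \<le> j} - prob {x \<in> space M. \<psi> x \<le> j}\<bar> \<le> prob {x \<in> space M. \<phi> x \<noteq> \<psi> x}"
proof -
  have le: "prob {x \<in> space M. f x \<le> j} \<le> prob {x \<in> space M. g x \<le> j} + prob {x \<in> space M. f x \<noteq> g x}"
    if [measurable]: "f \<in> measurable M (count_space UNIV)" "g \<in> measurable M (count_space UNIV)"
    for f g :: "'a \<Rightarrow> nat"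
  proof -
    have [measurable]: "random_variable borel (\<lambda>x. real (f x))" "random_variable borel (\<lambda>x. real (g x))"
      by (rule measurable_compose[OF that(1)], simp, rule measurable_compose[OF that(2)], simp)
    have "{x \<in> space M. f x \<noteq> g x} = {x \<in> space M. real (f x) \<noteq> real (g x)}" by simp
    also have "\<dots> \<in> events" by measurable
    finally have neq: "{x \<in> space M. f x \<noteq> g x} \<in> events" .
    have le: "{x \<in> space M. g x \<le> j} \<in> events" by measurable
    have "prob {x \<in> space M. f x \<le> j} \<le> prob ({x \<in> space M. g x \<le> j} \<union> {x \<in> space M. f x \<noteq> g x})"
      using neq le by (intro finite_measure_mono sets.Un) auto
    also have "\<dots> \<le> prob {x \<in> space M. g x \<le> j} + prob {x \<in> space M. f x \<noteq> g x}"
      by (rule measure_Un_le[OF le neq])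
    finally show ?thesis .
  qed
  have "{x \<in> space M. \<psi> x \<noteq> \<phi> x} = {x \<in> space M. \<phi> x \<noteq> \<psi> x}" by auto
  then show ?thesis using le[of \<phi> \<psi>] le[of \<psi> \<phi>] by simp
qed

text \<open>The factor \<open>n\<close> counts the distribution function values in
  \<open>expectation_min\<close>.\<close>

lemma (in prob_space) expectation_min_diff_le:
  fixes \<phi> \<psi> :: "'a \<Rightarrow> nat"
  assumes [measurable]: "\<phi> \<in> measurable M (count_space UNIV)" "\<psi> \<in> measurable M (count_space UNIV)"
  shows "\<bar>expectation (\<lambda>x. real (min (\<phi> x) n)) - expectation (\<lambda>x. real (min (\<psi> x) n))\<bar>
    \<le> real n * prob {x \<in> space M. \<phi> x \<noteq> \<psi> x}"
proof -
  have "\<bar>expectation (\<lambda>x. real (min (\<phi> x) n)) - expectation (\<lambda>x. real (min (\<psi> x) n))\<bar>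
      = \<bar>\<Sum>j<n. prob {x \<in> space M. \<phi> x \<le> j} - prob {x \<in> space M. \<psi> x \<le> j}\<bar>"
    by (simp add: expectation_min sum_subtractf)
  also have "\<dots> \<le> (\<Sum>j<n. prob {x \<in> space M. \<phi> x \<noteq> \<psi> x})"
    by (intro order_trans[OF sum_abs] sum_mono cdf_diff_le) auto
  finally show ?thesis by simp
qed

context finite_field_columns
begin

lemma linear_decodable_measurable: "Measurable.pred (block_columns F k n) (\<lambda>M. linear_decodable F k n M J)"
proof -
  have "{M \<in> space (block_columns F k n). linear_decodable F k n M J} \<in> sets (block_columns F k n)"
    unfolding block_columns_def
  proof (rule finite_subset_sets_PiM)
    have "finite ({1..n} \<rightarrow>\<^sub>E vectors F k)" by (intro finite_PiE finite_vectors) auto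
    then show "finite {M \<in> space (\<Pi>\<^sub>M j\<in>{1..n}. measure_pmf (nonzero_column F k)). linear_decodable F k n M J}"
      by (rule rev_finite_subset) (auto simp: linear_decodable_def)
  qed (auto simp: space_PiM)
  then show ?thesis by (simp only: pred_def)
qed

lemma linear_time_measurable: "linear_time F k n \<in> measurable (block_space F \<epsilon> k n) (count_space UNIV)"
  by (intro decode_time_measurable linear_decodable_measurable)

lemma linear_decodable_imp_card: "linear_decodable F k n M J \<Longrightarrow> J \<subseteq> {1..n} \<Longrightarrow> k \<le> card J"
  unfolding linear_decodable_def by (intro decodable_imp_card_ge) (auto intro: finite_subset)

lemma nonzero_vectors:
  shows "finite (vectors F k - {zero_vector F k})" and "card (vectors F k - {zero_vector F k}) = q ^ k - 1"
    and "vectors F k - {zero_vector F k} \<noteq> {}"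
proof -
  show "finite (vectors F k - {zero_vector F k})" using finite_vectors by simp
  show card: "card (vectors F k - {zero_vector F k}) = q ^ k - 1"
    using zero_vector_vectors finite_vectors card_vectors by (simp add: card_Diff_singleton)
  have "2 \<le> q ^ k" using power_increasing[OF k_pos, of q] q_ge_2 by simp
  then show "vectors F k - {zero_vector F k} \<noteq> {}" using card by force
qed

lemma set_nonzero_column: "set_pmf (nonzero_column F k) = vectors F k - {zero_vector F k}"
  unfolding nonzero_column_def using nonzero_vectors by simp

lemma AE_block_columns_valid: "AE M in block_columns F k n. M \<in> {1..n} \<rightarrow>\<^sub>E vectors F k"
proof -
  have "AE M in block_columns F k n. \<forall>j\<in>{1..n}. M j \<in> vectors F k"
  proof (intro AE_finite_allI)
    fix j assume "j \<in> {1..n}"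
    then show "AE M in block_columns F k n. M j \<in> vectors F k"
      unfolding block_columns_def
      by (intro AE_PiM_component measure_pmf.prob_space_axioms) (auto simp: AE_measure_pmf_iff set_nonzero_column)
  qed simp
  moreover have "AE M in block_columns F k n. M \<in> space (block_columns F k n)" by (rule AE_space)
  ultimately show ?thesis
    by eventually_elim (auto simp: block_columns_def space_PiM PiE_iff)
qed

lemma AE_block_space_valid: "AE x in block_space F \<epsilon> k n. fst x \<in> {1..n} \<rightarrow>\<^sub>E vectors F k"
proof -
  interpret C: prob_space "block_columns F k n" by (rule prob_space_block_columns)
  interpret E: prob_space "block_erasures \<epsilon> n" by (rule prob_space_block_erasures)
  have distr: "distr (block_space F \<epsilon> k n) (block_columns F k n) fst = block_columns F k n"
    unfolding block_space_def by (simp add: E.distr_pair_fst E.emeasure_space_1)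
  have "AE M in distr (block_space F \<epsilon> k n) (block_columns F k n) fst. M \<in> {1..n} \<rightarrow>\<^sub>E vectors F k"
    unfolding distr by (rule AE_block_columns_valid)
  then show ?thesis
    by (rule AE_distrD[rotated]) (simp add: block_space_def)
qed

text \<open>At most \<open>q ^ (k - 1)\<close> of the \<open>q ^ k - 1\<close> nonzero vectors are
  orthogonal to \<open>w\<close>. The 2 absorbs the removal of the zero vector.\<close>

lemma prob_orthogonal:
  assumes "i < k" "w \<in> vectors F k" "w i = \<one>"
  shows "measure_pmf.prob (nonzero_column F k) {x \<in> vectors F k. dot F k w x = \<zero>} \<le> 2 / real q"
proof -
  let ?W = "vectors F k - {zero_vector F k}" and ?A = "{x \<in> vectors F k. dot F k w x = \<zero>}"
  have "card (?W \<inter> ?A) \<le> card ?A"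
    using finite_vectors by (intro card_mono) auto
  also have "\<dots> \<le> q ^ (k - 1)" by (rule card_orthogonal_vectors[OF assms])
  finally have num: "real (card (?W \<inter> ?A)) \<le> real q ^ (k - 1)" by (simp flip: of_nat_power)
  have qk: "q * q ^ (k - 1) = q ^ k" using k_pos by (cases k) auto
  have q: "2 \<le> q" by (rule q_ge_2)
  have "2 \<le> q ^ k" using power_increasing[OF k_pos, of q] q by simp
  then have den: "real q ^ k / 2 \<le> real (q ^ k - 1)" by (simp add: of_nat_diff flip: of_nat_power)
  have "measure_pmf.prob (nonzero_column F k) ?A = real (card (?W \<inter> ?A)) / real (q ^ k - 1)"
    unfolding nonzero_column_def using nonzero_vectors by (simp add: measure_pmf_of_set)
  also have "\<dots> \<le> real q ^ (k - 1) / (real q ^ k / 2)"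
    using num den q by (intro frac_le) auto
  also have "\<dots> = 2 / real q"
    using q by (simp add: field_simps flip: qk of_nat_power)
  finally show ?thesis .
qed

text \<open>
  Union bound over the vectors orthogonal to all columns in \<open>J\<close>. Normalizing one coordinate to \<open>\<one>\<close>
  leaves only \<open>k q ^ (k - 1)\<close> of them, each orthogonal with probability about \<open>1 / q ^ k\<close>.
\<close>

lemma prob_not_decodable:
  assumes J: "J \<subseteq> {1..n}" "card J = k"
  shows "measure (block_columns F k n) {M \<in> space (block_columns F k n). M \<in> {1..n} \<rightarrow>\<^sub>E vectors F k \<and> \<not> decodable F k M J}
    \<le> real k * 2 ^ k / real q"
proof -
  interpret C: prob_space "block_columns F k n" by (rule prob_space_block_columns)
  interpret P: product_prob_space "\<lambda>_. measure_pmf (nonzero_column F k)" "{1..n}" ..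
  let ?S = "space (block_columns F k n)"
  define A where "A w = {x \<in> vectors F k. dot F k w x = \<zero>}" for w
  define E where "E w = {M \<in> ?S. \<forall>j\<in>J. M j \<in> A w}" for w
  define N where "N i = {w \<in> vectors F k. w i = \<one>}" for i
  have J_fin: "finite J" using J(1) finite_subset by blast
  have N_fin: "finite (N i)" for i unfolding N_def using finite_vectors by simp
  have E_sets: "E w \<in> C.events" for w
    unfolding E_def block_columns_def using J J_fin by (intro sets.sets_Collect_finite_All sets_Collect_single') auto
  have E_prob: "C.prob (E w) \<le> (2 / real q) ^ k" if "i < k" "w \<in> N i" for i w
  proof -
    \<comment> \<open>The \<open>k\<close> columns in \<open>J\<close> are independent, which gives
      the power \<open>k\<close>.\<close>
    have "emeasure (block_columns F k n) (E w) = (\<Prod>j\<in>J. emeasure (measure_pmf (nonzero_column F k)) (A w))"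
      unfolding E_def block_columns_def using J J_fin by (intro P.emeasure_PiM_Collect) auto
    then have "C.prob (E w) = (\<Prod>j\<in>J. measure_pmf.prob (nonzero_column F k) (A w))"
      by (simp add: C.emeasure_eq_measure measure_pmf.emeasure_eq_measure ennreal_power)
    also have "\<dots> \<le> (2 / real q) ^ k"
      using prob_orthogonal[of i w] that J(2) by (simp add: A_def N_def power_mono)
    finally show ?thesis .
  qed
  have "C.prob {M \<in> ?S. M \<in> {1..n} \<rightarrow>\<^sub>E vectors F k \<and> \<not> decodable F k M J} \<le> C.prob (\<Union>i<k. \<Union>w\<in>N i. E w)"
  proof (rule C.finite_measure_mono)
    show "{M \<in> ?S. M \<in> {1..n} \<rightarrow>\<^sub>E vectors F k \<and> \<not> decodable F k M J} \<subseteq> (\<Union>i<k. \<Union>w\<in>N i. E w)"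
    proof
      fix M assume M: "M \<in> {M \<in> ?S. M \<in> {1..n} \<rightarrow>\<^sub>E vectors F k \<and> \<not> decodable F k M J}"
      then have MJ: "M j \<in> vectors F k" if "j \<in> J" for j
        using that J(1) by (auto simp: PiE_iff)
      have "\<not> decodable F k M J" using M by simp
      from not_decodable_orthogonal[OF MJ this]
      obtain i w where i: "i < k" and w: "w \<in> vectors F k" "w i = \<one>" "\<forall>j\<in>J. dot F k w (M j) = \<zero>"
        by auto
      have "M \<in> E w" unfolding E_def A_def using M MJ w(3) by simp
      moreover have "w \<in> N i" unfolding N_def using w(1,2) by simp
      ultimately show "M \<in> (\<Union>i<k. \<Union>w\<in>N i. E w)" using i by blast
    qed
    show "(\<Union>i<k. \<Union>w\<in>N i. E w) \<in> C.events" using N_fin E_sets by (intro sets.finite_UN) auto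
  qed
  also have "\<dots> \<le> (\<Sum>i<k. C.prob (\<Union>w\<in>N i. E w))"
    using N_fin E_sets by (intro measure_UNION_le) auto
  also have "\<dots> \<le> (\<Sum>i<k. \<Sum>w\<in>N i. C.prob (E w))"
    using N_fin E_sets by (intro sum_mono measure_UNION_le) auto
  also have "\<dots> \<le> (\<Sum>i<k. \<Sum>w\<in>N i. (2 / real q) ^ k)"
    by (intro sum_mono E_prob) auto
  also have "\<dots> = (\<Sum>i<k. real (card (N i)) * (2 / real q) ^ k)" by simp
  also have "\<dots> \<le> (\<Sum>i<k. real q ^ (k - 1) * (2 / real q) ^ k)"
    using card_normalized_vectors by (intro sum_mono mult_right_mono) (auto simp: N_def simp flip: of_nat_power)
  also have "\<dots> = real k * 2 ^ k / real q"
    using q_ge_2 k_pos by (cases k) (auto simp: power_divide field_simps)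
  finally show ?thesis .
qed

text \<open>The two criteria agree on every received set: one with at least \<open>k\<close>
  positions contains a \<open>k\<close>-subset, which suffices by monotonicity, and fewer than
  \<open>k\<close> never suffice.\<close>

lemma linear_time_eq_mds_time:
  assumes M: "M \<in> {1..n} \<rightarrow>\<^sub>E vectors F k" and dec: "\<And>J. J \<subseteq> {1..n} \<Longrightarrow> card J = k \<Longrightarrow> decodable F k M J"
  shows "linear_time F k n (M, e) = mds_time k n (M, e)"
  unfolding decode_time_def fst_conv snd_conv
proof (rule decode_pos_cong)
  fix J assume "J \<subseteq> unerased n e"
  then have J: "J \<subseteq> {1..n}" using unerased_subset by blast
  show "linear_decodable F k n M J \<longleftrightarrow> k \<le> card J"
  proof
    assume "k \<le> card J"
    then obtain J' where J': "J' \<subseteq> J" "card J' = k" using obtain_subset_with_card_n by metis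
    have "decodable F k M J'" by (rule dec[OF subset_trans[OF J'(1) J] J'(2)])
    then show "linear_decodable F k n M J"
      unfolding linear_decodable_def using M decodable_mono[OF _ J'(1)] by blast
  qed (rule linear_decodable_imp_card[OF _ J])
qed

text \<open>Union bound over the \<open>k\<close>-subsets of columns, crudely at most
  \<open>2 ^ n\<close> many. For fixed \<open>n\<close> only the factor \<open>1 / q\<close>
  matters.\<close>

lemma prob_linear_time_neq_mds_time:
  "measure (block_space F \<epsilon> k n) {x \<in> space (block_space F \<epsilon> k n). linear_time F k n x \<noteq> mds_time k n x}
    \<le> 2 ^ n * (real k * 2 ^ k / real q)"
proof -
  interpret C: prob_space "block_columns F k n" by (rule prob_space_block_columns)
  interpret E: prob_space "block_erasures \<epsilon> n" by (rule prob_space_block_erasures)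
  interpret P: prob_space "block_space F \<epsilon> k n" by (rule prob_space_block_space)
  define \<J> where "\<J> = {J \<in> Pow {1..n}. card J = k}"
  define B where "B J = {M \<in> space (block_columns F k n). M \<in> {1..n} \<rightarrow>\<^sub>E vectors F k \<and> \<not> decodable F k M J}" for J
  have B_sets: "B J \<in> C.events" for J
  proof -
    show ?thesis
      unfolding B_def block_columns_def
    proof (rule finite_subset_sets_PiM)
      have "finite ({1..n} \<rightarrow>\<^sub>E vectors F k)" by (intro finite_PiE finite_vectors) auto
      then show "finite {M \<in> space (\<Pi>\<^sub>M j\<in>{1..n}. measure_pmf (nonzero_column F k)). M \<in> {1..n} \<rightarrow>\<^sub>E vectors F k \<and> \<not> decodable F k M J}"
        by (rule rev_finite_subset) auto
    qed (auto simp: space_PiM)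
  qed
  let ?BE = "\<lambda>J. B J \<times> space (block_erasures \<epsilon> n)"
  have BE_sets: "?BE J \<in> P.events" for J using B_sets by (simp add: block_space_def)
  have BE_prob: "P.prob (?BE J) = C.prob (B J)" for J
  proof -
    have "emeasure (block_space F \<epsilon> k n) (?BE J) = emeasure (block_columns F k n) (B J)"
      unfolding block_space_def using B_sets by (subst E.emeasure_pair_measure_Times) (auto simp: E.emeasure_space_1)
    then show ?thesis by (simp add: P.emeasure_eq_measure C.emeasure_eq_measure)
  qed
  have fin: "finite \<J>" by (simp add: \<J>_def)
  have "P.prob {x \<in> space (block_space F \<epsilon> k n). linear_time F k n x \<noteq> mds_time k n x} \<le> P.prob (\<Union>J\<in>\<J>. ?BE J)"
  proof (rule P.finite_measure_mono_AE)
    show "AE x in block_space F \<epsilon> k n. x \<in> {x \<in> space (block_space F \<epsilon> k n). linear_time F k n x \<noteq> mds_time k n x}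
        \<longrightarrow> x \<in> (\<Union>J\<in>\<J>. ?BE J)"
      using AE_block_space_valid
    proof eventually_elim
      case (elim x)
      show ?case
      proof
        assume x: "x \<in> {x \<in> space (block_space F \<epsilon> k n). linear_time F k n x \<noteq> mds_time k n x}"
        then have "linear_time F k n (fst x, snd x) \<noteq> mds_time k n (fst x, snd x)" by simp
        then obtain J where J: "J \<subseteq> {1..n}" "card J = k" "\<not> decodable F k (fst x) J"
          using linear_time_eq_mds_time[OF elim] by blast
        have "x \<in> space (block_columns F k n) \<times> space (block_erasures \<epsilon> n)"
          using x by (simp add: block_space_def space_pair_measure)
        then have "x \<in> ?BE J" unfolding B_def using J(3) elim by (simp add: mem_Times_iff)
        moreover have "J \<in> \<J>" unfolding \<J>_def using J(1,2) by blast
        ultimately show "x \<in> (\<Union>J\<in>\<J>. ?BE J)" by blast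
      qed
    qed
    show "(\<Union>J\<in>\<J>. ?BE J) \<in> P.events" using fin BE_sets by (intro sets.finite_UN) auto
  qed
  also have "\<dots> \<le> (\<Sum>J\<in>\<J>. P.prob (?BE J))"
    using fin BE_sets by (intro measure_UNION_le) auto
  also have "\<dots> \<le> (\<Sum>J\<in>\<J>. real k * 2 ^ k / real q)"
  proof (rule sum_mono)
    fix J assume "J \<in> \<J>"
    then have "J \<subseteq> {1..n}" "card J = k" by (auto simp: \<J>_def)
    then have "C.prob (B J) \<le> real k * 2 ^ k / real q"
      unfolding B_def by (rule prob_not_decodable)
    then show "P.prob (?BE J) \<le> real k * 2 ^ k / real q"
      by (simp only: BE_prob)
  qed
  also have "\<dots> = real (card \<J>) * (real k * 2 ^ k / real q)" by simp
  also have "\<dots> \<le> 2 ^ n * (real k * 2 ^ k / real q)"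
  proof (intro mult_right_mono)
    have "card \<J> \<le> card (Pow {1..n})" unfolding \<J>_def by (intro card_mono) auto
    then show "real (card \<J>) \<le> 2 ^ n" by (simp add: card_Pow flip: of_nat_le_iff)
  qed simp
  finally show ?thesis .
qed

text \<open>The union bound is void for small \<open>q\<close>, so positivity comes from one
  explicit outcome of positive probability: columns that include all unit vectors, and no
  erasures.\<close>

lemma linear_time_cdf_pos:
  assumes \<epsilon>: "0 \<le> \<epsilon>" "\<epsilon> < 1" and n: "k \<le> n"
  shows "0 < measure (block_space F \<epsilon> k n) {x \<in> space (block_space F \<epsilon> k n). linear_time F k n x \<le> n}"
proof -
  interpret C: prob_space "block_columns F k n" by (rule prob_space_block_columns)
  interpret E: prob_space "block_erasures \<epsilon> n" by (rule prob_space_block_erasures)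
  interpret P: prob_space "block_space F \<epsilon> k n" by (rule prob_space_block_space)
  interpret PC: product_prob_space "\<lambda>_. measure_pmf (nonzero_column F k)" "{1..n}" ..
  interpret PE: product_prob_space "\<lambda>_. measure_pmf (bernoulli_pmf \<epsilon>)" "{1..n}" ..
  note linear_time_measurable[of n \<epsilon>, measurable]
  define u where "u i = (\<lambda>l\<in>{..<k}. if l = i then \<one> else \<zero>)" for i
  \<comment> \<open>Columns beyond the first \<open>k\<close> repeat a unit vector; they only have
    to be nonzero in order to have positive mass.\<close>
  define c where "c j = u (if j \<le> k then j - 1 else 0)" for j :: nat
  have u: "u i \<in> vectors F k - {zero_vector F k}" if "i < k" for i
  proof -
    have "u i i \<noteq> zero_vector F k i" using that by (simp add: u_def zero_vector_def)
    then have "u i \<noteq> zero_vector F k" by metis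
    then show ?thesis by (auto simp: u_def vectors_def)
  qed
  have c: "c j \<in> set_pmf (nonzero_column F k)" if "j \<in> {1..n}" for j
  proof -
    have "(if j \<le> k then j - 1 else 0) < k" using that k_pos by auto
    from u[OF this] show ?thesis unfolding c_def set_nonzero_column .
  qed
  define A where "A = {M \<in> space (block_columns F k n). \<forall>j\<in>{1..n}. M j \<in> {c j}}"
  define B where "B = {e \<in> space (block_erasures \<epsilon> n). \<forall>j\<in>{1..n}. e j \<in> {False}}"
  have A_sets: "A \<in> C.events" unfolding A_def block_columns_def by (intro sets.sets_Collect_finite_All sets_Collect_single') auto
  have B_sets: "B \<in> E.events" by (auto simp: B_def sets_block_erasures space_block_erasures)
  have "emeasure (block_columns F k n) A = (\<Prod>j\<in>{1..n}. emeasure (measure_pmf (nonzero_column F k)) {c j})"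
    unfolding A_def block_columns_def by (intro PC.emeasure_PiM_Collect) auto
  also have "\<dots> > 0"
    unfolding zero_less_iff_neq_zero using c by (simp add: emeasure_pmf_single set_pmf_iff)
  finally have A_pos: "0 < emeasure (block_columns F k n) A" .
  have "emeasure (block_erasures \<epsilon> n) B = (\<Prod>j\<in>{1..n}. emeasure (measure_pmf (bernoulli_pmf \<epsilon>)) {False})"
    unfolding B_def block_erasures_def by (intro PE.emeasure_PiM_Collect) auto
  also have "\<dots> > 0"
    unfolding zero_less_iff_neq_zero using \<epsilon> by (simp add: emeasure_pmf_single)
  finally have B_pos: "0 < emeasure (block_erasures \<epsilon> n) B" .
  have "0 < emeasure (block_columns F k n) A * emeasure (block_erasures \<epsilon> n) B"
    using A_pos B_pos unfolding zero_less_iff_neq_zero by simp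
  also have "\<dots> = emeasure (block_space F \<epsilon> k n) (A \<times> B)"
    unfolding block_space_def by (rule E.emeasure_pair_measure_Times[OF A_sets B_sets, symmetric])
  also have "\<dots> \<le> emeasure (block_space F \<epsilon> k n) {x \<in> space (block_space F \<epsilon> k n). linear_time F k n x \<le> n}"
  proof (rule emeasure_mono)
    show "A \<times> B \<subseteq> {x \<in> space (block_space F \<epsilon> k n). linear_time F k n x \<le> n}"
    proof
      fix x assume "x \<in> A \<times> B"
      then obtain M e where x: "x = (M, e)" and M: "M \<in> A" and e: "e \<in> B" by blast
      have Mc: "M j = c j" if "j \<in> {1..n}" for j using M that by (auto simp: A_def)
      have "decodable F k M {1..n}"
      proof (rule decodable_unit_columns)
        fix i assume "i < k"
        then have "Suc i \<in> {1..n}" "c (Suc i) = u i" using n by (auto simp: c_def)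
        then show "\<exists>j\<in>{1..n}. M j = (\<lambda>l\<in>{..<k}. if l = i then \<one> else \<zero>)"
          using Mc[of "Suc i"] by (intro bexI[of _ "Suc i"]) (auto simp: u_def)
      qed
      moreover have "M \<in> {1..n} \<rightarrow>\<^sub>E vectors F k"
        using M Mc c by (auto simp: A_def block_columns_def space_PiM PiE_iff set_nonzero_column)
      moreover have "unerased n e \<inter> {..n} = {1..n}" using e by (auto simp: B_def unerased_def)
      ultimately have "linear_time F k n x \<le> n"
        using k_pos n by (auto simp: x decode_time_def linear_decodable_def intro!: decode_pos_le)
      then show "x \<in> {x \<in> space (block_space F \<epsilon> k n). linear_time F k n x \<le> n}"
        using M e by (auto simp: x block_space_def space_pair_measure A_def B_def)
    qed
  qed measurable
  finally show ?thesis by (simp add: P.emeasure_eq_measure)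
qed

end

section \<open>Average ages of linear schemes\<close>

lemma channel_use_Suc: "channel_use n (Suc i) j = i * n + j"
  by (simp add: channel_use_def)

lemma received_eq_unerased: "received n e (Suc i) n = unerased n (\<lambda>j\<in>{1..n}. e (i * n + j))"
  unfolding received_def unerased_def channel_use_Suc by (intro Collect_cong) auto

lemma received_prefix: "j \<le> n \<Longrightarrow> received n e l j = received n e l n \<inter> {..j}"
  by (auto simp: received_def)

lemma decoded_at_iff:
  "decoded_at F k n G e l j \<longleftrightarrow> j = decode_pos n (decodable F k (G l)) (received n e l n) \<and> j \<le> n"
proof -
  define P where "P i \<longleftrightarrow> decodable F k (G l) (received n e l n \<inter> {..i})" for i
  define p where "p = decode_pos n (decodable F k (G l)) (received n e l n)"
  have p: "1 \<le> p" "p \<le> n \<Longrightarrow> P p"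
    unfolding p_def P_def
    using decode_pos_props[where n = n and P = "decodable F k (G l)" and R = "received n e l n"] by simp_all
  have p_le: "p \<le> i" if "1 \<le> i" "P i" for i
    using that unfolding p_def P_def by (rule decode_pos_le[where P = "decodable F k (G l)"])
  have dec: "decodable F k (G l) (received n e l i) \<longleftrightarrow> P i" if "i \<le> n" for i
    unfolding P_def received_prefix[OF that] ..
  have "decoded_at F k n G e l j \<longleftrightarrow> j \<in> {1..n} \<and> P j \<and> (\<forall>i\<in>{1..<j}. \<not> P i)"
    unfolding decoded_at_def by (intro conj_cong ball_cong refl) (simp_all add: dec)
  also have "\<dots> \<longleftrightarrow> j = p \<and> j \<le> n"
  proof
    assume j: "j \<in> {1..n} \<and> P j \<and> (\<forall>i\<in>{1..<j}. \<not> P i)"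
    then have "p \<le> j" using p_le by simp
    moreover have "\<not> p < j" using j p by auto
    ultimately show "j = p \<and> j \<le> n" using j by simp
  next
    assume j: "j = p \<and> j \<le> n"
    have "\<not> P i" if "i \<in> {1..<j}" for i
      using p_le[of i] that j by auto
    then show "j \<in> {1..n} \<and> P j \<and> (\<forall>i\<in>{1..<j}. \<not> P i)"
      using p j by simp
  qed
  finally show ?thesis by (simp only: p_def)
qed

text \<open>Since a block starts at an integer time, rounding affects only \<open>- t0\<close>, and
  the message is older than its first channel use by exactly \<open>frac (- t0)\<close>. This is the
  offset \<phi> of \<open>block_age\<close>. Finiteness of \<open>B\<close> lets \<open>Max\<close>
  commute with the index shift \<open>Suc\<close>.\<close>

lemma age_eq_block_age:
  assumes n: "0 < n"
  shows "age F k n t0 a0 G e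
    = block_age n (frac (- t0)) a0 (\<lambda>i. decode_pos n (decodable F k (G (Suc i))) (received n e (Suc i) n))"
proof
  fix t
  define d where "d i = decode_pos n (decodable F k (G (Suc i))) (received n e (Suc i) n)" for i
  define B where "B = {i. d i \<le> n \<and> real (i * n + d i) \<le> t}"
  have "decoded_blocks F k n G e t = Suc ` B"
  proof (rule Set.set_eqI)
    fix l
    show "l \<in> decoded_blocks F k n G e t \<longleftrightarrow> l \<in> Suc ` B"
    proof (cases l)
      case (Suc i)
      then show ?thesis
        by (auto simp: decoded_blocks_def decoded_at_iff channel_use_Suc B_def d_def simp del: of_nat_add of_nat_mult)
    qed (auto simp: decoded_blocks_def)
  qed
  moreover have "finite B"
  proof (rule finite_subset)
    show "B \<subseteq> {..nat \<lfloor>t\<rfloor>}"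
    proof
      fix i assume "i \<in> B"
      then have "real (i * n) \<le> t" unfolding B_def by simp
      moreover have "real i \<le> real (i * n)" using n by (simp flip: of_nat_mult)
      ultimately show "i \<in> {..nat \<lfloor>t\<rfloor>}" by (simp add: le_nat_floor)
    qed
  qed simp
  then have "Max (Suc ` B) = Suc (Max B)" if "B \<noteq> {}"
    using that by (simp add: mono_Max_commute[symmetric] mono_Suc)
  moreover have "of_int (message_index n t0 (Suc m)) + t0 = real (m * n) + 1 - frac (- t0)" for m
  proof -
    have "(real (Suc m) - 1) * real n + 1 - t0 = of_int (int (m * n + 1)) + (- t0)" by simp
    then have "message_index n t0 (Suc m) = int (m * n + 1) + \<lfloor>- t0\<rfloor>"
      unfolding message_index_def by (metis floor_add_int add.commute)
    then show ?thesis by (simp add: frac_def)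
  qed
  ultimately show "age F k n t0 a0 G e t = block_age n (frac (- t0)) a0 (\<lambda>i. decode_pos n (decodable F k (G (Suc i))) (received n e (Suc i) n)) t"
    unfolding age_def block_age_def Let_def d_def[symmetric] B_def[symmetric] by (simp add: algebra_simps)
qed

text \<open>Turns an almost sure statement into the choice of one outcome, for possibly
  nonmeasurable \<open>P\<close>. It serves to identify almost sure limits and to derandomize the
  encoders.\<close>

lemma (in prob_space) AE_witness: "AE x in M. P x \<Longrightarrow> \<exists>x. P x"
proof (rule ccontr)
  assume "AE x in M. P x" "\<nexists>x. P x"
  then have "AE x in M. False" by simp
  then show False using AE_False by simp
qed

lemma AE_random_scheme_fst:
  assumes "AE x in random_scheme F \<epsilon> k n. P x"
  shows "AE G in random_encoders F k n. AE e in erasures \<epsilon>. P (G, e)"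
proof -
  interpret M: prob_space "random_encoders F k n" by (rule prob_space_random_encoders)
  interpret N: prob_space "erasures \<epsilon>" by (rule prob_space_erasures)
  interpret pair_prob_space "random_encoders F k n" "erasures \<epsilon>" ..
  show ?thesis by (rule AE_pair[OF assms[unfolded random_scheme_def]])
qed

lemma exists_min_of_linear_growth:
  fixes f :: "nat \<Rightarrow> real"
  assumes "\<And>n. k \<le> n \<Longrightarrow> real n / 2 - 1 \<le> f n"
  shows "\<exists>n\<ge>k. \<forall>n'\<ge>k. f n \<le> f n'"
proof -
  \<comment> \<open>Beyond \<open>m\<close> the linear bound is at least \<open>f k\<close>, so a
    minimum over \<open>{k..m}\<close> is global.\<close>
  define m where "m = k + nat \<lceil>2 * (f k + 1)\<rceil>"
  have "Min (f ` {k..m}) \<in> f ` {k..m}" by (intro Min_in) (auto simp: m_def)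
  then obtain n where n: "n \<in> {k..m}" and fn: "f n = Min (f ` {k..m})" by (metis imageE)
  have min: "f n \<le> f n'" if "n' \<in> {k..m}" for n'
    unfolding fn using that by (intro Min_le) auto
  have "f n \<le> f n'" if "k \<le> n'" for n'
  proof (cases "n' \<le> m")
    case True
    then show ?thesis using min that by simp
  next
    case False
    then have "2 * (f k + 1) \<le> real n'" unfolding m_def by linarith
    then have "f k \<le> f n'" using assms[OF that] by simp
    moreover have "f n \<le> f k" using min[of k] by (simp add: m_def)
    ultimately show ?thesis by simp
  qed
  then show ?thesis using n by auto
qed

text \<open>The expression of \<open>age_lower_bound_eq\<close> with the actual decoder in place of
  the idealized one.\<close>

definition random_age_value :: "'a ring \<Rightarrow> real \<Rightarrow> nat \<Rightarrow> real \<Rightarrow> nat \<Rightarrow> real" where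
  "random_age_value F \<epsilon> k t0 n = real n / 2 - 1 + frac (- t0)
    + (\<integral>x. real (min (linear_time F k n x) n) \<partial>block_space F \<epsilon> k n)
      / measure (block_space F \<epsilon> k n) {x \<in> space (block_space F \<epsilon> k n). linear_time F k n x \<le> n}"

context finite_field_columns
begin

lemma AE_random_encoders_valid:
  "AE x in random_scheme F \<epsilon> k n. \<forall>i. fst x (Suc i) \<in> {1..n} \<rightarrow>\<^sub>E vectors F k"
  unfolding AE_all_countable
proof
  fix i
  have "AE x in distr (random_scheme F \<epsilon> k n) (block_space F \<epsilon> k n) (block n i). fst x \<in> {1..n} \<rightarrow>\<^sub>E vectors F k"
    unfolding distr_block by (rule AE_block_space_valid)
  from AE_distrD[OF block_measurable this]
  show "AE x in random_scheme F \<epsilon> k n. fst x (Suc i) \<in> {1..n} \<rightarrow>\<^sub>E vectors F k"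
    by (simp add: block_def)
qed

lemma AE_has_average_random_scheme:
  assumes \<epsilon>: "0 \<le> \<epsilon>" "\<epsilon> < 1" and n: "k \<le> n"
  shows "AE x in random_scheme F \<epsilon> k n. has_average (age F k n t0 a0 (fst x) (snd x)) (random_age_value F \<epsilon> k t0 n)"
  using AE_random_encoders_valid AE_random_scheme_average[OF linear_time_measurable linear_time_cdf_pos[OF assms]]
proof eventually_elim
  case (elim x)
  let ?d = "\<lambda>i. linear_time F k n (block n i x)"
  have n0: "0 < n" using n k_pos by simp
  \<comment> \<open>For valid columns, which occur almost surely, \<open>linear_decodable\<close>
    and \<open>decodable\<close> coincide.\<close>
  have "?d i = decode_pos n (decodable F k (fst x (Suc i))) (received n (snd x) (Suc i) n)" for i
    unfolding decode_time_def block_def fst_conv snd_conv received_eq_unerased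
    using elim(1) by (intro decode_pos_cong) (simp add: linear_decodable_def)
  then have age: "age F k n t0 a0 (fst x) (snd x) = block_age n (frac (- t0)) a0 ?d"
    unfolding age_eq_block_age[OF n0] by simp
  show ?case
    unfolding age random_age_value_def
    by (rule has_average_block_age[OF n0 _ elim(2)]) (unfold decode_time_def, rule decode_pos_props(1))
qed

text \<open>Two almost sure values hold together at some outcome, where limits are unique; so the
  \<open>THE\<close> is well defined.\<close>

lemma random_average_age_eq:
  assumes "0 \<le> \<epsilon>" "\<epsilon> < 1" "k \<le> n"
  shows "random_average_age F \<epsilon> k t0 a0 n = random_age_value F \<epsilon> k t0 n"
  unfolding random_average_age_def
proof (rule the_equality)
  let ?c = "random_age_value F \<epsilon> k t0 n"
  have AE: "AE x in random_scheme F \<epsilon> k n. has_average (age F k n t0 a0 (fst x) (snd x)) ?c"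
    by (rule AE_has_average_random_scheme[OF assms])
  then show "AE (G, e) in random_scheme F \<epsilon> k n. has_average (age F k n t0 a0 G e) ?c"
    by (simp add: case_prod_beta)
  fix c assume "AE (G, e) in random_scheme F \<epsilon> k n. has_average (age F k n t0 a0 G e) c"
  then have "AE x in random_scheme F \<epsilon> k n. has_average (age F k n t0 a0 (fst x) (snd x)) c"
    by (simp add: case_prod_beta)
  with AE have "AE x in random_scheme F \<epsilon> k n. has_average (age F k n t0 a0 (fst x) (snd x)) ?c
      \<and> has_average (age F k n t0 a0 (fst x) (snd x)) c" by eventually_elim simp
  then obtain x where "has_average (age F k n t0 a0 (fst x) (snd x)) ?c" "has_average (age F k n t0 a0 (fst x) (snd x)) c"
    using prob_space.AE_witness[OF prob_space_random_scheme] by blast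
  then show "c = ?c"
    unfolding has_average_def by (rule tendsto_unique[OF trivial_limit_at_top_linorder, rotated])
qed

text \<open>Derandomization: almost every encoder sequence has this average for almost all erasure
  patterns, and one of them is fixed. Hence the random value bounds the optimum from above.\<close>

lemma random_age_value_in_linear_average_ages:
  assumes "0 \<le> \<epsilon>" "\<epsilon> < 1" "k \<le> n"
  shows "random_age_value F \<epsilon> k t0 n \<in> linear_average_ages F \<epsilon> k t0 a0"
proof -
  have "AE x in random_scheme F \<epsilon> k n. has_average (age F k n t0 a0 (fst x) (snd x)) (random_age_value F \<epsilon> k t0 n)
      \<and> (\<forall>i. fst x (Suc i) \<in> {1..n} \<rightarrow>\<^sub>E vectors F k)"
    using AE_has_average_random_scheme[OF assms] AE_random_encoders_valid by eventually_elim simp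
  from prob_space.AE_witness[OF prob_space_random_encoders AE_random_scheme_fst[OF this]]
  obtain G where G: "AE e in erasures \<epsilon>. has_average (age F k n t0 a0 G e) (random_age_value F \<epsilon> k t0 n)
      \<and> (\<forall>i. G (Suc i) \<in> {1..n} \<rightarrow>\<^sub>E vectors F k)"
    by auto
  \<comment> \<open>Validity of \<open>G\<close> does not involve the erasures, so a single erasure
    pattern yields it.\<close>
  then have valid: "G (Suc i) \<in> {1..n} \<rightarrow>\<^sub>E vectors F k" for i
    using prob_space.AE_witness[OF prob_space_erasures G] by blast
  have "linear_encoders F k n G"
    unfolding linear_encoders_def
  proof (intro allI impI ballI)
    fix l j :: nat assume "1 \<le> l" "j \<in> {1..n}"
    then show "G l j \<in> vectors F k" using valid[of "l - 1"] by (cases l) auto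
  qed
  moreover have "AE e in erasures \<epsilon>. has_average (age F k n t0 a0 G e) (random_age_value F \<epsilon> k t0 n)"
    using G by eventually_elim simp
  ultimately show ?thesis
    unfolding linear_average_ages_def using assms(3) by (intro CollectI exI[of _ n] exI[of _ G] conjI)
qed

text \<open>
  At least \<open>k\<close> received symbols are needed for decoding, so no encoder beats the idealized scheme
  that decodes as soon as \<open>k\<close> symbols of a block have arrived, for each erasure pattern.
\<close>

lemma age_lower_bound_le_linear:
  assumes \<epsilon>: "0 \<le> \<epsilon>" "\<epsilon> < 1" and n: "k \<le> n" and G: "linear_encoders F k n G"
    and c: "AE e in erasures \<epsilon>. has_average (age F k n t0 a0 G e) c"
  shows "age_lower_bound \<epsilon> k t0 n \<le> c"
proof -
  have n0: "0 < n" using n k_pos by simp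
  have pos: "0 < measure (block_space F \<epsilon> k n) {x \<in> space (block_space F \<epsilon> k n). mds_time k n x \<le> n}"
    unfolding mds_time_cdf[OF \<epsilon> k_pos order_refl] using \<epsilon> n by (intro geometric_sum_cdf_pos) auto
  define m where "m = (\<integral>x. real (min (mds_time k n x) n) \<partial>block_space F \<epsilon> k n)
      / measure (block_space F \<epsilon> k n) {x \<in> space (block_space F \<epsilon> k n). mds_time k n x \<le> n}"
  let ?d' = "\<lambda>e i. decode_pos n (\<lambda>J. k \<le> card J) (received n e (Suc i) n)"
  have "AE x in random_scheme F \<epsilon> k n.
      (\<lambda>N. (\<Sum>i<N. real (gap n (?d' (snd x)) i * min (?d' (snd x) i) n)) / real N) \<longlonglongrightarrow> m"
    using AE_random_scheme_average[OF mds_time_measurable pos]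
    unfolding m_def decode_time_def block_def fst_conv snd_conv received_eq_unerased .
  \<comment> \<open>The positions \<open>?d'\<close> depend on the erasures only, so one encoder
    sequence transfers the limit to \<open>erasures \<epsilon>\<close>.\<close>
  from prob_space.AE_witness[OF prob_space_random_encoders AE_random_scheme_fst[OF this]]
  have "AE e in erasures \<epsilon>. (\<lambda>N. (\<Sum>i<N. real (gap n (?d' e) i * min (?d' e i) n)) / real N) \<longlonglongrightarrow> m"
    by simp
  with c have "AE e in erasures \<epsilon>. has_average (age F k n t0 a0 G e) c
      \<and> (\<lambda>N. (\<Sum>i<N. real (gap n (?d' e) i * min (?d' e i) n)) / real N) \<longlonglongrightarrow> m"
    by eventually_elim simp
  \<comment> \<open>One erasure pattern with both limits is enough, because the comparison is
    pathwise and the limits are constants.\<close>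
  from prob_space.AE_witness[OF prob_space_erasures this]
  obtain e where avg: "has_average (age F k n t0 a0 G e) c"
    and lim: "(\<lambda>N. (\<Sum>i<N. real (gap n (?d' e) i * min (?d' e i) n)) / real N) \<longlonglongrightarrow> m"
    by blast
  have "?d' e i \<le> decode_pos n (decodable F k (G (Suc i))) (received n e (Suc i) n)" for i
  proof (rule decode_pos_antimono)
    fix J assume J: "J \<subseteq> received n e (Suc i) n" and dec: "decodable F k (G (Suc i)) J"
    have J': "J \<subseteq> {1..n}" using J by (auto simp: received_def)
    show "k \<le> card J"
    proof (rule decodable_imp_card_ge[OF _ _ dec])
      show "finite J" using J' finite_subset by blast
      fix j assume "j \<in> J"
      then show "G (Suc i) j \<in> vectors F k" using G J' unfolding linear_encoders_def by auto
    qed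
  qed
  from block_age_average_lower_bound[OF n0 decode_pos_props(1) this lim avg[unfolded age_eq_block_age[OF n0]]]
  show ?thesis
    unfolding age_lower_bound_eq[OF \<epsilon> k_pos n, of t0 F] m_def .
qed

lemma linear_average_ages_ge:
  assumes "0 \<le> \<epsilon>" "\<epsilon> < 1" "c \<in> linear_average_ages F \<epsilon> k t0 a0"
  shows "\<exists>n\<ge>k. age_lower_bound \<epsilon> k t0 n \<le> c"
proof -
  obtain n G where n: "k \<le> n" and G: "linear_encoders F k n G"
    and c: "AE e in erasures \<epsilon>. has_average (age F k n t0 a0 G e) c"
    using assms(3) by (auto simp: linear_average_ages_def)
  show ?thesis using age_lower_bound_le_linear[OF assms(1,2) n G c] n by (intro exI[of _ n] conjI)
qed

end

lemma random_age_value_ge: "real n / 2 - 1 \<le> random_age_value F \<epsilon> k t0 n"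
  unfolding random_age_value_def by (simp add: add_increasing2 divide_nonneg_nonneg)

text \<open>Both quantities are a common constant plus \<mu> / p, for pairs (p, \<mu>) that differ
  by O(1 / q). Continuity of the quotient at the idealized pair, where p > 0, gives closeness. The
  threshold can precede \<open>F\<close> because the idealized pair depends on neither
  \<open>q\<close> nor \<open>F\<close>.\<close>

lemma random_age_value_near_lower_bound:
  assumes \<epsilon>: "0 \<le> \<epsilon>" "\<epsilon> < 1" and k: "1 \<le> k" and n: "k \<le> n" and \<delta>: "0 < \<delta>"
  shows "\<exists>q0>0. \<forall>q\<ge>q0. \<forall>F :: 'a ring. galois_field q F \<longrightarrow>
    \<bar>random_age_value F \<epsilon> k t0 n - age_lower_bound \<epsilon> k t0 n\<bar> < \<delta>"
proof -
  define p where "p = measure_pmf.prob (geometric_sum_pmf k (1 - \<epsilon>)) {..n}"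
  define \<mu> where "\<mu> = real n - real n * p
      + real k / (1 - \<epsilon>) * measure_pmf.prob (geometric_sum_pmf (Suc k) (1 - \<epsilon>)) {..Suc n}"
  have p: "0 < p" unfolding p_def using \<epsilon> n by (intro geometric_sum_cdf_pos) auto
  have "((\<lambda>z. snd z / fst z) \<longlongrightarrow> \<mu> / p) (nhds (p, \<mu>))"
  proof -
    have "((\<lambda>z. snd z / fst z) \<longlongrightarrow> snd (p, \<mu>) / fst (p, \<mu>)) (nhds (p, \<mu>))"
      using p by (intro tendsto_divide tendsto_snd tendsto_fst filterlim_ident) simp
    then show ?thesis by simp
  qed
  then have "eventually (\<lambda>z. dist (snd z / fst z) (\<mu> / p) < \<delta>) (nhds (p, \<mu>))"
    using \<delta> by (rule tendstoD)
  then obtain \<eta> where \<eta>: "0 < \<eta>" and close: "\<And>x y. dist (x, y) (p, \<mu>) < \<eta> \<Longrightarrow> \<bar>y / x - \<mu> / p\<bar> < \<delta>"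
    unfolding eventually_nhds_metric by (auto simp: dist_real_def)
  \<comment> \<open>The deviations of p and \<mu> are at most 1 and \<open>n\<close> times the
    probability that the two decoders disagree.\<close>
  define C where "C = (1 + real n) * (2 ^ n * (real k * 2 ^ k))"
  have C: "0 \<le> C" by (simp add: C_def)
  show ?thesis
  proof (intro exI[of _ "Suc (nat \<lceil>C / \<eta>\<rceil>)"] conjI allI impI)
    fix q :: nat and F :: "'a ring"
    assume q: "Suc (nat \<lceil>C / \<eta>\<rceil>) \<le> q" and F: "galois_field q F"
    interpret finite_field_columns F q k using F k by unfold_locales
    interpret P: prob_space "block_space F \<epsilon> k n" by (rule prob_space_block_space)
    let ?p = "P.prob {x \<in> space (block_space F \<epsilon> k n). linear_time F k n x \<le> n}"
    let ?\<mu> = "P.expectation (\<lambda>x. real (min (linear_time F k n x) n))"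
    let ?b = "P.prob {x \<in> space (block_space F \<epsilon> k n). linear_time F k n x \<noteq> mds_time k n x}"
    have "C / \<eta> < real q" using q by linarith
    then have small: "C / real q < \<eta>" using \<eta> q by (simp add: field_simps)
    have dp: "\<bar>?p - p\<bar> \<le> ?b"
      using P.cdf_diff_le[OF linear_time_measurable mds_time_measurable[where k' = k], where j = n]
      unfolding mds_time_cdf[OF \<epsilon> k order_refl] p_def .
    have d\<mu>: "\<bar>?\<mu> - \<mu>\<bar> \<le> real n * ?b"
      using P.expectation_min_diff_le[OF linear_time_measurable mds_time_measurable[where k' = k], where n = n]
      unfolding mds_time_expectation[OF \<epsilon> k] \<mu>_def p_def .
    have "dist (?p, ?\<mu>) (p, \<mu>) \<le> \<bar>?p - p\<bar> + \<bar>?\<mu> - \<mu>\<bar>"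
      unfolding dist_Pair_Pair dist_real_def by (rule order_trans[OF sqrt_sum_squares_le_sum_abs]) simp
    also have "\<dots> \<le> (1 + real n) * ?b" using dp d\<mu> by (simp add: algebra_simps)
    also have "\<dots> \<le> (1 + real n) * (2 ^ n * (real k * 2 ^ k / real q))"
      by (intro mult_left_mono prob_linear_time_neq_mds_time) auto
    also have "\<dots> = C / real q" by (simp add: C_def)
    finally have "\<bar>?\<mu> / ?p - \<mu> / p\<bar> < \<delta>" using small by (intro close) simp
    then show "\<bar>random_age_value F \<epsilon> k t0 n - age_lower_bound \<epsilon> k t0 n\<bar> < \<delta>"
      unfolding random_age_value_def age_lower_bound_eq[OF \<epsilon> k n, of t0 F]
        mds_time_cdf[OF \<epsilon> k order_refl] mds_time_expectation[OF \<epsilon> k]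
      by (simp add: p_def \<mu>_def)
  qed simp
qed

text \<open>The middle conjunct justifies the notation of the last: the \<open>THE\<close> in
  \<open>random_average_age\<close> denotes an almost sure value, and the infimum over
  \<open>n\<close> is attained, so it is a minimum.\<close>

theorem theorem5:
  fixes \<epsilon> t0 a0 :: real and k :: nat
  assumes "0 \<le> \<epsilon>" and "\<epsilon> < 1" and "k \<ge> 2"
  shows
    "(\<forall>n\<ge>k. \<forall>\<delta>>0. \<exists>q0>0. \<forall>q\<ge>q0. primepow q \<longrightarrow>
        (\<forall>F :: 'a ring. galois_field q F \<longrightarrow>
          (AE (G, e) in random_scheme F \<epsilon> k n.
             \<exists>\<Delta>. has_average (age F k n t0 a0 G e) \<Delta> \<and>
                 \<bar>\<Delta> - age_lower_bound \<epsilon> k t0 n\<bar> < \<delta>)))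
     \<and>
     (\<forall>q. primepow q \<longrightarrow>
        (\<forall>F :: 'a ring. galois_field q F \<longrightarrow>
          (\<forall>n\<ge>k. AE (G, e) in random_scheme F \<epsilon> k n.
             has_average (age F k n t0 a0 G e) (random_average_age F \<epsilon> k t0 a0 n)) \<and>
          (\<exists>n\<ge>k. \<forall>n'\<ge>k. random_average_age F \<epsilon> k t0 a0 n \<le> random_average_age F \<epsilon> k t0 a0 n')))
     \<and>
     (\<forall>\<delta>>0. \<exists>q0>0. \<forall>q\<ge>q0. primepow q \<longrightarrow>
        (\<forall>F :: 'a ring. galois_field q F \<longrightarrow>
          \<bar>optimal_linear_age F \<epsilon> k t0 a0 - (INF n\<in>{k..}. random_average_age F \<epsilon> k t0 a0 n)\<bar> < \<delta>))"
proof (intro conjI)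
  note \<epsilon> = assms(1,2)
  have k: "1 \<le> k" using assms(3) by simp
  have columns: "finite_field_columns F q k" if "galois_field q F" for F :: "'a ring" and q
    using that k by (rule finite_field_columns.intro)
  have AE: "AE (G, e) in random_scheme F \<epsilon> k n. has_average (age F k n t0 a0 G e) (random_age_value F \<epsilon> k t0 n)"
    if "galois_field q F" "k \<le> n" for F :: "'a ring" and q n
    using finite_field_columns.AE_has_average_random_scheme[OF columns[OF that(1)] \<epsilon> that(2)]
    by (simp add: case_prod_beta)
  have average_eq: "random_average_age F \<epsilon> k t0 a0 n = random_age_value F \<epsilon> k t0 n"
    if "galois_field q F" "k \<le> n" for F :: "'a ring" and q n
    by (rule finite_field_columns.random_average_age_eq[OF columns[OF that(1)] \<epsilon> that(2)])

  show "\<forall>n\<ge>k. \<forall>\<delta>>0. \<exists>q0>0. \<forall>q\<ge>q0. primepow q \<longrightarrow>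
        (\<forall>F :: 'a ring. galois_field q F \<longrightarrow>
          (AE (G, e) in random_scheme F \<epsilon> k n.
             \<exists>\<Delta>. has_average (age F k n t0 a0 G e) \<Delta> \<and>
                 \<bar>\<Delta> - age_lower_bound \<epsilon> k t0 n\<bar> < \<delta>))"
  proof (intro allI impI)
    fix n \<delta> assume n: "k \<le> n" and \<delta>: "(0 :: real) < \<delta>"
    obtain q0 where q0: "0 < q0" "\<And>q F. q0 \<le> q \<Longrightarrow> galois_field q (F :: 'a ring) \<Longrightarrow>
        \<bar>random_age_value F \<epsilon> k t0 n - age_lower_bound \<epsilon> k t0 n\<bar> < \<delta>"
      using random_age_value_near_lower_bound[OF \<epsilon> k n \<delta>, where ?t0.0 = t0 and ?'a = 'a] by blast
    show "\<exists>q0>0. \<forall>q\<ge>q0. primepow q \<longrightarrow>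
        (\<forall>F :: 'a ring. galois_field q F \<longrightarrow>
          (AE (G, e) in random_scheme F \<epsilon> k n.
             \<exists>\<Delta>. has_average (age F k n t0 a0 G e) \<Delta> \<and>
                 \<bar>\<Delta> - age_lower_bound \<epsilon> k t0 n\<bar> < \<delta>))"
    proof (intro exI[of _ q0] conjI allI impI q0(1))
      fix q and F :: "'a ring" assume q: "q0 \<le> q" and F: "galois_field q F"
      show "AE (G, e) in random_scheme F \<epsilon> k n. \<exists>\<Delta>. has_average (age F k n t0 a0 G e) \<Delta> \<and>
                 \<bar>\<Delta> - age_lower_bound \<epsilon> k t0 n\<bar> < \<delta>"
        using AE[OF F n] by eventually_elim (use q0(2)[OF q F] in auto)
    qed
  qed

  show "\<forall>q. primepow q \<longrightarrow>
        (\<forall>F :: 'a ring. galois_field q F \<longrightarrow>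
          (\<forall>n\<ge>k. AE (G, e) in random_scheme F \<epsilon> k n.
             has_average (age F k n t0 a0 G e) (random_average_age F \<epsilon> k t0 a0 n)) \<and>
          (\<exists>n\<ge>k. \<forall>n'\<ge>k. random_average_age F \<epsilon> k t0 a0 n \<le> random_average_age F \<epsilon> k t0 a0 n'))"
  proof (intro allI impI conjI)
    fix q n and F :: "'a ring" assume F: "galois_field q F" and n: "k \<le> n"
    show "AE (G, e) in random_scheme F \<epsilon> k n. has_average (age F k n t0 a0 G e) (random_average_age F \<epsilon> k t0 a0 n)"
      unfolding average_eq[OF F n] by (rule AE[OF F n])
  next
    fix q and F :: "'a ring" assume F: "galois_field q F"
    show "\<exists>n\<ge>k. \<forall>n'\<ge>k. random_average_age F \<epsilon> k t0 a0 n \<le> random_average_age F \<epsilon> k t0 a0 n'"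
      using random_age_value_ge average_eq[OF F]
      by (intro exists_min_of_linear_growth) simp
  qed

  show "\<forall>\<delta>>0. \<exists>q0>0. \<forall>q\<ge>q0. primepow q \<longrightarrow>
        (\<forall>F :: 'a ring. galois_field q F \<longrightarrow>
          \<bar>optimal_linear_age F \<epsilon> k t0 a0 - (INF n\<in>{k..}. random_average_age F \<epsilon> k t0 a0 n)\<bar> < \<delta>)"
  proof (intro allI impI)
    fix \<delta> :: real assume \<delta>: "0 < \<delta>"
    \<comment> \<open>The minimizer \<open>m\<close> is chosen before \<open>q\<close>, since the
      lower bound does not depend on the field; a single approximation at \<open>m\<close> then
      suffices.\<close>
    have "\<exists>m\<ge>k. \<forall>n\<ge>k. age_lower_bound \<epsilon> k t0 m \<le> age_lower_bound \<epsilon> k t0 n"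
      by (intro exists_min_of_linear_growth age_lower_bound_ge[OF \<epsilon> k])
    then obtain m where m: "k \<le> m"
      and m_min: "\<And>n. k \<le> n \<Longrightarrow> age_lower_bound \<epsilon> k t0 m \<le> age_lower_bound \<epsilon> k t0 n"
      by blast
    obtain q0 where q0: "0 < q0" "\<And>q F. q0 \<le> q \<Longrightarrow> galois_field q (F :: 'a ring) \<Longrightarrow>
        \<bar>random_age_value F \<epsilon> k t0 m - age_lower_bound \<epsilon> k t0 m\<bar> < \<delta>"
      using random_age_value_near_lower_bound[OF \<epsilon> k m \<delta>, where ?t0.0 = t0 and ?'a = 'a] by blast
    show "\<exists>q0>0. \<forall>q\<ge>q0. primepow q \<longrightarrow> (\<forall>F :: 'a ring. galois_field q F \<longrightarrow>
          \<bar>optimal_linear_age F \<epsilon> k t0 a0 - (INF n\<in>{k..}. random_average_age F \<epsilon> k t0 a0 n)\<bar> < \<delta>)"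
    proof (intro exI[of _ q0] conjI allI impI q0(1))
      fix q and F :: "'a ring" assume q: "q0 \<le> q" and F: "galois_field q F"
      interpret finite_field_columns F q k by (rule columns[OF F])
      let ?L = "linear_average_ages F \<epsilon> k t0 a0"
      let ?r = "\<lambda>n. random_age_value F \<epsilon> k t0 n"
      have in_L: "?r n \<in> ?L" if "k \<le> n" for n
        by (rule random_age_value_in_linear_average_ages[OF \<epsilon> that])
      have L_ge: "age_lower_bound \<epsilon> k t0 m \<le> c" if "c \<in> ?L" for c
      proof -
        from linear_average_ages_ge[OF \<epsilon> that]
        obtain n where "k \<le> n" "age_lower_bound \<epsilon> k t0 n \<le> c" by auto
        then show ?thesis using m_min[of n] by linarith
      qed
      \<comment> \<open>The chain is: bound at \<open>m\<close> \<le> optimum \<le> infimum of the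
        random values \<le> random value at \<open>m\<close> < bound at \<open>m\<close> +
        \<delta>.\<close>
      have opt_ge: "age_lower_bound \<epsilon> k t0 m \<le> optimal_linear_age F \<epsilon> k t0 a0"
        unfolding optimal_linear_age_def by (rule cInf_greatest[OF _ L_ge]) (use in_L[OF m] in blast)
      have opt_le: "optimal_linear_age F \<epsilon> k t0 a0 \<le> ?r n" if "k \<le> n" for n
        unfolding optimal_linear_age_def by (rule cInf_lower[OF in_L[OF that] bdd_belowI[OF L_ge]])
      have inf: "(INF n\<in>{k..}. random_average_age F \<epsilon> k t0 a0 n) = (INF n\<in>{k..}. ?r n)"
        using average_eq[OF F] by (intro INF_cong) auto
      have "optimal_linear_age F \<epsilon> k t0 a0 \<le> (INF n\<in>{k..}. ?r n)"
        by (intro cINF_greatest opt_le) auto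
      moreover have "(INF n\<in>{k..}. ?r n) \<le> ?r m"
        using opt_le m by (intro cINF_lower bdd_belowI2) auto
      moreover have "?r m < age_lower_bound \<epsilon> k t0 m + \<delta>"
        using q0(2)[OF q F] by linarith
      ultimately show "\<bar>optimal_linear_age F \<epsilon> k t0 a0 - (INF n\<in>{k..}. random_average_age F \<epsilon> k t0 a0 n)\<bar> < \<delta>"
        unfolding inf using opt_ge by linarith
    qed
  qed
qed

end
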